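(* Let $n\ge 2$, let $G=\mathrm{SL}_n(\mathbb{C})$, let $V=(n+1)\mathbb{C}^n\oplus(n-1)(\mathbb{C}^n)^*$ and let $Z=V/\!\!/G$. Then $Z_m$ is normal for all $m\ge 0$ and $p_m^*\colon\mathcal{O}(Z_m)\to\mathcal{O}(V_m)^{G_m}$ is an isomorphism for $m=0,1,\dots,\infty$.
   Context: $k\mathbb{C}^n$ denotes the direct sum of $k$ copies of the standard representation $\mathbb{C}^n$, and $(\mathbb{C}^n)^*$ its dual. For a scheme $X$ of finite type over $\mathbb{C}$ and an integer $m\ge 0$, the jet scheme $X_m$ is characterized by functorial bijections $\mathrm{Hom}(\mathrm{Spec}\,A,X_m)\cong\mathrm{Hom}(\mathrm{Spec}\,A[t]/\langle t^{m+1}\rangle,X)$ for $\mathbb{C}$-algebras $A$; the arc space is $X_\infty=\varprojlim X_m$. $V/\!\!/G=\mathrm{Spec}(\mathcal{O}(V)^G)$ with canonical map $p\colon V\to V/\!\!/G$. By functoriality $G_m$ acts on $V_m$, and $p$ induces $p_m\colon V_m\to(V/\!\!/G)_m$ and $p_m^*\colon\mathcal{O}((V/\!\!/G)_m)\to\mathcal{O}(V_m)^{G_m}$. *)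

theory Defs
  imports
    Complex_Main
    "HOL-Library.Poly_Mapping"
    "HOL-Library.Extended_Nat"
    "HOL-Combinatorics.Permutations"
    "HOL-Algebra.Module"
    "HOL-Algebra.QuotRing"
    "HOL-Algebra.Polynomials"
begin

section \<open>Commutative complex algebras\<close>

text \<open>
  A complex algebra is a record \<open>A\<close> with \<open>algebra complex_alg A\<close>, where \<open>algebra\<close> is the locale of
  commutative unital algebras from the library. All schemes below are affine and are represented by
  their coordinate rings.
\<close>

definition complex_alg :: "(complex, complex) module" where
  "complex_alg =
     \<lparr>carrier = UNIV, mult = (*), one = 1, zero = 0, add = (+), smult = (*)\<rparr>"

definition alg_hom ::
  "(complex, 'a, 'c) module_scheme \<Rightarrow> (complex, 'b, 'd) module_scheme \<Rightarrow> ('a \<Rightarrow> 'b) set" where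
  "alg_hom A B =
     {f \<in> ring_hom A B. \<forall>c. \<forall>x\<in>carrier A. f (c \<odot>\<^bsub>A\<^esub> x) = c \<odot>\<^bsub>B\<^esub> f x}"

text \<open>
  The polynomial algebra in the variables \<open>S\<close>; a monomial is a finitely supported exponent function.
\<close>

type_synonym 'x mpoly = "('x \<Rightarrow>\<^sub>0 nat) \<Rightarrow>\<^sub>0 complex"

definition poly_alg :: "'x set \<Rightarrow> (complex, 'x mpoly) module" where
  "poly_alg S =
     \<lparr>carrier = {p. \<forall>\<mu>\<in>Poly_Mapping.keys p. Poly_Mapping.keys \<mu> \<subseteq> S},
      mult = (*), one = 1, zero = 0, add = (+),
      smult = (\<lambda>c p. Poly_Mapping.single 0 c * p)\<rparr>"

definition poly_var :: "'x \<Rightarrow> 'x mpoly" where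
  "poly_var x = Poly_Mapping.single (Poly_Mapping.single x 1) 1"

definition poly_eval ::
  "(complex, 'a, 'c) module_scheme \<Rightarrow> ('x \<Rightarrow> 'a) \<Rightarrow> 'x mpoly \<Rightarrow> 'a" where
  "poly_eval A v p =
     (\<Oplus>\<^bsub>A\<^esub>\<mu>\<in>Poly_Mapping.keys p. Poly_Mapping.lookup p \<mu> \<odot>\<^bsub>A\<^esub>
        (\<Otimes>\<^bsub>A\<^esub>x\<in>Poly_Mapping.keys \<mu>. v x [^]\<^bsub>A\<^esub> Poly_Mapping.lookup \<mu> x))"

text \<open>The ring \<open>A Quot I\<close> with its induced complex algebra structure.\<close>

definition quot_alg ::
  "(complex, 'a, 'c) module_scheme \<Rightarrow> 'a set \<Rightarrow> (complex, 'a set) module" where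
  "quot_alg A I =
     \<lparr>carrier = carrier (A Quot I), mult = mult (A Quot I), one = one (A Quot I),
      zero = zero (A Quot I), add = add (A Quot I),
      smult = (\<lambda>c C. \<Union>x\<in>C. I +>\<^bsub>A\<^esub> (c \<odot>\<^bsub>A\<^esub> x))\<rparr>"


section \<open>Jet schemes and arc spaces\<close>

text \<open>
  \<open>jet_ring m A\<close> is \<open>A[t]/(t^(m+1))\<close> for finite \<open>m\<close> and \<open>A[[t]]\<close> for \<open>m = \<infinity>\<close>; an element is its
  sequence of coefficients. For an affine scheme \<open>X\<close>, an \<open>A\<close>-point of the inverse limit \<open>X\<^sub>\<infinity>\<close> of the
  jet schemes is a compatible family of \<open>A[t]/(t^(m+1))\<close>-points of \<open>X\<close>, that is, an \<open>A[[t]]\<close>-point.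
\<close>

definition jet_ring ::
  "enat \<Rightarrow> (complex, 'a, 'c) module_scheme \<Rightarrow> (complex, nat \<Rightarrow> 'a) module" where
  "jet_ring m A =
     \<lparr>carrier = {f. (\<forall>k. f k \<in> carrier A) \<and> (\<forall>k. enat k > m \<longrightarrow> f k = \<zero>\<^bsub>A\<^esub>)},
      mult = (\<lambda>f g k. if enat k \<le> m then \<Oplus>\<^bsub>A\<^esub>i\<in>{..k}. f i \<otimes>\<^bsub>A\<^esub> g (k - i) else \<zero>\<^bsub>A\<^esub>),
      one = (\<lambda>k. if k = 0 then \<one>\<^bsub>A\<^esub> else \<zero>\<^bsub>A\<^esub>),
      zero = (\<lambda>k. \<zero>\<^bsub>A\<^esub>),
      add = (\<lambda>f g k. f k \<oplus>\<^bsub>A\<^esub> g k),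
      smult = (\<lambda>c f k. c \<odot>\<^bsub>A\<^esub> f k)\<rparr>"

text \<open>
  The coordinate ring of the \<open>m\<close>-th jet scheme of \<open>Spec R\<close> (of its arc space if \<open>m = \<infinity>\<close>): the algebra
  generated by symbols \<open>(r, k)\<close> with \<open>r \<in> R\<close> and \<open>k \<le> m\<close>, standing for the \<open>k\<close>-th coefficient of \<open>r\<close>
  along the universal jet, modulo the relations saying that \<open>r \<mapsto> (\<Sum>k. (r, k) t^k)\<close> is a homomorphism
  of algebras. That it represents the functor \<open>A \<mapsto> Hom(Spec (jet_ring m A), Spec R)\<close> is proved
  in \<open>jet_alg_universal\<close> below.
\<close>

definition jet_rels ::
  "enat \<Rightarrow> (complex, 'a, 'c) module_scheme \<Rightarrow> ('a \<times> nat) mpoly set" where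
  "jet_rels m R =
     {poly_var (a \<oplus>\<^bsub>R\<^esub> b, k) - (poly_var (a, k) + poly_var (b, k)) | a b k.
        a \<in> carrier R \<and> b \<in> carrier R \<and> enat k \<le> m} \<union>
     {poly_var (a \<otimes>\<^bsub>R\<^esub> b, k) - (\<Sum>i\<le>k. poly_var (a, i) * poly_var (b, k - i)) | a b k.
        a \<in> carrier R \<and> b \<in> carrier R \<and> enat k \<le> m} \<union>
     {poly_var (c \<odot>\<^bsub>R\<^esub> \<one>\<^bsub>R\<^esub>, k) - Poly_Mapping.single 0 (if k = 0 then c else 0) | c k.
        enat k \<le> m}"

definition jet_symbols :: "enat \<Rightarrow> (complex, 'a, 'c) module_scheme \<Rightarrow> ('a \<times> nat) set" where
  "jet_symbols m R = carrier R \<times> {k. enat k \<le> m}"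

definition jet_ideal ::
  "enat \<Rightarrow> (complex, 'a, 'c) module_scheme \<Rightarrow> ('a \<times> nat) mpoly set" where
  "jet_ideal m R = genideal (poly_alg (jet_symbols m R)) (jet_rels m R)"

definition jet_alg ::
  "enat \<Rightarrow> (complex, 'a, 'c) module_scheme \<Rightarrow> (complex, ('a \<times> nat) mpoly set) module" where
  "jet_alg m R = quot_alg (poly_alg (jet_symbols m R)) (jet_ideal m R)"

text \<open>The universal jet, a homomorphism from \<open>R\<close> to \<open>jet_ring m (jet_alg m R)\<close>.\<close>

definition jet_univ ::
  "enat \<Rightarrow> (complex, 'a, 'c) module_scheme \<Rightarrow> 'a \<Rightarrow> nat \<Rightarrow> ('a \<times> nat) mpoly set" where
  "jet_univ m R r k =
     (if enat k \<le> m
      then jet_ideal m R +>\<^bsub>poly_alg (jet_symbols m R)\<^esub> poly_var (r, k)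
      else \<zero>\<^bsub>jet_alg m R\<^esub>)"

text \<open>
  For \<open>\<phi> : R \<rightarrow> jet_ring m A\<close>, the homomorphism \<open>jet_alg m R \<rightarrow> A\<close> (that is, the \<open>A\<close>-point of
  the jet scheme) corresponding to \<open>\<phi>\<close>.
\<close>

definition jet_lift ::
  "(complex, 'b, 'd) module_scheme \<Rightarrow> ('a \<Rightarrow> nat \<Rightarrow> 'b) \<Rightarrow> ('a \<times> nat) mpoly set \<Rightarrow> 'b" where
  "jet_lift A \<phi> F = the_elem (poly_eval A (\<lambda>(r, k). \<phi> r k) ` F)"

text \<open>Functoriality: the homomorphism \<open>jet_alg m R \<rightarrow> jet_alg m S\<close> induced by \<open>f : R \<rightarrow> S\<close>.\<close>

definition jet_map ::
  "enat \<Rightarrow> (complex, 'b, 'd) module_scheme \<Rightarrow> ('a \<Rightarrow> 'b) \<Rightarrow>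
   ('a \<times> nat) mpoly set \<Rightarrow> ('b \<times> nat) mpoly set" where
  "jet_map m S f = jet_lift (jet_alg m S) (\<lambda>r. jet_univ m S (f r))"


section \<open>Normality\<close>

text \<open>
  The fraction \<open>a/s\<close> in the localization of \<open>R\<close> at a multiplicative set \<open>S\<close> is the class of \<open>(a, s)\<close>.
\<close>

definition frac_rel :: "('a, 'c) ring_scheme \<Rightarrow> 'a set \<Rightarrow> (('a \<times> 'a) \<times> ('a \<times> 'a)) set" where
  "frac_rel R S =
     {((a, s), (b, t)) | a s b t. a \<in> carrier R \<and> b \<in> carrier R \<and> s \<in> S \<and> t \<in> S \<and>
        (\<exists>u\<in>S. u \<otimes>\<^bsub>R\<^esub> (a \<otimes>\<^bsub>R\<^esub> t) = u \<otimes>\<^bsub>R\<^esub> (b \<otimes>\<^bsub>R\<^esub> s))}"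

definition fraction :: "('a, 'c) ring_scheme \<Rightarrow> 'a set \<Rightarrow> 'a \<Rightarrow> 'a \<Rightarrow> ('a \<times> 'a) set" where
  "fraction R S a s = frac_rel R S `` {(a, s)}"

definition localization :: "('a, 'c) ring_scheme \<Rightarrow> 'a set \<Rightarrow> ('a \<times> 'a) set ring" where
  "localization R S =
     \<lparr>carrier = (carrier R \<times> S) // frac_rel R S,
      mult = (\<lambda>C D. \<Union>(a, s)\<in>C. \<Union>(b, t)\<in>D. fraction R S (a \<otimes>\<^bsub>R\<^esub> b) (s \<otimes>\<^bsub>R\<^esub> t)),
      one = fraction R S \<one>\<^bsub>R\<^esub> \<one>\<^bsub>R\<^esub>,
      zero = fraction R S \<zero>\<^bsub>R\<^esub> \<one>\<^bsub>R\<^esub>,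
      add = (\<lambda>C D. \<Union>(a, s)\<in>C. \<Union>(b, t)\<in>D.
               fraction R S ((a \<otimes>\<^bsub>R\<^esub> t) \<oplus>\<^bsub>R\<^esub> (b \<otimes>\<^bsub>R\<^esub> s)) (s \<otimes>\<^bsub>R\<^esub> t))\<rparr>"

text \<open>Library polynomials are coefficient lists with the leading coefficient first.\<close>

definition integral_over :: "('a, 'c) ring_scheme \<Rightarrow> 'a set \<Rightarrow> 'a \<Rightarrow> bool" where
  "integral_over K A x \<longleftrightarrow>
     (\<exists>p \<in> carrier (univ_poly K A).
        p \<noteq> [] \<and> lead_coeff p = \<one>\<^bsub>K\<^esub> \<and> ring.eval K p x = \<zero>\<^bsub>K\<^esub>)"

definition integrally_closed_domain :: "('a, 'c) ring_scheme \<Rightarrow> bool" where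
  "integrally_closed_domain R \<longleftrightarrow> domain R \<and>
     (let S = carrier R - {\<zero>\<^bsub>R\<^esub>};
          K = localization R S;
          R' = (\<lambda>a. fraction R S a \<one>\<^bsub>R\<^esub>) ` carrier R
      in \<forall>x \<in> carrier K. integral_over K R' x \<longrightarrow> x \<in> R')"

text \<open>\<open>Spec R\<close> is normal: all its local rings are integrally closed domains.\<close>

definition normal_ring :: "('a, 'c) ring_scheme \<Rightarrow> bool" where
  "normal_ring R \<longleftrightarrow>
     (\<forall>P. primeideal P R \<longrightarrow> integrally_closed_domain (localization R (carrier R - P)))"


section \<open>The special linear group and its representation\<close>

definition ring_det :: "('a, 'c) ring_scheme \<Rightarrow> nat \<Rightarrow> (nat \<times> nat \<Rightarrow> 'a) \<Rightarrow> 'a" where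
  "ring_det B n g =
     (\<Oplus>\<^bsub>B\<^esub>\<sigma>\<in>{\<sigma>. \<sigma> permutes {..<n}}.
        (if evenperm \<sigma> then \<one>\<^bsub>B\<^esub> else \<ominus>\<^bsub>B\<^esub> \<one>\<^bsub>B\<^esub>) \<otimes>\<^bsub>B\<^esub> (\<Otimes>\<^bsub>B\<^esub>i\<in>{..<n}. g (i, \<sigma> i)))"

definition SL :: "('a, 'c) ring_scheme \<Rightarrow> nat \<Rightarrow> (nat \<times> nat \<Rightarrow> 'a) monoid" where
  "SL B n =
     \<lparr>carrier = {g \<in> {..<n} \<times> {..<n} \<rightarrow>\<^sub>E carrier B. ring_det B n g = \<one>\<^bsub>B\<^esub>},
      mult = (\<lambda>g h. \<lambda>(i, j) \<in> {..<n} \<times> {..<n}. \<Oplus>\<^bsub>B\<^esub>k\<in>{..<n}. g (i, k) \<otimes>\<^bsub>B\<^esub> h (k, j)),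
      one = (\<lambda>(i, j) \<in> {..<n} \<times> {..<n}. if i = j then \<one>\<^bsub>B\<^esub> else \<zero>\<^bsub>B\<^esub>)\<rparr>"

text \<open>
  The coordinate functions on \<open>V\<close>: \<open>Vec i j\<close> is the \<open>j\<close>-th coordinate of the \<open>i\<close>-th vector and
  \<open>Covec i j\<close> the \<open>j\<close>-th coordinate (in the dual basis) of the \<open>i\<close>-th linear form.
\<close>

datatype coord = Vec nat nat | Covec nat nat

definition coords :: "nat \<Rightarrow> coord set" where
  "coords n = {Vec i j | i j. i < n + 1 \<and> j < n} \<union> {Covec i j | i j. i < n - 1 \<and> j < n}"

definition V_points :: "('a, 'c) ring_scheme \<Rightarrow> nat \<Rightarrow> (coord \<Rightarrow> 'a) set" where
  "V_points B n = coords n \<rightarrow>\<^sub>E carrier B"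

text \<open>
  The action of \<open>SL B n\<close> on the \<open>B\<close>-points of \<open>V\<close>: \<open>g\<close> sends a column vector \<open>x\<close> to \<open>g x\<close> and a
  linear form \<open>\<xi>\<close>, written as a row vector, to \<open>\<xi> g\<close> with \<open>g\<close> replaced by its inverse.
\<close>

definition V_act ::
  "('a, 'c) ring_scheme \<Rightarrow> nat \<Rightarrow> (nat \<times> nat \<Rightarrow> 'a) \<Rightarrow> (coord \<Rightarrow> 'a) \<Rightarrow> coord \<Rightarrow> 'a" where
  "V_act B n g v = restrict
     (\<lambda>z. case z of
        Vec i j \<Rightarrow> \<Oplus>\<^bsub>B\<^esub>l\<in>{..<n}. g (j, l) \<otimes>\<^bsub>B\<^esub> v (Vec i l)
      | Covec i j \<Rightarrow> \<Oplus>\<^bsub>B\<^esub>l\<in>{..<n}. v (Covec i l) \<otimes>\<^bsub>B\<^esub> (inv\<^bsub>SL B n\<^esub> g) (l, j))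
     (coords n)"

abbreviation O_V :: "nat \<Rightarrow> (complex, coord mpoly) module" where
  "O_V n \<equiv> poly_alg (coords n)"

text \<open>The coordinate ring of \<open>Z = V//G\<close>, the invariant polynomials.\<close>

definition O_Z :: "nat \<Rightarrow> (complex, coord mpoly) module" where
  "O_Z n = (O_V n)
     \<lparr>carrier := {f \<in> carrier (O_V n).
        \<forall>g \<in> carrier (SL complex_alg n). \<forall>v \<in> V_points complex_alg n.
          poly_eval complex_alg (V_act complex_alg n g v) f = poly_eval complex_alg v f}\<rparr>"

text \<open>
  The value of a regular function \<open>F\<close> on the jet scheme of \<open>V\<close> at its complex point \<open>v\<close>, where
  \<open>v\<close> is a point of \<open>V\<close> over \<open>B = jet_ring m complex_alg\<close>, that is, the homomorphism
  from \<open>O(V)\<close> to \<open>B\<close> given by evaluation at \<open>v\<close>.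
\<close>

definition jet_value :: "enat \<Rightarrow> (coord \<Rightarrow> nat \<Rightarrow> complex) \<Rightarrow> (coord mpoly \<times> nat) mpoly set \<Rightarrow> complex"
  where
  "jet_value m v F = jet_lift complex_alg (\<lambda>f. poly_eval (jet_ring m complex_alg) v f) F"

text \<open>
  The invariants in the coordinate ring of the \<open>m\<close>-th jet scheme \<open>V\<^sub>m\<close> of \<open>V\<close> under the \<open>m\<close>-th jet
  scheme \<open>G\<^sub>m\<close> of \<open>G\<close>: the regular functions that are constant on the orbits of the complex points.
  The complex points of \<open>G\<^sub>m\<close> are the points of \<open>G\<close> over \<open>jet_ring m complex_alg\<close>.
\<close>

definition O_Vm_inv :: "enat \<Rightarrow> nat \<Rightarrow> (complex, (coord mpoly \<times> nat) mpoly set) module" where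
  "O_Vm_inv m n = (jet_alg m (O_V n))
     \<lparr>carrier := {F \<in> carrier (jet_alg m (O_V n)).
        \<forall>g \<in> carrier (SL (jet_ring m complex_alg) n). \<forall>v \<in> V_points (jet_ring m complex_alg) n.
          jet_value m (V_act (jet_ring m complex_alg) n g v) F = jet_value m v F}\<rparr>"

text \<open>
  The comorphism of \<open>p\<^sub>m\<close>: the comorphism of \<open>p\<close> is the inclusion of \<open>O_Z n\<close> into \<open>O_V n\<close>.
\<close>

definition pm_star ::
  "enat \<Rightarrow> nat \<Rightarrow> (coord mpoly \<times> nat) mpoly set \<Rightarrow> (coord mpoly \<times> nat) mpoly set" where
  "pm_star m n = jet_map m (O_V n) (\<lambda>f. f)"


section \<open>Polynomial algebras\<close>

lemma cring_complex_alg: "cring complex_alg"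
proof (rule cringI)
  show "abelian_group complex_alg"
    by (rule abelian_groupI) (auto simp: complex_alg_def intro: exI[of _ "- x" for x])
  show "comm_monoid complex_alg"
    by (rule comm_monoidI) (auto simp: complex_alg_def)
qed (auto simp: complex_alg_def algebra_simps)

lemma algebra_complex_alg: "algebra complex_alg complex_alg"
  by (rule algebraI[OF cring_complex_alg cring_complex_alg])
     (auto simp: complex_alg_def algebra_simps)

lemma poly_alg_mult_closed:
  assumes "p \<in> carrier (poly_alg S)" "q \<in> carrier (poly_alg S)"
  shows "p * q \<in> carrier (poly_alg S)"
proof -
  have "Poly_Mapping.keys \<mu> \<subseteq> S" if \<mu>: "\<mu> \<in> Poly_Mapping.keys (p * q)" for \<mu>
  proof -
    obtain a b where "\<mu> = a + b" "a \<in> Poly_Mapping.keys p" "b \<in> Poly_Mapping.keys q"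
      using \<mu> Poly_Mapping.keys_mult[of p q] by blast
    thus ?thesis using assms Poly_Mapping.keys_add[of a b] by (fastforce simp: poly_alg_def)
  qed
  thus ?thesis by (simp add: poly_alg_def)
qed

lemma poly_alg_add_closed:
  "p \<in> carrier (poly_alg S) \<Longrightarrow> q \<in> carrier (poly_alg S) \<Longrightarrow> p + q \<in> carrier (poly_alg S)"
  using Poly_Mapping.keys_add[of p q] by (fastforce simp: poly_alg_def)

lemma poly_alg_const_closed: "Poly_Mapping.single 0 c \<in> carrier (poly_alg S)"
  by (auto simp: poly_alg_def)

lemma poly_var_closed: "x \<in> S \<Longrightarrow> poly_var x \<in> carrier (poly_alg S)"
  by (auto simp: poly_alg_def poly_var_def)

lemma single_closed: "Poly_Mapping.keys \<mu> \<subseteq> S \<Longrightarrow> Poly_Mapping.single \<mu> c \<in> carrier (poly_alg S)"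
  by (auto simp: poly_alg_def)

lemma poly_alg_uminus_closed:
  "p \<in> carrier (poly_alg S) \<Longrightarrow> - p \<in> carrier (poly_alg S)"
  by (auto simp: poly_alg_def in_keys_iff)

lemma poly_alg_simps:
  "\<zero>\<^bsub>poly_alg S\<^esub> = 0" "\<one>\<^bsub>poly_alg S\<^esub> = 1" "p \<oplus>\<^bsub>poly_alg S\<^esub> q = p + q"
  "p \<otimes>\<^bsub>poly_alg S\<^esub> q = p * q" "c \<odot>\<^bsub>poly_alg S\<^esub> p = Poly_Mapping.single 0 c * p"
  by (simp_all add: poly_alg_def)

lemma cring_poly_alg: "cring (poly_alg S)"
proof (rule cringI)
  show "abelian_group (poly_alg S)"
  proof (rule abelian_groupI)
    fix x assume "x \<in> carrier (poly_alg S)"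
    thus "\<exists>y\<in>carrier (poly_alg S). y \<oplus>\<^bsub>poly_alg S\<^esub> x = \<zero>\<^bsub>poly_alg S\<^esub>"
      by (intro bexI[of _ "- x"]) (auto simp: poly_alg_uminus_closed, simp add: poly_alg_def)
  qed (use poly_alg_add_closed[of _ S] poly_alg_const_closed[of 0 S] in
        \<open>auto simp: poly_alg_simps add_ac\<close>)
  show "comm_monoid (poly_alg S)"
    by (rule comm_monoidI)
       (use poly_alg_mult_closed[of _ S] poly_alg_const_closed[of 1 S] in
         \<open>auto simp: poly_alg_simps mult_ac\<close>)
qed (auto simp: poly_alg_simps algebra_simps)

lemma algebra_poly_alg: "algebra complex_alg (poly_alg S)"
proof (rule algebraI[OF cring_complex_alg cring_poly_alg])
  fix a :: complex and x assume "x \<in> carrier (poly_alg S)"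
  thus "a \<odot>\<^bsub>poly_alg S\<^esub> x \<in> carrier (poly_alg S)"
    using poly_alg_mult_closed[OF poly_alg_const_closed[of a S]] by (auto simp: poly_alg_simps)
qed (auto simp: poly_alg_simps complex_alg_def single_add algebra_simps mult_single)

lemma poly_induct [consumes 1, case_names zero add]:
  assumes p: "p \<in> carrier (poly_alg S)"
    and 0: "P 0"
    and step: "\<And>p \<mu> c. p \<in> carrier (poly_alg S) \<Longrightarrow> Poly_Mapping.keys \<mu> \<subseteq> S \<Longrightarrow> P p \<Longrightarrow>
                 P (p + Poly_Mapping.single \<mu> c)"
  shows "P p"
  using p
proof (induction p rule: update_induct)
  case const
  show ?case by (rule 0)
next
  case (update f a b)
  have eq: "Poly_Mapping.update a b f = f + Poly_Mapping.single a b"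
    using update(1)
    by (intro poly_mapping_eqI)
       (auto simp: lookup_add lookup_single lookup_update in_keys_iff when_def)
  have k: "Poly_Mapping.keys (Poly_Mapping.update a b f) = insert a (Poly_Mapping.keys f)"
    using update(2) by (simp add: keys_update)
  show ?case unfolding eq
    by (rule step) (use update k in \<open>auto simp: poly_alg_def\<close>)
qed

definition monom_eval ::
  "(complex, 'a, 'c) module_scheme \<Rightarrow> ('x \<Rightarrow> 'a) \<Rightarrow> ('x \<Rightarrow>\<^sub>0 nat) \<Rightarrow> 'a" where
  "monom_eval A v \<mu> = (\<Otimes>\<^bsub>A\<^esub>x\<in>Poly_Mapping.keys \<mu>. v x [^]\<^bsub>A\<^esub> Poly_Mapping.lookup \<mu> x)"

context
  fixes A :: "(complex, 'a, 'c) module_scheme" and S :: "'x set" and v :: "'x \<Rightarrow> 'a"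
  assumes A: "algebra complex_alg A" and v: "\<And>x. x \<in> S \<Longrightarrow> v x \<in> carrier A"
begin

interpretation AA: cring A by (rule algebra.M_cring[OF A])
interpretation algebra complex_alg A by (rule A)

lemma monom_eval_superset:
  assumes "finite T" "Poly_Mapping.keys \<mu> \<subseteq> T" "T \<subseteq> S"
  shows "monom_eval A v \<mu> = (\<Otimes>\<^bsub>A\<^esub>x\<in>T. v x [^]\<^bsub>A\<^esub> Poly_Mapping.lookup \<mu> x)"
  unfolding monom_eval_def
  by (rule AA.finprod_mono_neutral_cong_left) (use assms v in \<open>auto simp: in_keys_iff\<close>)

lemma monom_eval_closed: "Poly_Mapping.keys \<mu> \<subseteq> S \<Longrightarrow> monom_eval A v \<mu> \<in> carrier A"
  unfolding monom_eval_def by (intro AA.finprod_closed) (use v in auto)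

lemma monom_eval_add:
  assumes "Poly_Mapping.keys \<mu> \<subseteq> S" "Poly_Mapping.keys \<nu> \<subseteq> S"
  shows "monom_eval A v (\<mu> + \<nu>) = monom_eval A v \<mu> \<otimes>\<^bsub>A\<^esub> monom_eval A v \<nu>"
proof -
  let ?T = "Poly_Mapping.keys \<mu> \<union> Poly_Mapping.keys \<nu>"
  have T: "finite ?T" "?T \<subseteq> S" using assms by auto
  have vT: "v x \<in> carrier A" if "x \<in> ?T" for x using that assms v by auto
  have "monom_eval A v (\<mu> + \<nu>) = (\<Otimes>\<^bsub>A\<^esub>x\<in>?T. v x [^]\<^bsub>A\<^esub> Poly_Mapping.lookup (\<mu> + \<nu>) x)"
    by (rule monom_eval_superset) (use T Poly_Mapping.keys_add[of \<mu> \<nu>] in auto)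
  also have "\<dots> = (\<Otimes>\<^bsub>A\<^esub>x\<in>?T. v x [^]\<^bsub>A\<^esub> Poly_Mapping.lookup \<mu> x \<otimes>\<^bsub>A\<^esub>
                                v x [^]\<^bsub>A\<^esub> Poly_Mapping.lookup \<nu> x)"
    by (rule AA.finprod_cong') (use vT in \<open>auto simp: lookup_add AA.nat_pow_mult\<close>)
  also have "\<dots> = (\<Otimes>\<^bsub>A\<^esub>x\<in>?T. v x [^]\<^bsub>A\<^esub> Poly_Mapping.lookup \<mu> x) \<otimes>\<^bsub>A\<^esub>
                  (\<Otimes>\<^bsub>A\<^esub>x\<in>?T. v x [^]\<^bsub>A\<^esub> Poly_Mapping.lookup \<nu> x)"
    by (rule AA.finprod_multf) (use vT in auto)
  also have "\<dots> = monom_eval A v \<mu> \<otimes>\<^bsub>A\<^esub> monom_eval A v \<nu>"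
    by (subst (1 2) monom_eval_superset[of ?T]) (use T in auto)
  finally show ?thesis .
qed

lemma poly_eval_superset:
  assumes "finite T" "Poly_Mapping.keys p \<subseteq> T" "\<And>\<mu>. \<mu> \<in> T \<Longrightarrow> Poly_Mapping.keys \<mu> \<subseteq> S"
  shows "poly_eval A v p = (\<Oplus>\<^bsub>A\<^esub>\<mu>\<in>T. Poly_Mapping.lookup p \<mu> \<odot>\<^bsub>A\<^esub> monom_eval A v \<mu>)"
  unfolding poly_eval_def monom_eval_def[symmetric]
  by (rule AA.add.finprod_mono_neutral_cong_left)
     (use assms monom_eval_closed smult_l_null in
       \<open>auto simp: in_keys_iff complex_alg_def intro!: smult_closed\<close>)

lemma poly_eval_closed: "p \<in> carrier (poly_alg S) \<Longrightarrow> poly_eval A v p \<in> carrier A"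
  unfolding poly_eval_def monom_eval_def[symmetric]
  by (intro AA.finsum_closed)
     (use monom_eval_closed in \<open>auto simp: complex_alg_def poly_alg_def intro!: smult_closed\<close>)

lemma poly_eval_add:
  assumes p: "p \<in> carrier (poly_alg S)" and q: "q \<in> carrier (poly_alg S)"
  shows "poly_eval A v (p + q) = poly_eval A v p \<oplus>\<^bsub>A\<^esub> poly_eval A v q"
proof -
  let ?T = "Poly_Mapping.keys p \<union> Poly_Mapping.keys q"
  have T: "finite ?T" "\<And>\<mu>. \<mu> \<in> ?T \<Longrightarrow> Poly_Mapping.keys \<mu> \<subseteq> S"
    using p q by (auto simp: poly_alg_def)
  have c: "c \<odot>\<^bsub>A\<^esub> monom_eval A v \<mu> \<in> carrier A" if "\<mu> \<in> ?T" for \<mu> c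
    by (rule smult_closed) (use T(2)[OF that] monom_eval_closed in \<open>auto simp: complex_alg_def\<close>)
  have "poly_eval A v (p + q) =
        (\<Oplus>\<^bsub>A\<^esub>\<mu>\<in>?T. Poly_Mapping.lookup (p + q) \<mu> \<odot>\<^bsub>A\<^esub> monom_eval A v \<mu>)"
    by (rule poly_eval_superset) (use T Poly_Mapping.keys_add[of p q] in auto)
  also have "\<dots> = (\<Oplus>\<^bsub>A\<^esub>\<mu>\<in>?T. Poly_Mapping.lookup p \<mu> \<odot>\<^bsub>A\<^esub> monom_eval A v \<mu> \<oplus>\<^bsub>A\<^esub>
                                Poly_Mapping.lookup q \<mu> \<odot>\<^bsub>A\<^esub> monom_eval A v \<mu>)"
  proof (rule AA.finsum_cong')
    fix \<mu> assume "\<mu> \<in> ?T"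
    thus "Poly_Mapping.lookup (p + q) \<mu> \<odot>\<^bsub>A\<^esub> monom_eval A v \<mu> =
          Poly_Mapping.lookup p \<mu> \<odot>\<^bsub>A\<^esub> monom_eval A v \<mu> \<oplus>\<^bsub>A\<^esub>
          Poly_Mapping.lookup q \<mu> \<odot>\<^bsub>A\<^esub> monom_eval A v \<mu>"
      using smult_l_distr[of "Poly_Mapping.lookup p \<mu>" "Poly_Mapping.lookup q \<mu>" "monom_eval A v \<mu>"]
            monom_eval_closed[OF T(2)] by (simp add: lookup_add complex_alg_def)
  qed (use c in auto)
  also have "\<dots> = poly_eval A v p \<oplus>\<^bsub>A\<^esub> poly_eval A v q"
    by (subst AA.finsum_addf, use c in blast, use c in blast)
       (simp add: poly_eval_superset[of ?T p] poly_eval_superset[of ?T q] T del: Un_iff)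
  finally show ?thesis .
qed

lemma poly_eval_single:
  assumes "Poly_Mapping.keys \<mu> \<subseteq> S"
  shows "poly_eval A v (Poly_Mapping.single \<mu> c) = c \<odot>\<^bsub>A\<^esub> monom_eval A v \<mu>"
proof -
  have "c \<odot>\<^bsub>A\<^esub> monom_eval A v \<mu> \<in> carrier A"
    by (rule smult_closed) (use monom_eval_closed assms in \<open>auto simp: complex_alg_def\<close>)
  thus ?thesis using assms by (subst poly_eval_superset[of "{\<mu>}"]) auto
qed

lemma poly_eval_zero: "poly_eval A v 0 = \<zero>\<^bsub>A\<^esub>"
  by (simp add: poly_eval_def)

lemma poly_eval_const: "poly_eval A v (Poly_Mapping.single 0 c) = c \<odot>\<^bsub>A\<^esub> \<one>\<^bsub>A\<^esub>"
  by (subst poly_eval_single) (auto simp: monom_eval_def)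

lemma poly_eval_var: "x \<in> S \<Longrightarrow> poly_eval A v (poly_var x) = v x"
  unfolding poly_var_def
  by (subst poly_eval_single) (use v smult_one in \<open>auto simp: monom_eval_def complex_alg_def\<close>)

lemma smult_mult:
  assumes "x \<in> carrier A" "y \<in> carrier A"
  shows "(c * d) \<odot>\<^bsub>A\<^esub> (x \<otimes>\<^bsub>A\<^esub> y) = (c \<odot>\<^bsub>A\<^esub> x) \<otimes>\<^bsub>A\<^esub> (d \<odot>\<^bsub>A\<^esub> y)"
proof -
  have C: "e \<in> carrier complex_alg" for e by (simp add: complex_alg_def)
  have "(c * d) \<odot>\<^bsub>A\<^esub> (x \<otimes>\<^bsub>A\<^esub> y) = c \<odot>\<^bsub>A\<^esub> (d \<odot>\<^bsub>A\<^esub> (x \<otimes>\<^bsub>A\<^esub> y))"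
    using smult_assoc1[OF C[of c] C[of d], of "x \<otimes>\<^bsub>A\<^esub> y"] assms by (simp add: complex_alg_def)
  also have "d \<odot>\<^bsub>A\<^esub> (x \<otimes>\<^bsub>A\<^esub> y) = x \<otimes>\<^bsub>A\<^esub> (d \<odot>\<^bsub>A\<^esub> y)"
    using assms smult_assoc2[OF C[of d], of y x] smult_closed[OF C[of d], of y]
    by (simp add: AA.m_comm)
  also have "c \<odot>\<^bsub>A\<^esub> (x \<otimes>\<^bsub>A\<^esub> (d \<odot>\<^bsub>A\<^esub> y)) = (c \<odot>\<^bsub>A\<^esub> x) \<otimes>\<^bsub>A\<^esub> (d \<odot>\<^bsub>A\<^esub> y)"
    using assms smult_assoc2[OF C[of c], of x "d \<odot>\<^bsub>A\<^esub> y"] smult_closed[OF C[of d], of y] by simp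
  finally show ?thesis .
qed

lemma poly_eval_mult:
  assumes p: "p \<in> carrier (poly_alg S)" and q: "q \<in> carrier (poly_alg S)"
  shows "poly_eval A v (p * q) = poly_eval A v p \<otimes>\<^bsub>A\<^esub> poly_eval A v q"
proof -
  have 1: "poly_eval A v (Poly_Mapping.single \<mu> c * q) =
           (c \<odot>\<^bsub>A\<^esub> monom_eval A v \<mu>) \<otimes>\<^bsub>A\<^esub> poly_eval A v q"
    if \<mu>: "Poly_Mapping.keys \<mu> \<subseteq> S" for \<mu> c
    using q
  proof (induction q rule: poly_induct)
    case zero
    have "c \<odot>\<^bsub>A\<^esub> monom_eval A v \<mu> \<in> carrier A"
      by (rule smult_closed) (use monom_eval_closed \<mu> in \<open>auto simp: complex_alg_def\<close>)
    thus ?case by (simp add: poly_eval_zero)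
  next
    case (add p \<nu> d)
    have c: "e \<odot>\<^bsub>A\<^esub> monom_eval A v \<kappa> \<in> carrier A" if "Poly_Mapping.keys \<kappa> \<subseteq> S" for \<kappa> e
      by (rule smult_closed) (use monom_eval_closed that in \<open>auto simp: complex_alg_def\<close>)
    have k: "Poly_Mapping.keys (\<mu> + \<nu>) \<subseteq> S"
      using \<mu> add(2) Poly_Mapping.keys_add[of \<mu> \<nu>] by auto
    have "poly_eval A v (Poly_Mapping.single \<mu> c * (p + Poly_Mapping.single \<nu> d)) =
          poly_eval A v (Poly_Mapping.single \<mu> c * p) \<oplus>\<^bsub>A\<^esub>
          (c * d) \<odot>\<^bsub>A\<^esub> monom_eval A v (\<mu> + \<nu>)"
      unfolding distrib_left mult_single
      by (subst poly_eval_add)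
         (use k \<mu> add(1,2) in \<open>auto intro!: poly_alg_mult_closed single_closed simp: poly_eval_single\<close>)
    also have "\<dots> = (c \<odot>\<^bsub>A\<^esub> monom_eval A v \<mu>) \<otimes>\<^bsub>A\<^esub> poly_eval A v (p + Poly_Mapping.single \<nu> d)"
      using \<mu> add c[OF \<mu>, of c] c[OF add(2), of d]
      by (simp add: poly_eval_add single_closed poly_eval_single monom_eval_add smult_mult
            monom_eval_closed AA.r_distr poly_eval_closed)
    finally show ?case .
  qed
  show ?thesis using p
  proof (induction p rule: poly_induct)
    case zero
    show ?case using poly_eval_closed[OF q] by (simp add: poly_eval_zero)
  next
    case (add p \<nu> d)
    have c: "d \<odot>\<^bsub>A\<^esub> monom_eval A v \<nu> \<in> carrier A"
      by (rule smult_closed) (use monom_eval_closed add in \<open>auto simp: complex_alg_def\<close>)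
    show ?case
      using add q c
      by (simp add: distrib_right poly_eval_add poly_alg_mult_closed single_closed 1
            poly_eval_single AA.l_distr poly_eval_closed)
  qed
qed

lemma poly_eval_hom: "poly_eval A v \<in> alg_hom (poly_alg S) A"
proof -
  have C: "e \<in> carrier complex_alg" for e by (simp add: complex_alg_def)
  have "poly_eval A v \<in> ring_hom (poly_alg S) A"
  proof (rule ring_hom_memI)
    show "poly_eval A v \<one>\<^bsub>poly_alg S\<^esub> = \<one>\<^bsub>A\<^esub>"
      using poly_eval_const[of 1] smult_one by (simp add: poly_alg_simps complex_alg_def)
  qed (auto simp: poly_alg_simps poly_eval_closed poly_eval_add poly_eval_mult)
  moreover have "poly_eval A v (c \<odot>\<^bsub>poly_alg S\<^esub> p) = c \<odot>\<^bsub>A\<^esub> poly_eval A v p"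
    if p: "p \<in> carrier (poly_alg S)" for c p
    using smult_assoc2[OF C[of c], of "\<one>\<^bsub>A\<^esub>" "poly_eval A v p"] poly_eval_closed[OF p]
    by (simp add: poly_alg_simps poly_eval_mult[OF poly_alg_const_closed p] poly_eval_const)
  ultimately show ?thesis by (auto simp: alg_hom_def)
qed

end

lemma alg_homD:
  assumes "f \<in> alg_hom A B"
  shows "f \<in> ring_hom A B" "x \<in> carrier A \<Longrightarrow> f x \<in> carrier B"
    "x \<in> carrier A \<Longrightarrow> y \<in> carrier A \<Longrightarrow> f (x \<otimes>\<^bsub>A\<^esub> y) = f x \<otimes>\<^bsub>B\<^esub> f y"
    "x \<in> carrier A \<Longrightarrow> y \<in> carrier A \<Longrightarrow> f (x \<oplus>\<^bsub>A\<^esub> y) = f x \<oplus>\<^bsub>B\<^esub> f y"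
    "f \<one>\<^bsub>A\<^esub> = \<one>\<^bsub>B\<^esub>"
    "x \<in> carrier A \<Longrightarrow> f (c \<odot>\<^bsub>A\<^esub> x) = c \<odot>\<^bsub>B\<^esub> f x"
  using assms by (auto simp: alg_hom_def dest: ring_hom_memE)

text \<open>A homomorphism from a polynomial algebra is determined by the images of the variables.\<close>

lemma poly_hom_unique:
  assumes A: "algebra complex_alg A" and f: "f \<in> alg_hom (poly_alg S) A"
    and p: "p \<in> carrier (poly_alg S)"
  shows "f p = poly_eval A (\<lambda>x. f (poly_var x)) p"
proof -
  interpret AA: cring A by (rule algebra.M_cring[OF A])
  interpret PP: cring "poly_alg S" by (rule cring_poly_alg)
  interpret algebra complex_alg A by (rule A)
  interpret H: ring_hom_cring "poly_alg S" A f
    by unfold_locales (rule alg_homD(1)[OF f])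
  note fD = alg_homD[OF f, unfolded poly_alg_simps]
  have v: "f (poly_var x) \<in> carrier A" if "x \<in> S" for x
    using that by (intro fD poly_var_closed)
  have pow: "f (Poly_Mapping.single (Poly_Mapping.single x n) 1) = f (poly_var x) [^]\<^bsub>A\<^esub> n"
    if "x \<in> S" for x and n :: nat
  proof (induction n)
    case (Suc n)
    have "Poly_Mapping.single (Poly_Mapping.single x (Suc n)) (1::complex) =
          Poly_Mapping.single (Poly_Mapping.single x n) 1 * poly_var x"
      by (simp add: poly_var_def mult_single flip: single_add)
    moreover have "Poly_Mapping.single (Poly_Mapping.single x n) 1 \<in> carrier (poly_alg S)"
      using that by (intro single_closed) auto
    ultimately show ?case using that Suc by (simp add: fD(3) poly_var_closed)
  qed (use fD(5) in simp)
  have mon: "f (Poly_Mapping.single \<mu> 1) = monom_eval A (\<lambda>x. f (poly_var x)) \<mu>"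
    if "Poly_Mapping.keys \<mu> \<subseteq> S" for \<mu>
    using that
  proof (induction \<mu> rule: update_induct)
    case const
    show ?case using fD(5) by (simp add: monom_eval_def)
  next
    case (update \<mu> x n)
    have k: "Poly_Mapping.keys (Poly_Mapping.update x n \<mu>) = insert x (Poly_Mapping.keys \<mu>)"
      using update(2) by (simp add: keys_update)
    have x: "x \<in> S" "Poly_Mapping.keys \<mu> \<subseteq> S" using update(4) k by auto
    have eq: "Poly_Mapping.update x n \<mu> = \<mu> + Poly_Mapping.single x n"
      using update(1)
      by (intro poly_mapping_eqI)
         (auto simp: lookup_add lookup_single lookup_update in_keys_iff when_def)
    have ke: "Poly_Mapping.keys (Poly_Mapping.single x n) \<subseteq> S" using x by auto
    have "f (Poly_Mapping.single (\<mu> + Poly_Mapping.single x n) 1) =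
          f (Poly_Mapping.single \<mu> 1 * Poly_Mapping.single (Poly_Mapping.single x n) 1)"
      by (simp add: mult_single)
    also have "\<dots> = monom_eval A (\<lambda>x. f (poly_var x)) \<mu> \<otimes>\<^bsub>A\<^esub> f (poly_var x) [^]\<^bsub>A\<^esub> n"
      using x update(3) ke by (simp add: fD(3) single_closed pow)
    also have "f (poly_var x) [^]\<^bsub>A\<^esub> n = monom_eval A (\<lambda>x. f (poly_var x)) (Poly_Mapping.single x n)"
      using update(2) v[OF x(1)] by (simp add: monom_eval_def)
    also have "monom_eval A (\<lambda>x. f (poly_var x)) \<mu> \<otimes>\<^bsub>A\<^esub> \<dots> =
               monom_eval A (\<lambda>x. f (poly_var x)) (\<mu> + Poly_Mapping.single x n)"
      by (rule monom_eval_add[OF A v x(2) ke, symmetric])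
    finally show ?case by (simp add: eq)
  qed
  have sing: "f (Poly_Mapping.single \<mu> c) = c \<odot>\<^bsub>A\<^esub> f (Poly_Mapping.single \<mu> 1)"
    if "Poly_Mapping.keys \<mu> \<subseteq> S" for \<mu> c
    using fD(6)[of "Poly_Mapping.single \<mu> 1" c] single_closed[OF that] by (simp add: mult_single)
  show ?thesis using p
  proof (induction p rule: poly_induct)
    case zero
    have "f 0 = \<zero>\<^bsub>A\<^esub>" using H.hom_zero unfolding poly_alg_simps .
    thus ?case by (simp add: poly_eval_def)
  next
    case (add p \<mu> c)
    have "f (p + Poly_Mapping.single \<mu> c) = f p \<oplus>\<^bsub>A\<^esub> f (Poly_Mapping.single \<mu> c)"
      by (rule fD(4)[OF add(1) single_closed[OF add(2)]])
    also have "f (Poly_Mapping.single \<mu> c) = poly_eval A (\<lambda>x. f (poly_var x)) (Poly_Mapping.single \<mu> c)"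
      unfolding sing[OF add(2), of c] mon[OF add(2)] by (rule poly_eval_single[OF A v add(2), symmetric])
    also have "f p \<oplus>\<^bsub>A\<^esub> \<dots> = poly_eval A (\<lambda>x. f (poly_var x)) (p + Poly_Mapping.single \<mu> c)"
      unfolding add(3)
      by (rule poly_eval_add[OF A _ add(1) single_closed[OF add(2)], symmetric]) (rule v)
    finally show ?case .
  qed
qed


section \<open>The universal property of the jet algebra\<close>

lemma cring_quot_alg:
  assumes A: "algebra complex_alg A" and I: "ideal I A"
  shows "cring (quot_alg A I)"
proof -
  interpret Q: cring "A Quot I"
    by (rule ideal.quotient_is_cring[OF I algebra.M_cring[OF A]])
  have s: "carrier (quot_alg A I) = carrier (A Quot I)" "mult (quot_alg A I) = mult (A Quot I)"
     "one (quot_alg A I) = one (A Quot I)" "zero (quot_alg A I) = zero (A Quot I)"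
     "add (quot_alg A I) = add (A Quot I)"
    by (simp_all add: quot_alg_def)
  show ?thesis
  proof (rule cringI)
    show "abelian_group (quot_alg A I)"
      by (rule abelian_groupI) (auto simp: s Q.a_ac intro: Q.add.l_inv_ex)
    show "comm_monoid (quot_alg A I)"
      by (rule comm_monoidI) (auto simp: s Q.m_ac)
  qed (auto simp: s Q.l_distr)
qed

lemma quot_alg_proj:
  assumes A: "algebra complex_alg A" and I: "ideal I A"
  shows "(\<lambda>x. I +>\<^bsub>A\<^esub> x) \<in> alg_hom A (quot_alg A I)"
    and "carrier (quot_alg A I) = (\<lambda>x. I +>\<^bsub>A\<^esub> x) ` carrier A"
proof -
  interpret AA: cring A by (rule algebra.M_cring[OF A])
  interpret algebra complex_alg A by (rule A)
  interpret I: ideal I A by (rule I)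
  have C: "e \<in> carrier complex_alg" for e by (simp add: complex_alg_def)
  show "carrier (quot_alg A I) = (\<lambda>x. I +>\<^bsub>A\<^esub> x) ` carrier A"
    by (auto simp: quot_alg_def FactRing_def A_RCOSETS_def')
  have smult_I: "c \<odot>\<^bsub>A\<^esub> h \<in> I" if "h \<in> I" for c h
  proof -
    have "(c \<odot>\<^bsub>A\<^esub> \<one>\<^bsub>A\<^esub>) \<otimes>\<^bsub>A\<^esub> h = c \<odot>\<^bsub>A\<^esub> h"
      using smult_assoc2[OF C, of "\<one>\<^bsub>A\<^esub>" h c] I.Icarr[OF that] by simp
    thus ?thesis using I.I_l_closed[OF that smult_closed[OF C AA.one_closed]] by metis
  qed
  have sm: "(\<Union>x\<in>I +>\<^bsub>A\<^esub> a. I +>\<^bsub>A\<^esub> (c \<odot>\<^bsub>A\<^esub> x)) = I +>\<^bsub>A\<^esub> (c \<odot>\<^bsub>A\<^esub> a)"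
    if a: "a \<in> carrier A" for a c
  proof -
    have "I +>\<^bsub>A\<^esub> (c \<odot>\<^bsub>A\<^esub> x) = I +>\<^bsub>A\<^esub> (c \<odot>\<^bsub>A\<^esub> a)" if x: "x \<in> I +>\<^bsub>A\<^esub> a" for x
    proof -
      obtain h where h: "h \<in> I" "x = h \<oplus>\<^bsub>A\<^esub> a" using x by (auto simp: a_r_coset_def')
      have "c \<odot>\<^bsub>A\<^esub> x = c \<odot>\<^bsub>A\<^esub> h \<oplus>\<^bsub>A\<^esub> c \<odot>\<^bsub>A\<^esub> a"
        using h a C I.Icarr by (simp add: smult_r_distr)
      hence "c \<odot>\<^bsub>A\<^esub> x \<in> I +>\<^bsub>A\<^esub> (c \<odot>\<^bsub>A\<^esub> a)"
        using smult_I[OF h(1)] by (auto simp: a_r_coset_def')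
      from I.a_repr_independence'[OF this] show ?thesis using a C by simp
    qed
    thus ?thesis using I.a_rcos_self[OF a] by blast
  qed
  show "(\<lambda>x. I +>\<^bsub>A\<^esub> x) \<in> alg_hom A (quot_alg A I)"
    using I.rcos_ring_hom
    by (auto simp: alg_hom_def ring_hom_def quot_alg_def sm)
qed

lemma algebra_quot_alg:
  assumes A: "algebra complex_alg A" and I: "ideal I A"
  shows "algebra complex_alg (quot_alg A I)"
proof -
  interpret AA: cring A by (rule algebra.M_cring[OF A])
  interpret algebra complex_alg A by (rule A)
  let ?q = "\<lambda>x. I +>\<^bsub>A\<^esub> x"
  note q = alg_homD(3,4,6)[OF quot_alg_proj(1)[OF A I], symmetric]
  note c = quot_alg_proj(2)[OF A I]
  note h = alg_homD(2)[OF quot_alg_proj(1)[OF A I]]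
  have C: "e \<in> carrier complex_alg" for e by (simp add: complex_alg_def)
  show ?thesis
    by (rule algebraI[OF cring_complex_alg cring_quot_alg[OF A I]])
       (auto simp: c q C smult_closed smult_l_distr smult_r_distr smult_assoc1 smult_assoc2
         simp del: One_nat_def intro!: imageI)
qed

lemma jet_rels_closed:
  assumes R: "algebra complex_alg R"
  shows "jet_rels m R \<subseteq> carrier (poly_alg (jet_symbols m R))"
proof -
  let ?P = "poly_alg (jet_symbols m R)"
  interpret RR: cring R by (rule algebra.M_cring[OF R])
  interpret algebra complex_alg R by (rule R)
  have C: "e \<in> carrier complex_alg" for e by (simp add: complex_alg_def)
  have var: "poly_var (a, k) \<in> carrier ?P" if "a \<in> carrier R" "enat k \<le> m" for a k
    using that by (intro poly_var_closed) (auto simp: jet_symbols_def)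
  have le: "enat i \<le> m" if "i \<le> k" "enat k \<le> m" for i k
    using that by (meson enat_ord_simps(1) order_trans)
  have le': "enat (k - i) \<le> m" if "enat k \<le> m" for i k
    by (rule le[OF _ that]) simp
  have minus: "p - q \<in> carrier ?P" if "p \<in> carrier ?P" "q \<in> carrier ?P" for p q
    using poly_alg_add_closed[OF that(1) poly_alg_uminus_closed[OF that(2)]] by simp
  have sum: "(\<Sum>i\<le>k. f i) \<in> carrier ?P" if "\<And>i. i \<le> (k::nat) \<Longrightarrow> f i \<in> carrier ?P" for f k
    using that by (induction k) (auto intro: poly_alg_add_closed)
  show ?thesis
    unfolding jet_rels_def
    by (auto intro!: minus var poly_alg_add_closed sum poly_alg_mult_closed poly_alg_const_closed
          smult_closed C intro: le le')
qed

lemma jet_ideal: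
  assumes "algebra complex_alg R"
  shows "ideal (jet_ideal m R) (poly_alg (jet_symbols m R))"
proof -
  interpret PP: cring "poly_alg (jet_symbols m R)" by (rule cring_poly_alg)
  show ?thesis unfolding jet_ideal_def
    by (rule PP.genideal_ideal[OF jet_rels_closed[OF assms]])
qed

lemma algebra_jet_alg: "algebra complex_alg R \<Longrightarrow> algebra complex_alg (jet_alg m R)"
  unfolding jet_alg_def by (rule algebra_quot_alg[OF algebra_poly_alg jet_ideal])

lemma jet_ring_simps:
  "carrier (jet_ring m A) =
     {f. (\<forall>k. f k \<in> carrier A) \<and> (\<forall>k. enat k > m \<longrightarrow> f k = \<zero>\<^bsub>A\<^esub>)}"
  "(f \<otimes>\<^bsub>jet_ring m A\<^esub> g) k =
     (if enat k \<le> m then \<Oplus>\<^bsub>A\<^esub>i\<in>{..k}. f i \<otimes>\<^bsub>A\<^esub> g (k - i) else \<zero>\<^bsub>A\<^esub>)"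
  "\<one>\<^bsub>jet_ring m A\<^esub> k = (if k = 0 then \<one>\<^bsub>A\<^esub> else \<zero>\<^bsub>A\<^esub>)"
  "\<zero>\<^bsub>jet_ring m A\<^esub> k = \<zero>\<^bsub>A\<^esub>"
  "(f \<oplus>\<^bsub>jet_ring m A\<^esub> g) k = f k \<oplus>\<^bsub>A\<^esub> g k"
  "(c \<odot>\<^bsub>jet_ring m A\<^esub> f) k = c \<odot>\<^bsub>A\<^esub> f k"
  by (simp_all add: jet_ring_def)

lemma conv_assoc:
  fixes A (structure)
  assumes "cring A" and "\<And>i. a i \<in> carrier A" "\<And>i. b i \<in> carrier A" "\<And>i. c i \<in> carrier A"
    and "(k::nat) \<le> n"
  shows "(\<Oplus>j \<in> {..k}. (\<Oplus>i \<in> {..j}. a i \<otimes> b (j - i)) \<otimes> c (n - j)) =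
         (\<Oplus>j \<in> {..k}. a j \<otimes> (\<Oplus>i \<in> {..k - j}. b i \<otimes> c (n - j - i)))"
  using assms(5)
proof (induction k)
  interpret cring A by (rule assms(1))
  case 0
  show ?case by (simp add: assms m_assoc)
next
  interpret cring A by (rule assms(1))
  case (Suc k)
  hence IH: "(\<Oplus>j \<in> {..k}. (\<Oplus>i \<in> {..j}. a i \<otimes> b (j - i)) \<otimes> c (n - j)) =
         (\<Oplus>j \<in> {..k}. a j \<otimes> (\<Oplus>i \<in> {..k - j}. b i \<otimes> c (n - j - i)))" by simp
  from IH Suc(2) assms(2-4) show ?case
    by (simp cong: finsum_cong add: Suc_diff_le Pi_def l_distr r_distr m_assoc)
       (simp cong: finsum_cong add: Pi_def a_ac finsum_ldistr m_assoc)
qed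

lemma conv_comm:
  fixes A (structure)
  assumes "cring A" and "\<And>i. a i \<in> carrier A" "\<And>i. b i \<in> carrier A"
  shows "(\<Oplus>i \<in> {..n::nat}. a i \<otimes> b (n - i)) = (\<Oplus>i \<in> {..n}. b i \<otimes> a (n - i))"
proof -
  interpret cring A by (rule assms(1))
  have inj: "inj_on (\<lambda>i. n - i) {..n}" by (auto simp: inj_on_def)
  have im: "(\<lambda>i. n - i) ` {..n} = {..n}"
  proof (intro equalityI subsetI)
    fix x assume "x \<in> {..n}"
    thus "x \<in> (\<lambda>i. n - i) ` {..n}" by (intro image_eqI[of x _ "n - x"]) auto
  qed auto
  have "(\<Oplus>i \<in> {..n}. b i \<otimes> a (n - i)) = (\<Oplus>i \<in> (\<lambda>i. n - i) ` {..n}. b i \<otimes> a (n - i))"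
    by (simp add: im)
  also have "\<dots> = (\<Oplus>i \<in> {..n}. b (n - i) \<otimes> a (n - (n - i)))"
    by (rule finsum_reindex[OF _ inj]) (use assms in auto)
  also have "\<dots> = (\<Oplus>i \<in> {..n}. a i \<otimes> b (n - i))"
    by (rule finsum_cong') (use assms in \<open>auto simp: m_comm\<close>)
  finally show ?thesis by simp
qed

lemma algebra_jet_ring:
  assumes A: "algebra complex_alg A"
  shows "algebra complex_alg (jet_ring m A)"
proof -
  interpret AA: cring A by (rule algebra.M_cring[OF A])
  interpret algebra complex_alg A by (rule A)
  have C: "e \<in> carrier complex_alg" for e by (simp add: complex_alg_def)
  have le: "enat i \<le> m" if "i \<le> k" "enat k \<le> m" for i k
    using that by (meson enat_ord_simps(1) order_trans)
  have cm: "comm_monoid (jet_ring m A)"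
  proof (rule comm_monoidI)
    fix x y assume xy: "x \<in> carrier (jet_ring m A)" "y \<in> carrier (jet_ring m A)"
    thus "x \<otimes>\<^bsub>jet_ring m A\<^esub> y \<in> carrier (jet_ring m A)"
      by (auto simp: jet_ring_simps intro!: AA.finsum_closed)
    show "x \<otimes>\<^bsub>jet_ring m A\<^esub> y = y \<otimes>\<^bsub>jet_ring m A\<^esub> x"
      using xy conv_comm[of A x y] AA.cring_axioms by (auto simp: jet_ring_simps fun_eq_iff)
    fix z assume z: "z \<in> carrier (jet_ring m A)"
    show "x \<otimes>\<^bsub>jet_ring m A\<^esub> y \<otimes>\<^bsub>jet_ring m A\<^esub> z = x \<otimes>\<^bsub>jet_ring m A\<^esub> (y \<otimes>\<^bsub>jet_ring m A\<^esub> z)"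
    proof
      fix k
      show "(x \<otimes>\<^bsub>jet_ring m A\<^esub> y \<otimes>\<^bsub>jet_ring m A\<^esub> z) k =
            (x \<otimes>\<^bsub>jet_ring m A\<^esub> (y \<otimes>\<^bsub>jet_ring m A\<^esub> z)) k"
      proof (cases "enat k \<le> m")
        case True
        have "(x \<otimes>\<^bsub>jet_ring m A\<^esub> y \<otimes>\<^bsub>jet_ring m A\<^esub> z) k =
          (\<Oplus>\<^bsub>A\<^esub>j\<in>{..k}. (\<Oplus>\<^bsub>A\<^esub>i\<in>{..j}. x i \<otimes>\<^bsub>A\<^esub> y (j - i)) \<otimes>\<^bsub>A\<^esub> z (k - j))"
          unfolding jet_ring_simps(2)[of m A "x \<otimes>\<^bsub>jet_ring m A\<^esub> y"]
          using True
          by (simp, intro AA.finsum_cong')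
             (use xy z le in \<open>auto simp: jet_ring_simps intro!: AA.finsum_closed\<close>)
        also have "\<dots> = (\<Oplus>\<^bsub>A\<^esub>j\<in>{..k}. x j \<otimes>\<^bsub>A\<^esub> (\<Oplus>\<^bsub>A\<^esub>i\<in>{..k - j}. y i \<otimes>\<^bsub>A\<^esub> z (k - j - i)))"
          by (rule conv_assoc[OF AA.cring_axioms]) (use xy z in \<open>auto simp: jet_ring_simps\<close>)
        also have "\<dots> = (x \<otimes>\<^bsub>jet_ring m A\<^esub> (y \<otimes>\<^bsub>jet_ring m A\<^esub> z)) k"
          unfolding jet_ring_simps(2)[of m A x]
          using True
          by (simp, intro AA.finsum_cong')
             (use xy z le[of "k - i" k for i] in \<open>auto simp: jet_ring_simps intro!: AA.finsum_closed\<close>)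
        finally show ?thesis .
      qed (simp add: jet_ring_simps)
    qed
  next
    show "\<one>\<^bsub>jet_ring m A\<^esub> \<in> carrier (jet_ring m A)"
      by (auto simp: jet_ring_simps zero_enat_def[symmetric])
    fix x assume x: "x \<in> carrier (jet_ring m A)"
    show "\<one>\<^bsub>jet_ring m A\<^esub> \<otimes>\<^bsub>jet_ring m A\<^esub> x = x"
    proof
      fix k
      have "(\<Oplus>\<^bsub>A\<^esub>i\<in>{..k}. \<one>\<^bsub>jet_ring m A\<^esub> i \<otimes>\<^bsub>A\<^esub> x (k - i)) =
            (\<Oplus>\<^bsub>A\<^esub>i\<in>{..k}. if 0 = i then x (k - i) else \<zero>\<^bsub>A\<^esub>)"
        by (rule AA.finsum_cong') (use x in \<open>auto simp: jet_ring_simps\<close>)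
      also have "\<dots> = x k"
        by (subst AA.finsum_singleton) (use x in \<open>auto simp: jet_ring_simps\<close>)
      finally show "(\<one>\<^bsub>jet_ring m A\<^esub> \<otimes>\<^bsub>jet_ring m A\<^esub> x) k = x k"
        using x by (auto simp: jet_ring_simps)
    qed
  qed
  have cr: "cring (jet_ring m A)"
  proof (rule cringI[OF _ cm])
    show "abelian_group (jet_ring m A)"
    proof (rule abelian_groupI)
      fix x assume x: "x \<in> carrier (jet_ring m A)"
      show "\<exists>y\<in>carrier (jet_ring m A). y \<oplus>\<^bsub>jet_ring m A\<^esub> x = \<zero>\<^bsub>jet_ring m A\<^esub>"
        by (rule bexI[of _ "\<lambda>k. \<ominus>\<^bsub>A\<^esub> x k"])
           (use x in \<open>auto simp: jet_ring_simps fun_eq_iff AA.l_neg\<close>)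
    qed (auto simp: jet_ring_simps fun_eq_iff AA.a_ac)
    fix x y z
    assume xyz: "x \<in> carrier (jet_ring m A)" "y \<in> carrier (jet_ring m A)" "z \<in> carrier (jet_ring m A)"
    show "(x \<oplus>\<^bsub>jet_ring m A\<^esub> y) \<otimes>\<^bsub>jet_ring m A\<^esub> z =
          x \<otimes>\<^bsub>jet_ring m A\<^esub> z \<oplus>\<^bsub>jet_ring m A\<^esub> y \<otimes>\<^bsub>jet_ring m A\<^esub> z"
    proof
      fix k
      have "(\<Oplus>\<^bsub>A\<^esub>i\<in>{..k}. (x i \<oplus>\<^bsub>A\<^esub> y i) \<otimes>\<^bsub>A\<^esub> z (k - i)) =
            (\<Oplus>\<^bsub>A\<^esub>i\<in>{..k}. x i \<otimes>\<^bsub>A\<^esub> z (k - i) \<oplus>\<^bsub>A\<^esub> y i \<otimes>\<^bsub>A\<^esub> z (k - i))"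
        by (rule AA.finsum_cong') (use xyz in \<open>auto simp: jet_ring_simps AA.l_distr\<close>)
      also have "\<dots> = (\<Oplus>\<^bsub>A\<^esub>i\<in>{..k}. x i \<otimes>\<^bsub>A\<^esub> z (k - i)) \<oplus>\<^bsub>A\<^esub> (\<Oplus>\<^bsub>A\<^esub>i\<in>{..k}. y i \<otimes>\<^bsub>A\<^esub> z (k - i))"
        by (rule AA.finsum_addf) (use xyz in \<open>auto simp: jet_ring_simps\<close>)
      finally show "((x \<oplus>\<^bsub>jet_ring m A\<^esub> y) \<otimes>\<^bsub>jet_ring m A\<^esub> z) k =
          (x \<otimes>\<^bsub>jet_ring m A\<^esub> z \<oplus>\<^bsub>jet_ring m A\<^esub> y \<otimes>\<^bsub>jet_ring m A\<^esub> z) k"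
        by (simp add: jet_ring_simps)
    qed
  qed
  show ?thesis
  proof (rule algebraI[OF cring_complex_alg cr])
    fix c :: complex and x y
    assume xy: "x \<in> carrier (jet_ring m A)" "y \<in> carrier (jet_ring m A)"
    show "(c \<odot>\<^bsub>jet_ring m A\<^esub> x) \<otimes>\<^bsub>jet_ring m A\<^esub> y = c \<odot>\<^bsub>jet_ring m A\<^esub> (x \<otimes>\<^bsub>jet_ring m A\<^esub> y)"
    proof
      fix k
      have "(\<Oplus>\<^bsub>A\<^esub>i\<in>{..k}. (c \<odot>\<^bsub>A\<^esub> x i) \<otimes>\<^bsub>A\<^esub> y (k - i)) =
            (\<Oplus>\<^bsub>A\<^esub>i\<in>{..k}. c \<odot>\<^bsub>A\<^esub> (x i \<otimes>\<^bsub>A\<^esub> y (k - i)))"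
        by (rule AA.finsum_cong')
           (use xy C in \<open>auto simp: jet_ring_simps smult_assoc2 intro!: smult_closed\<close>)
      also have "\<dots> = c \<odot>\<^bsub>A\<^esub> (\<Oplus>\<^bsub>A\<^esub>i\<in>{..k}. x i \<otimes>\<^bsub>A\<^esub> y (k - i))"
        by (rule finsum_smult_ldistr[symmetric]) (use xy C in \<open>auto simp: jet_ring_simps\<close>)
      finally show "((c \<odot>\<^bsub>jet_ring m A\<^esub> x) \<otimes>\<^bsub>jet_ring m A\<^esub> y) k =
            (c \<odot>\<^bsub>jet_ring m A\<^esub> (x \<otimes>\<^bsub>jet_ring m A\<^esub> y)) k"
        using smult_r_null[OF C[of c]] by (simp add: jet_ring_simps)
    qed
  qed (use C smult_l_distr smult_r_distr smult_assoc1 smult_one smult_r_null smult_closed in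
        \<open>auto simp: jet_ring_simps fun_eq_iff\<close>)
qed

context
  fixes R :: "(complex, 'a, 'c) module_scheme" and m :: enat
  assumes R: "algebra complex_alg R"
begin

interpretation RR: cring R by (rule algebra.M_cring[OF R])
interpretation algebra complex_alg R by (rule R)

abbreviation (input) "jP \<equiv> poly_alg (jet_symbols m R)"
abbreviation (input) "jq p \<equiv> jet_ideal m R +>\<^bsub>jP\<^esub> p"

lemma jq: "jq \<in> alg_hom jP (jet_alg m R)" "carrier (jet_alg m R) = jq ` carrier jP"
  unfolding jet_alg_def by (rule quot_alg_proj[OF algebra_poly_alg jet_ideal[OF R]])+

lemma jq_eqI:
  assumes "p - q \<in> jet_ideal m R" "p \<in> carrier jP" "q \<in> carrier jP"
  shows "jq p = jq q"
proof -
  interpret PP: cring jP by (rule cring_poly_alg)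
  interpret I: ideal "jet_ideal m R" jP by (rule jet_ideal[OF R])
  have "p \<in> jq q" using assms(1) by (auto simp: a_r_coset_def' poly_alg_simps intro!: bexI[of _ "p - q"])
  from I.a_repr_independence'[OF this assms(3)] show ?thesis by simp
qed

lemma jq_rel:
  assumes "p - q \<in> jet_rels m R" "p \<in> carrier jP" "q \<in> carrier jP"
  shows "jq p = jq q"
proof -
  interpret PP: cring jP by (rule cring_poly_alg)
  show ?thesis
    using assms PP.genideal_self[OF jet_rels_closed[OF R]] by (intro jq_eqI) (auto simp: jet_ideal_def)
qed

lemma var_closed: "a \<in> carrier R \<Longrightarrow> enat k \<le> m \<Longrightarrow> poly_var (a, k) \<in> carrier jP"
  by (intro poly_var_closed) (auto simp: jet_symbols_def)

lemma jet_sum_closed: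
  "(\<And>i. i \<le> (k::nat) \<Longrightarrow> f i \<in> carrier (poly_alg S)) \<Longrightarrow> (\<Sum>i\<le>k. f i) \<in> carrier (poly_alg S)"
  by (induction k) (auto intro: poly_alg_add_closed)

lemma poly_hom_sum:
  assumes A: "algebra complex_alg A" and f: "f \<in> alg_hom (poly_alg S) A"
    and "\<And>i. i \<le> (k::nat) \<Longrightarrow> g i \<in> carrier (poly_alg S)"
  shows "f (\<Sum>i\<le>k. g i) = (\<Oplus>\<^bsub>A\<^esub>i\<in>{..k}. f (g i))"
proof -
  interpret AA: cring A by (rule algebra.M_cring[OF A])
  note fD = alg_homD[OF f, unfolded poly_alg_simps]
  show ?thesis using assms(3)
  proof (induction k)
    case (Suc k)
    have "f (\<Sum>i\<le>Suc k. g i) = f (\<Sum>i\<le>k. g i) \<oplus>\<^bsub>A\<^esub> f (g (Suc k))"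
      using Suc(2) by (simp add: fD(4) jet_sum_closed)
    also have "\<dots> = f (g (Suc k)) \<oplus>\<^bsub>A\<^esub> (\<Oplus>\<^bsub>A\<^esub>i\<in>{..k}. f (g i))"
      using Suc AA.a_comm[OF fD(2)[OF jet_sum_closed] fD(2), of k g "g (Suc k)"] by simp
    also have "\<dots> = (\<Oplus>\<^bsub>A\<^esub>i\<in>{..Suc k}. f (g i))"
      by (rule AA.finsum_Suc[symmetric]) (use Suc(2) fD(2) in auto)
    finally show ?case .
  qed (use fD(2) in simp)
qed

lemma le_enat: "i \<le> k \<Longrightarrow> enat k \<le> m \<Longrightarrow> enat i \<le> m"
  by (meson enat_ord_simps(1) order_trans)

lemma le_enat': "enat k \<le> m \<Longrightarrow> enat (k - i) \<le> m"
  by (rule le_enat[of _ k]) auto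

lemma jet_univ_le: "enat k \<le> m \<Longrightarrow> jet_univ m R r k = jq (poly_var (r, k))"
  by (simp add: jet_univ_def)

lemma jet_univ_gt: "\<not> enat k \<le> m \<Longrightarrow> jet_univ m R r k = \<zero>\<^bsub>jet_alg m R\<^esub>"
  by (simp add: jet_univ_def)

lemma jet_univ_hom: "jet_univ m R \<in> alg_hom R (jet_ring m (jet_alg m R))"
proof -
  let ?J = "jet_alg m R"
  let ?JR = "jet_ring m ?J"
  note Jalg = algebra_jet_alg[OF R]
  note JRalg = algebra_jet_ring[OF Jalg]
  interpret J: cring ?J by (rule algebra.M_cring[OF Jalg])
  interpret JR: cring ?JR by (rule algebra.M_cring[OF JRalg])
  have C: "e \<in> carrier complex_alg" for e by (simp add: complex_alg_def)
  note qD = alg_homD[OF jq(1), unfolded poly_alg_simps]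
  have closed: "jet_univ m R r \<in> carrier ?JR" if "r \<in> carrier R" for r
    using that by (auto simp: jet_ring_simps jet_univ_def intro!: qD(2) var_closed)
  have add: "jet_univ m R (a \<oplus>\<^bsub>R\<^esub> b) = jet_univ m R a \<oplus>\<^bsub>?JR\<^esub> jet_univ m R b"
    if ab: "a \<in> carrier R" "b \<in> carrier R" for a b
  proof
    fix k
    show "jet_univ m R (a \<oplus>\<^bsub>R\<^esub> b) k = (jet_univ m R a \<oplus>\<^bsub>?JR\<^esub> jet_univ m R b) k"
    proof (cases "enat k \<le> m")
      case True
      have "jq (poly_var (a \<oplus>\<^bsub>R\<^esub> b, k)) = jq (poly_var (a, k) + poly_var (b, k))"
        by (rule jq_rel) (use ab True in \<open>auto simp: jet_rels_def intro!: var_closed poly_alg_add_closed\<close>)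
      thus ?thesis using True ab by (simp add: jet_univ_le jet_ring_simps qD(4) var_closed)
    qed (simp add: jet_univ_gt jet_ring_simps)
  qed
  have mult: "jet_univ m R (a \<otimes>\<^bsub>R\<^esub> b) = jet_univ m R a \<otimes>\<^bsub>?JR\<^esub> jet_univ m R b"
    if ab: "a \<in> carrier R" "b \<in> carrier R" for a b
  proof
    fix k
    show "jet_univ m R (a \<otimes>\<^bsub>R\<^esub> b) k = (jet_univ m R a \<otimes>\<^bsub>?JR\<^esub> jet_univ m R b) k"
    proof (cases "enat k \<le> m")
      case True
      have v: "poly_var (a, i) * poly_var (b, k - i) \<in> carrier jP" if "i \<le> k" for i
        using that ab True le_enat le_enat' by (intro poly_alg_mult_closed var_closed) auto
      have "jq (poly_var (a \<otimes>\<^bsub>R\<^esub> b, k)) = jq (\<Sum>i\<le>k. poly_var (a, i) * poly_var (b, k - i))"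
        by (rule jq_rel) (use ab True v in \<open>auto simp: jet_rels_def intro!: var_closed jet_sum_closed\<close>)
      also have "\<dots> = (\<Oplus>\<^bsub>?J\<^esub>i\<in>{..k}. jq (poly_var (a, i) * poly_var (b, k - i)))"
        by (rule poly_hom_sum[OF Jalg jq(1) v])
      also have "\<dots> = (\<Oplus>\<^bsub>?J\<^esub>i\<in>{..k}. jet_univ m R a i \<otimes>\<^bsub>?J\<^esub> jet_univ m R b (k - i))"
        using True ab closed[OF ab(1)] closed[OF ab(2)]
        by (intro J.finsum_cong')
           (auto simp: jet_univ_le qD(3) var_closed le_enat[of _ k] le_enat' jet_ring_simps
                  intro!: J.m_closed qD(2))
      finally show ?thesis using True by (simp add: jet_univ_le jet_ring_simps)
    qed (simp add: jet_univ_gt jet_ring_simps)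
  qed
  have const: "jet_univ m R (c \<odot>\<^bsub>R\<^esub> \<one>\<^bsub>R\<^esub>) = c \<odot>\<^bsub>?JR\<^esub> \<one>\<^bsub>?JR\<^esub>" for c
  proof
    fix k
    have z: "c \<odot>\<^bsub>?J\<^esub> \<zero>\<^bsub>?J\<^esub> = \<zero>\<^bsub>?J\<^esub>"
      by (rule module.smult_r_null[OF _ C]) (use Jalg in \<open>simp add: algebra_def\<close>)
    have qz: "jq 0 = \<zero>\<^bsub>?J\<^esub>"
    proof -
      interpret H: ring_hom_ring jP ?J jq
        by (intro ring_hom_ringI2 cring.axioms(1) cring_poly_alg J.ring_axioms alg_homD(1)[OF jq(1)])
      show ?thesis using H.hom_zero by (simp only: poly_alg_simps)
    qed
    show "jet_univ m R (c \<odot>\<^bsub>R\<^esub> \<one>\<^bsub>R\<^esub>) k = (c \<odot>\<^bsub>?JR\<^esub> \<one>\<^bsub>?JR\<^esub>) k"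
    proof (cases "enat k \<le> m")
      case True
      have "jq (poly_var (c \<odot>\<^bsub>R\<^esub> \<one>\<^bsub>R\<^esub>, k)) = jq (Poly_Mapping.single 0 (if k = 0 then c else 0))"
      proof (rule jq_rel[OF _ var_closed[OF smult_closed[OF C RR.one_closed] True] poly_alg_const_closed])
        show "poly_var (c \<odot>\<^bsub>R\<^esub> \<one>\<^bsub>R\<^esub>, k) - Poly_Mapping.single 0 (if k = 0 then c else 0) \<in> jet_rels m R"
          unfolding jet_rels_def using True by blast
      qed
      also have "\<dots> = (c \<odot>\<^bsub>?JR\<^esub> \<one>\<^bsub>?JR\<^esub>) k"
        using qD(6)[of 1 c] qD(5) poly_alg_const_closed[of 1] by (auto simp: jet_ring_simps z qz)
      finally show ?thesis using True by (simp add: jet_univ_le)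
    next
      case False
      hence "k \<noteq> 0" by (metis zero_enat_def zero_le)
      thus ?thesis using False by (simp add: jet_univ_gt jet_ring_simps z)
    qed
  qed
  have smult: "jet_univ m R (c \<odot>\<^bsub>R\<^esub> r) = c \<odot>\<^bsub>?JR\<^esub> jet_univ m R r" if r: "r \<in> carrier R" for c r
  proof -
    have "c \<odot>\<^bsub>R\<^esub> r = (c \<odot>\<^bsub>R\<^esub> \<one>\<^bsub>R\<^esub>) \<otimes>\<^bsub>R\<^esub> r"
      using smult_assoc2[OF C, of "\<one>\<^bsub>R\<^esub>" r c] r by simp
    hence "jet_univ m R (c \<odot>\<^bsub>R\<^esub> r) = (c \<odot>\<^bsub>?JR\<^esub> \<one>\<^bsub>?JR\<^esub>) \<otimes>\<^bsub>?JR\<^esub> jet_univ m R r"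
      using r C by (simp add: mult smult_closed const)
    also have "\<dots> = c \<odot>\<^bsub>?JR\<^esub> jet_univ m R r"
      using algebra.smult_assoc2[OF JRalg C JR.one_closed closed[OF r], of c] closed[OF r] by simp
    finally show ?thesis .
  qed
  have one: "jet_univ m R \<one>\<^bsub>R\<^esub> = \<one>\<^bsub>?JR\<^esub>"
  proof -
    interpret M: module complex_alg ?JR using JRalg by (simp add: algebra_def)
    show ?thesis using const[of 1] smult_one[of "\<one>\<^bsub>R\<^esub>"] M.smult_one[of "\<one>\<^bsub>?JR\<^esub>"]
      by (simp add: complex_alg_def)
  qed
  show ?thesis
    unfolding alg_hom_def
  proof (intro CollectI conjI allI ballI)
    show "jet_univ m R \<in> ring_hom R ?JR"
      by (rule ring_hom_memI[OF closed mult add one])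
  qed (rule smult)
qed

text \<open>
  The algebra \<open>jet_alg m R\<close> represents the functor \<open>A \<mapsto> alg_hom R (jet_ring m A)\<close>, with universal
  element \<open>jet_univ m R\<close>.
\<close>

theorem jet_alg_universal:
  assumes A: "algebra complex_alg A" and \<phi>: "\<phi> \<in> alg_hom R (jet_ring m A)"
  shows "jet_lift A \<phi> \<in> alg_hom (jet_alg m R) A"
    and "r \<in> carrier R \<Longrightarrow> jet_lift A \<phi> (jet_univ m R r k) = \<phi> r k"
    and "\<psi> \<in> alg_hom (jet_alg m R) A \<Longrightarrow>
           (\<And>r k. r \<in> carrier R \<Longrightarrow> \<psi> (jet_univ m R r k) = \<phi> r k) \<Longrightarrow>
           F \<in> carrier (jet_alg m R) \<Longrightarrow> \<psi> F = jet_lift A \<phi> F"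
proof -
  let ?e = "poly_eval A (\<lambda>(r, k). \<phi> r k)"
  let ?I = "jet_ideal m R"
  have C: "e \<in> carrier complex_alg" for e by (simp add: complex_alg_def)
  interpret AA: cring A by (rule algebra.M_cring[OF A])
  interpret PP: cring jP by (rule cring_poly_alg)
  interpret AM: module complex_alg A using A by (simp add: algebra_def)
  interpret I: ideal "?I" jP by (rule jet_ideal[OF R])
  interpret J: cring "jet_alg m R" by (rule algebra.M_cring[OF algebra_jet_alg[OF R]])
  note \<phi>D = alg_homD[OF \<phi>]
  have \<phi>c: "\<phi> r k \<in> carrier A" if "r \<in> carrier R" for r k
    using \<phi>D(2)[OF that] by (simp add: jet_ring_simps)
  have v: "(\<lambda>(r, k). \<phi> r k) x \<in> carrier A" if "x \<in> jet_symbols m R" for x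
    using that \<phi>c by (auto simp: jet_symbols_def)
  have e: "?e \<in> alg_hom jP A" by (rule poly_eval_hom[OF A v])
  note eD = alg_homD[OF e, unfolded poly_alg_simps]
  have ev: "?e (poly_var (r, k)) = \<phi> r k" if "r \<in> carrier R" "enat k \<le> m" for r k
    using poly_eval_var[OF A v, where x = "(r, k)"] that by (simp add: jet_symbols_def)
  interpret H: ring_hom_ring jP A ?e
    by (intro ring_hom_ringI2 PP.ring_axioms AA.ring_axioms alg_homD(1)[OF e])
  have eq0: "?e (p - q) = \<zero>\<^bsub>A\<^esub>" if pq: "p \<in> carrier jP" "q \<in> carrier jP" "?e p = ?e q" for p q
  proof -
    have c: "p - q \<in> carrier jP"
      using poly_alg_add_closed[OF pq(1) poly_alg_uminus_closed[OF pq(2)]] by simp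
    have "?e q = ?e (p - q) \<oplus>\<^bsub>A\<^esub> ?e q" using eD(4)[OF c pq(2)] pq(3) by simp
    thus ?thesis using eD(2)[OF c] eD(2)[OF pq(2)] by (metis AA.add.r_cancel_one')
  qed
  have "x \<in> a_kernel jP A ?e" if x: "x \<in> jet_rels m R" for x
  proof -
    have "?e x = \<zero>\<^bsub>A\<^esub>"
      using x unfolding jet_rels_def
    proof (elim UnE CollectE exE conjE)
      fix a b k
      assume *: "x = poly_var (a \<oplus>\<^bsub>R\<^esub> b, k) - (poly_var (a, k) + poly_var (b, k))"
         "a \<in> carrier R" "b \<in> carrier R" "enat k \<le> m"
      show ?thesis unfolding *(1)
        by (rule eq0)
           (use * in \<open>auto intro!: var_closed poly_alg_add_closed simp: eD(4) var_closed ev \<phi>D(4) jet_ring_simps\<close>)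
    next
      fix a b k
      assume *: "x = poly_var (a \<otimes>\<^bsub>R\<^esub> b, k) - (\<Sum>i\<le>k. poly_var (a, i) * poly_var (b, k - i))"
         "a \<in> carrier R" "b \<in> carrier R" "enat k \<le> m"
      have w: "poly_var (a, i) * poly_var (b, k - i) \<in> carrier jP" if "i \<le> k" for i
        using that * le_enat le_enat' by (intro poly_alg_mult_closed var_closed) auto
      have "?e (\<Sum>i\<le>k. poly_var (a, i) * poly_var (b, k - i)) =
            (\<Oplus>\<^bsub>A\<^esub>i\<in>{..k}. ?e (poly_var (a, i) * poly_var (b, k - i)))"
        by (rule poly_hom_sum[OF A e w])
      also have "\<dots> = (\<Oplus>\<^bsub>A\<^esub>i\<in>{..k}. \<phi> a i \<otimes>\<^bsub>A\<^esub> \<phi> b (k - i))"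
        using * \<phi>c by (intro AA.finsum_cong') (auto simp: eD(3) var_closed ev le_enat[of _ k] le_enat')
      also have "\<dots> = \<phi> (a \<otimes>\<^bsub>R\<^esub> b) k"
        using * by (simp add: \<phi>D(3) jet_ring_simps)
      also have "\<dots> = ?e (poly_var (a \<otimes>\<^bsub>R\<^esub> b, k))" using * by (simp add: ev)
      finally show ?thesis unfolding *(1)
        by (intro eq0) (use * w in \<open>auto intro!: var_closed jet_sum_closed\<close>)
    next
      fix c k
      assume *: "x = poly_var (c \<odot>\<^bsub>R\<^esub> \<one>\<^bsub>R\<^esub>, k) - Poly_Mapping.single 0 (if k = 0 then c else 0)"
        "enat k \<le> m"
      have c1: "c \<odot>\<^bsub>R\<^esub> \<one>\<^bsub>R\<^esub> \<in> carrier R" using C by (intro smult_closed) auto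
      have "?e (Poly_Mapping.single 0 (if k = 0 then c else 0)) = (if k = 0 then c else 0) \<odot>\<^bsub>A\<^esub> \<one>\<^bsub>A\<^esub>"
        by (rule poly_eval_const[OF A v])
      also have "\<dots> = \<phi> (c \<odot>\<^bsub>R\<^esub> \<one>\<^bsub>R\<^esub>) k"
        using AM.smult_l_null[OF AA.one_closed] AM.smult_r_null[OF C[of c]]
        by (simp add: \<phi>D(5,6) jet_ring_simps complex_alg_def)
      finally have "?e (poly_var (c \<odot>\<^bsub>R\<^esub> \<one>\<^bsub>R\<^esub>, k)) = ?e (Poly_Mapping.single 0 (if k = 0 then c else 0))"
        using ev[OF c1 *(2)] by simp
      thus ?thesis unfolding *(1)
        by (intro eq0 var_closed poly_alg_const_closed) (use * c1 in auto)
    qed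
    thus ?thesis using subsetD[OF jet_rels_closed[OF R] x] unfolding a_kernel_def' by blast
  qed
  hence ker: "?I \<subseteq> a_kernel jP A ?e"
    unfolding jet_ideal_def by (intro PP.genideal_minimal H.kernel_is_ideal) auto
  have lift: "jet_lift A \<phi> (jq p) = ?e p" if p: "p \<in> carrier jP" for p
  proof -
    have "?e x = ?e p" if x: "x \<in> jq p" for x
    proof -
      obtain h where h: "h \<in> ?I" "x = h + p" using x unfolding a_r_coset_def' poly_alg_simps by blast
      have "?e h = \<zero>\<^bsub>A\<^esub>" using subsetD[OF ker h(1)] unfolding a_kernel_def' by blast
      thus ?thesis using h eD(2)[OF p] eD(4)[OF I.Icarr[OF h(1)] p] by simp
    qed
    hence "?e ` jq p = {?e p}" using I.a_rcos_self[OF p] by blast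
    thus ?thesis by (simp add: jet_lift_def)
  qed
  show L: "jet_lift A \<phi> \<in> alg_hom (jet_alg m R) A"
    unfolding alg_hom_def
  proof (intro CollectI conjI ballI allI ring_hom_memI)
    fix F assume "F \<in> carrier (jet_alg m R)"
    then obtain p where p: "p \<in> carrier jP" "F = jq p" using jq(2) by auto
    show "jet_lift A \<phi> F \<in> carrier A" using p by (simp add: lift eD(2))
    show "jet_lift A \<phi> (c \<odot>\<^bsub>jet_alg m R\<^esub> F) = c \<odot>\<^bsub>A\<^esub> jet_lift A \<phi> F" for c
      using p algebra_poly_alg lift[of "c \<odot>\<^bsub>jP\<^esub> p"] alg_homD(6)[OF jq(1) p(1), of c]
        alg_homD(6)[OF e p(1), of c] lift[OF p(1)]
        poly_alg_mult_closed[OF poly_alg_const_closed p(1), of c]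
      by (simp add: poly_alg_simps)
    fix G assume "G \<in> carrier (jet_alg m R)"
    then obtain q where q: "q \<in> carrier jP" "G = jq q" using jq(2) by auto
    show "jet_lift A \<phi> (F \<otimes>\<^bsub>jet_alg m R\<^esub> G) = jet_lift A \<phi> F \<otimes>\<^bsub>A\<^esub> jet_lift A \<phi> G"
      using p q alg_homD(3)[OF jq(1) p(1) q(1)] alg_homD(3)[OF e p(1) q(1)]
        lift[OF PP.m_closed[OF p(1) q(1)]] by (simp add: lift)
    show "jet_lift A \<phi> (F \<oplus>\<^bsub>jet_alg m R\<^esub> G) = jet_lift A \<phi> F \<oplus>\<^bsub>A\<^esub> jet_lift A \<phi> G"
      using p q alg_homD(4)[OF jq(1) p(1) q(1)] alg_homD(4)[OF e p(1) q(1)]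
        lift[OF PP.a_closed[OF p(1) q(1)]] by (simp add: lift)
  next
    show "jet_lift A \<phi> \<one>\<^bsub>jet_alg m R\<^esub> = \<one>\<^bsub>A\<^esub>"
      using alg_homD(5)[OF jq(1)] alg_homD(5)[OF e] lift[OF PP.one_closed] by simp
  qed
  have zero: "f \<zero>\<^bsub>jet_alg m R\<^esub> = \<zero>\<^bsub>A\<^esub>" if "f \<in> alg_hom (jet_alg m R) A" for f
  proof -
    interpret ring_hom_ring "jet_alg m R" A f
      by (intro ring_hom_ringI2 J.ring_axioms AA.ring_axioms alg_homD(1)[OF that])
    show ?thesis by (rule hom_zero)
  qed
  show "jet_lift A \<phi> (jet_univ m R r k) = \<phi> r k" if "r \<in> carrier R" for r k
  proof (cases "enat k \<le> m")
    case True
    thus ?thesis using that by (simp add: jet_univ_le lift var_closed ev)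
  next
    case False
    thus ?thesis using \<phi>D(2)[OF that] by (simp add: jet_univ_gt zero[OF L] jet_ring_simps)
  qed
  show "\<psi> F = jet_lift A \<phi> F"
    if \<psi>: "\<psi> \<in> alg_hom (jet_alg m R) A"
      and eq: "\<And>r k. r \<in> carrier R \<Longrightarrow> \<psi> (jet_univ m R r k) = \<phi> r k"
      and F: "F \<in> carrier (jet_alg m R)"
  proof -
    obtain p where p: "p \<in> carrier jP" "F = jq p" using F jq(2) by auto
    have c: "(\<lambda>p. \<psi> (jq p)) \<in> alg_hom jP A"
      using alg_homD[OF jq(1)] alg_homD[OF \<psi>] by (auto simp: alg_hom_def intro!: ring_hom_memI)
    have "\<psi> (jq p) = poly_eval A (\<lambda>x. \<psi> (jq (poly_var x))) p"
      by (rule poly_hom_unique[OF A c p(1)])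
    also have "\<dots> = ?e p"
    proof -
      have "monom_eval A (\<lambda>x. \<psi> (jq (poly_var x))) \<mu> = monom_eval A (\<lambda>(r, k). \<phi> r k) \<mu>"
        if \<mu>: "\<mu> \<in> Poly_Mapping.keys p" for \<mu>
        unfolding monom_eval_def
      proof (rule AA.finprod_cong')
        fix x assume x: "x \<in> Poly_Mapping.keys \<mu>"
        hence xs: "x \<in> jet_symbols m R" using p(1) \<mu> by (auto simp: poly_alg_def)
        then obtain r k where rk: "x = (r, k)" "r \<in> carrier R" "enat k \<le> m"
          by (auto simp: jet_symbols_def)
        show "\<psi> (jq (poly_var x)) [^]\<^bsub>A\<^esub> Poly_Mapping.lookup \<mu> x =
              (case x of (r, k) \<Rightarrow> \<phi> r k) [^]\<^bsub>A\<^esub> Poly_Mapping.lookup \<mu> x"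
          using eq[OF rk(2), of k] rk by (simp add: jet_univ_le)
      next
        show "(\<lambda>x. (case x of (r, k) \<Rightarrow> \<phi> r k) [^]\<^bsub>A\<^esub> Poly_Mapping.lookup \<mu> x)
              \<in> Poly_Mapping.keys \<mu> \<rightarrow> carrier A"
          using p(1) \<mu> v by (intro Pi_I AA.nat_pow_closed) (auto simp: poly_alg_def)
      qed simp
      moreover have "Poly_Mapping.lookup p \<mu> \<odot>\<^bsub>A\<^esub> monom_eval A (\<lambda>(r, k). \<phi> r k) \<mu> \<in> carrier A"
        if \<mu>: "\<mu> \<in> Poly_Mapping.keys p" for \<mu>
        by (rule AM.smult_closed[OF C monom_eval_closed[OF A v]])
           (use p(1) \<mu> in \<open>auto simp: poly_alg_def\<close>)
      ultimately show ?thesis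
        unfolding poly_eval_def monom_eval_def[symmetric] by (intro AA.finsum_cong') auto
    qed
    also have "\<dots> = jet_lift A \<phi> (jq p)" using lift[OF p(1)] by simp
    finally show ?thesis using p(2) by simp
  qed
qed

end


section \<open>Localizations are rings and the invariants form an algebra\<close>

context
  fixes R :: "('a, 'c) ring_scheme" (structure) and S :: "'a set"
  assumes R: "cring R" and S: "submonoid S R"
begin

interpretation cring R by (rule R)
interpretation S: submonoid S R by (rule S)

lemma frac_rel_iff:
  "((a, s), (b, t)) \<in> frac_rel R S \<longleftrightarrow>
     a \<in> carrier R \<and> b \<in> carrier R \<and> s \<in> S \<and> t \<in> S \<and>
     (\<exists>u\<in>S. u \<otimes> (a \<otimes> t) = u \<otimes> (b \<otimes> s))"
  by (auto simp: frac_rel_def)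

lemma frac_rel_equiv: "equiv (carrier R \<times> S) (frac_rel R S)"
proof (rule equivI)
  show "frac_rel R S \<subseteq> (carrier R \<times> S) \<times> (carrier R \<times> S)" by (auto simp: frac_rel_def)
  show "refl_on (carrier R \<times> S) (frac_rel R S)"
    using S.one_closed by (auto simp: refl_on_def frac_rel_iff)
  show "sym (frac_rel R S)"
  proof (rule symI)
    fix x y assume xy: "(x, y) \<in> frac_rel R S"
    obtain a s b t where e: "x = (a, s)" "y = (b, t)" by (metis prod.exhaust)
    show "(y, x) \<in> frac_rel R S" using xy unfolding e frac_rel_iff by metis
  qed
  show "trans (frac_rel R S)"
  proof (rule transI)
    fix x y z assume xy: "(x, y) \<in> frac_rel R S" and yz: "(y, z) \<in> frac_rel R S"
    obtain a s b t c r where e: "x = (a, s)" "y = (b, t)" "z = (c, r)" by (metis prod.exhaust)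
    obtain u where u: "u \<in> S" "u \<otimes> (a \<otimes> t) = u \<otimes> (b \<otimes> s)"
      using xy by (auto simp: e frac_rel_iff)
    obtain v where v: "v \<in> S" "v \<otimes> (b \<otimes> r) = v \<otimes> (c \<otimes> t)"
      using yz by (auto simp: e frac_rel_iff)
    have S: "s \<in> S" "t \<in> S" "r \<in> S" and C: "a \<in> carrier R" "b \<in> carrier R" "c \<in> carrier R"
      using xy yz by (auto simp: e frac_rel_iff)
    note CS = S[THEN S.mem_carrier] C u(1)[THEN S.mem_carrier] v(1)[THEN S.mem_carrier]
    have "(u \<otimes> v \<otimes> t) \<otimes> (a \<otimes> r) = (v \<otimes> r) \<otimes> (u \<otimes> (a \<otimes> t))"
      using CS by (simp add: m_ac)
    also have "\<dots> = (u \<otimes> s) \<otimes> (v \<otimes> (b \<otimes> r))" unfolding u(2) using CS by (simp add: m_ac)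
    also have "\<dots> = (u \<otimes> v \<otimes> t) \<otimes> (c \<otimes> s)" unfolding v(2) using CS by (simp add: m_ac)
    finally show "(x, z) \<in> frac_rel R S"
      using S C u(1) v(1) by (auto simp: e frac_rel_iff intro!: bexI[of _ "u \<otimes> v \<otimes> t"])
  qed
qed

lemma fraction_eq_iff:
  assumes "a \<in> carrier R" "b \<in> carrier R" "s \<in> S" "t \<in> S"
  shows "fraction R S a s = fraction R S b t \<longleftrightarrow> (\<exists>u\<in>S. u \<otimes> (a \<otimes> t) = u \<otimes> (b \<otimes> s))"
  unfolding fraction_def
  by (subst eq_equiv_class_iff[OF frac_rel_equiv]) (use assms in \<open>auto simp: frac_rel_iff\<close>)

lemma fraction_self: "a \<in> carrier R \<Longrightarrow> s \<in> S \<Longrightarrow> (a, s) \<in> fraction R S a s"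
  unfolding fraction_def using equiv_class_self[OF frac_rel_equiv] by auto

lemma fraction_memD:
  "(b, t) \<in> fraction R S a s \<Longrightarrow>
     b \<in> carrier R \<and> t \<in> S \<and> a \<in> carrier R \<and> s \<in> S \<and> (\<exists>u\<in>S. u \<otimes> (a \<otimes> t) = u \<otimes> (b \<otimes> s))"
  by (auto simp: fraction_def frac_rel_iff)

lemma localization_carrier:
  "carrier (localization R S) = {fraction R S a s | a s. a \<in> carrier R \<and> s \<in> S}"
  by (auto simp: localization_def quotient_def fraction_def)

lemma UN_pair_const:
  assumes "\<And>a s b t. (a, s) \<in> C \<Longrightarrow> (b, t) \<in> D \<Longrightarrow> f a s b t = E"
    and ne: "(a, s) \<in> C" "(b, t) \<in> D"
  shows "(\<Union>(a, s)\<in>C. \<Union>(b, t)\<in>D. f a s b t) = E"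
proof -
  have "(\<Union>(a, s)\<in>C. \<Union>(b, t)\<in>D. f a s b t) = (\<Union>(a, s)\<in>C. \<Union>(b, t)\<in>D. E)"
    by (intro SUP_cong refl) (auto simp: assms(1))
  also have "\<dots> = E" using ne by (auto split: prod.splits)
  finally show ?thesis .
qed

lemma localization_mult:
  assumes "a \<in> carrier R" "b \<in> carrier R" "s \<in> S" "t \<in> S"
  shows "fraction R S a s \<otimes>\<^bsub>localization R S\<^esub> fraction R S b t = fraction R S (a \<otimes> b) (s \<otimes> t)"
proof -
  have *: "fraction R S (a' \<otimes> b') (s' \<otimes> t') = fraction R S (a \<otimes> b) (s \<otimes> t)"
    if m: "(a', s') \<in> fraction R S a s" "(b', t') \<in> fraction R S b t" for a' s' b' t'
  proof -
    obtain u v where u: "u \<in> S" "u \<otimes> (a \<otimes> s') = u \<otimes> (a' \<otimes> s)"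
      and v: "v \<in> S" "v \<otimes> (b \<otimes> t') = v \<otimes> (b' \<otimes> t)"
      and c: "a' \<in> carrier R" "b' \<in> carrier R" "s' \<in> S" "t' \<in> S"
      using fraction_memD[OF m(1)] fraction_memD[OF m(2)] by blast
    note CS = c(1,2) assms(1,2) c(3,4)[THEN S.mem_carrier] assms(3,4)[THEN S.mem_carrier]
       u(1)[THEN S.mem_carrier] v(1)[THEN S.mem_carrier]
    have "(u \<otimes> v) \<otimes> ((a' \<otimes> b') \<otimes> (s \<otimes> t)) = (u \<otimes> (a' \<otimes> s)) \<otimes> (v \<otimes> (b' \<otimes> t))"
      using CS by (simp add: m_ac)
    also have "\<dots> = (u \<otimes> v) \<otimes> ((a \<otimes> b) \<otimes> (s' \<otimes> t'))"
      unfolding u(2)[symmetric] v(2)[symmetric] using CS by (simp add: m_ac)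
    finally show ?thesis
      using c assms u(1) v(1) by (subst fraction_eq_iff) (auto intro!: bexI[of _ "u \<otimes> v"])
  qed
  show ?thesis
    unfolding localization_def monoid.simps ring.simps
    by (rule UN_pair_const) (use * fraction_self assms in blast)+
qed

lemma localization_add:
  assumes "a \<in> carrier R" "b \<in> carrier R" "s \<in> S" "t \<in> S"
  shows "fraction R S a s \<oplus>\<^bsub>localization R S\<^esub> fraction R S b t =
         fraction R S ((a \<otimes> t) \<oplus> (b \<otimes> s)) (s \<otimes> t)"
proof -
  have *: "fraction R S ((a' \<otimes> t') \<oplus> (b' \<otimes> s')) (s' \<otimes> t') =
        fraction R S ((a \<otimes> t) \<oplus> (b \<otimes> s)) (s \<otimes> t)"
    if m: "(a', s') \<in> fraction R S a s" "(b', t') \<in> fraction R S b t" for a' s' b' t'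
  proof -
    obtain u v where u: "u \<in> S" "u \<otimes> (a \<otimes> s') = u \<otimes> (a' \<otimes> s)"
      and v: "v \<in> S" "v \<otimes> (b \<otimes> t') = v \<otimes> (b' \<otimes> t)"
      and c: "a' \<in> carrier R" "b' \<in> carrier R" "s' \<in> S" "t' \<in> S"
      using fraction_memD[OF m(1)] fraction_memD[OF m(2)] by blast
    note CS = c(1,2) assms(1,2) c(3,4)[THEN S.mem_carrier] assms(3,4)[THEN S.mem_carrier]
       u(1)[THEN S.mem_carrier] v(1)[THEN S.mem_carrier]
    have "(u \<otimes> v) \<otimes> (((a' \<otimes> t') \<oplus> (b' \<otimes> s')) \<otimes> (s \<otimes> t)) =
          (v \<otimes> t \<otimes> t') \<otimes> (u \<otimes> (a' \<otimes> s)) \<oplus> (u \<otimes> s \<otimes> s') \<otimes> (v \<otimes> (b' \<otimes> t))"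
      using CS by (simp add: m_ac l_distr r_distr)
    also have "\<dots> = (u \<otimes> v) \<otimes> (((a \<otimes> t) \<oplus> (b \<otimes> s)) \<otimes> (s' \<otimes> t'))"
      unfolding u(2)[symmetric] v(2)[symmetric] using CS by (simp add: m_ac l_distr r_distr)
    finally show ?thesis
      using c assms u(1) v(1) S.mem_carrier
      by (subst fraction_eq_iff) (auto intro!: bexI[of _ "u \<otimes> v"])
  qed
  show ?thesis
    unfolding localization_def monoid.simps ring.simps
    by (rule UN_pair_const) (use * fraction_self assms in blast)+
qed

lemma fraction_eqI:
  assumes "a \<in> carrier R" "b \<in> carrier R" "s \<in> S" "t \<in> S" "a \<otimes> t = b \<otimes> s"
  shows "fraction R S a s = fraction R S b t"
  using assms S.one_closed by (subst fraction_eq_iff) auto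

lemma cring_localization: "cring (localization R S)"
proof -
  let ?L = "localization R S"
  have one: "\<one>\<^bsub>?L\<^esub> = fraction R S \<one> \<one>" and zero: "\<zero>\<^bsub>?L\<^esub> = fraction R S \<zero> \<one>"
    by (simp_all add: localization_def)
  note s = localization_mult localization_add one zero
  have ex: "\<exists>a s. x = fraction R S a s \<and> a \<in> carrier R \<and> s \<in> S" if "x \<in> carrier ?L" for x
    using that by (auto simp: localization_carrier)
  have mem: "fraction R S a s \<in> carrier ?L" if "a \<in> carrier R" "s \<in> S" for a s
    using that by (auto simp: localization_carrier)
  note SC = S.mem_carrier S.one_closed S.m_closed
  show ?thesis
  proof (rule cringI)
    show "abelian_group ?L"
    proof (rule abelian_groupI)
      fix x y assume "x \<in> carrier ?L" "y \<in> carrier ?L"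
      then obtain a s b t where e: "x = fraction R S a s" "a \<in> carrier R" "s \<in> S"
          "y = fraction R S b t" "b \<in> carrier R" "t \<in> S"
        using ex by metis
      show "x \<oplus>\<^bsub>?L\<^esub> y \<in> carrier ?L" using e SC by (simp add: localization_add mem)
      show "x \<oplus>\<^bsub>?L\<^esub> y = y \<oplus>\<^bsub>?L\<^esub> x"
        using e SC by (simp add: localization_add a_comm m_comm)
      fix z assume "z \<in> carrier ?L"
      then obtain c r where f: "z = fraction R S c r" "c \<in> carrier R" "r \<in> S" using ex by metis
      show "x \<oplus>\<^bsub>?L\<^esub> y \<oplus>\<^bsub>?L\<^esub> z = x \<oplus>\<^bsub>?L\<^esub> (y \<oplus>\<^bsub>?L\<^esub> z)"
        using e f SC by (simp add: localization_add l_distr r_distr m_ac a_ac)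
    next
      show "\<zero>\<^bsub>?L\<^esub> \<in> carrier ?L" using SC by (simp add: zero mem)
      fix x assume "x \<in> carrier ?L"
      then obtain a s where e: "x = fraction R S a s" "a \<in> carrier R" "s \<in> S" using ex by metis
      show "\<zero>\<^bsub>?L\<^esub> \<oplus>\<^bsub>?L\<^esub> x = x" using e SC by (simp add: zero localization_add)
      have "fraction R S (\<ominus> a) s \<oplus>\<^bsub>?L\<^esub> x = fraction R S ((\<ominus> a) \<otimes> s \<oplus> a \<otimes> s) (s \<otimes> s)"
        using e by (simp add: localization_add)
      also have "\<dots> = \<zero>\<^bsub>?L\<^esub>"
        unfolding zero using e SC by (intro fraction_eqI) (simp_all add: l_distr[symmetric] l_neg)
      finally have "fraction R S (\<ominus> a) s \<oplus>\<^bsub>?L\<^esub> x = \<zero>\<^bsub>?L\<^esub>" .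
      thus "\<exists>y\<in>carrier ?L. y \<oplus>\<^bsub>?L\<^esub> x = \<zero>\<^bsub>?L\<^esub>"
        by (rule bexI) (rule mem[OF a_inv_closed[OF e(2)] e(3)])
    qed
    show "comm_monoid ?L"
    proof (rule comm_monoidI)
      fix x y assume "x \<in> carrier ?L" "y \<in> carrier ?L"
      then obtain a s b t where e: "x = fraction R S a s" "a \<in> carrier R" "s \<in> S"
          "y = fraction R S b t" "b \<in> carrier R" "t \<in> S"
        using ex by metis
      show "x \<otimes>\<^bsub>?L\<^esub> y \<in> carrier ?L" using e SC by (simp add: localization_mult mem)
      show "x \<otimes>\<^bsub>?L\<^esub> y = y \<otimes>\<^bsub>?L\<^esub> x" using e SC by (simp add: localization_mult m_comm)
      fix z assume "z \<in> carrier ?L"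
      then obtain c r where f: "z = fraction R S c r" "c \<in> carrier R" "r \<in> S" using ex by metis
      show "x \<otimes>\<^bsub>?L\<^esub> y \<otimes>\<^bsub>?L\<^esub> z = x \<otimes>\<^bsub>?L\<^esub> (y \<otimes>\<^bsub>?L\<^esub> z)"
        using e f SC by (simp add: localization_mult m_assoc)
    next
      show "\<one>\<^bsub>?L\<^esub> \<in> carrier ?L" using SC by (simp add: one mem)
      fix x assume "x \<in> carrier ?L"
      then obtain a s where e: "x = fraction R S a s" "a \<in> carrier R" "s \<in> S" using ex by metis
      show "\<one>\<^bsub>?L\<^esub> \<otimes>\<^bsub>?L\<^esub> x = x" using e SC by (simp add: one localization_mult)
    qed
    fix x y z assume "x \<in> carrier ?L" "y \<in> carrier ?L" "z \<in> carrier ?L"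
    then obtain a s b t c r where e: "x = fraction R S a s" "a \<in> carrier R" "s \<in> S"
          "y = fraction R S b t" "b \<in> carrier R" "t \<in> S"
          "z = fraction R S c r" "c \<in> carrier R" "r \<in> S"
        using ex by metis
    show "(x \<oplus>\<^bsub>?L\<^esub> y) \<otimes>\<^bsub>?L\<^esub> z = x \<otimes>\<^bsub>?L\<^esub> z \<oplus>\<^bsub>?L\<^esub> y \<otimes>\<^bsub>?L\<^esub> z"
      using e SC
      by (simp add: localization_mult localization_add, intro fraction_eqI)
         (simp_all add: l_distr r_distr m_ac)
  qed
qed

end

lemma cring_localization_prime:
  assumes "cring R" "primeideal P R"
  shows "cring (localization R (carrier R - P))"
proof (rule cring_localization[OF assms(1)])
  interpret primeideal P R by (rule assms(2))
  show "submonoid (carrier R - P) R"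
  proof
    show "\<one>\<^bsub>R\<^esub> \<in> carrier R - P" using I_notcarr one_imp_carrier by auto
  qed (use I_prime in auto)
qed

lemma algebra_O_Z: "algebra complex_alg (O_Z n)"
proof -
  let ?P = "O_V n"
  let ?H = "carrier (O_Z n)"
  interpret P: cring ?P by (rule cring_poly_alg)
  interpret C: cring complex_alg by (rule cring_complex_alg)
  interpret PM: algebra complex_alg ?P by (rule algebra_poly_alg)
  have ev: "poly_eval complex_alg v \<in> alg_hom ?P complex_alg" for v
    by (rule poly_eval_hom[OF algebra_complex_alg]) (simp add: complex_alg_def)
  have H: "ring_hom_cring ?P complex_alg (poly_eval complex_alg v)" for v
    by (intro ring_hom_cring.intro ring_hom_cring_axioms.intro P.cring_axioms C.cring_axioms
          alg_homD(1)[OF ev])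
  note eD = alg_homD[OF ev]
  have Z: "O_Z n = ?P\<lparr>carrier := ?H\<rparr>" by (simp add: O_Z_def)
  have sub: "?H \<subseteq> carrier ?P" by (auto simp: O_Z_def)
  have neg: "poly_eval complex_alg v (\<ominus>\<^bsub>?P\<^esub> p) = \<ominus>\<^bsub>complex_alg\<^esub> poly_eval complex_alg v p"
    if "p \<in> carrier ?P" for v p
    by (rule ring_hom_cring.hom_a_inv[OF H that])
  have "subcring ?H ?P"
    by (rule P.subcringI', rule P.subringI)
       (auto simp: O_Z_def eD neg P.m_closed P.a_closed)
  hence cr: "cring (O_Z n)" using P.subcring_iff[OF sub] Z by simp
  have ops: "mult (O_Z n) = mult ?P" "add (O_Z n) = add ?P" "smult (O_Z n) = smult ?P" "one (O_Z n) = one ?P"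
    by (simp_all add: O_Z_def)
  have sm: "c \<odot>\<^bsub>?P\<^esub> p \<in> ?H" if "p \<in> ?H" for c p
    using that PM.smult_closed[of c p] eD(6) by (auto simp: O_Z_def complex_alg_def)
  show ?thesis
    by (rule algebraI[OF cring_complex_alg cr])
       (use sub sm in \<open>auto simp: ops subset_iff PM.smult_l_distr PM.smult_r_distr PM.smult_assoc1
          PM.smult_assoc2 PM.smult_one\<close>)
qed

end

theory Submission
  imports Defs
    "Jordan_Normal_Form.Determinant"
    "HOL-Computational_Algebra.Formal_Power_Series"
    "HOL-Library.Countable"
    "HOL-Library.Product_Lexorder"
begin

text \<open>
  Write \<open>M\<close> for the matrix of the pairings \<open>\<langle>\<xi>\<^sub>j, x\<^sub>i\<rangle>\<close> and \<open>d\<close> for the vector of the signed maximal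
  minors of \<open>(x\<^sub>0, \<dots>, x\<^sub>n)\<close>, so that \<open>M d = 0\<close> by Cramer's rule. For a suitable weight the
  coefficients of \<open>M(t) d(t)\<close> have pairwise coprime leading monomials, none of which involves
  \<open>d\<^sub>0(0)\<close> or \<open>d\<^sub>1(0)\<close>; hence modulo these coefficients the standard monomials are a basis and
  \<open>d\<^sub>0(0), d\<^sub>1(0)\<close> is a regular sequence. Where \<open>d\<^sub>c(0)\<close> is invertible, the group moves every jet
  into a slice whose coordinates are polynomials in the jets of \<open>M\<close>, \<open>d\<close> and in \<open>1 / d\<^sub>c(0)\<close>. So an
  invariant becomes a polynomial in the jets of \<open>M\<close> and \<open>d\<close> after multiplication by a power of
  \<open>d\<^sub>0(0)\<close>, and likewise for \<open>d\<^sub>1(0)\<close>; regularity removes the denominators. The same slice shows that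
  all relations between the jets of \<open>M\<close> and \<open>d\<close> come from \<open>M(t) d(t) = 0\<close>. The case \<open>m = 0\<close> gives
  generators and relations of \<open>O(Z)\<close>, hence of \<open>O(Z\<^sub>m)\<close>, and \<open>p\<^sub>m\<^sup>*\<close> is an isomorphism. Normality
  follows because invariants in the integrally closed domain \<open>O(V\<^sub>m)\<close> are integrally closed.
\<close>

text \<open>The slice sees only the locus where \<open>d_0(0)\<close> or \<open>d_1(0)\<close> is a
  unit, so what may happen elsewhere has to be controlled at every jet order. This is what the
  weight is for: the n - 1 relations of each order need leading monomials on disjoint sets of
  variables, and \<open>d_0(0)\<close>, \<open>d_1(0)\<close> must stay free. In the coefficient of
  t^k in row j the leading product couples the d-coefficient of index nk + j + 2 with the
  M-coefficient of index k - j - 2. As j + 2 runs through 2, ..., n, the first indices are pairwise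
  distinct and never 0 or 1; for fixed j the second ones are distinct as well.

  Jets of every order are represented by full power series. Nothing is lost, since points of SL_n
  and V over C[t]/(t^(m+1)) lift to C[[t]]. For m = \<infinity> each polynomial involves finitely
  many orders only, so finite orders suffice.

  Polynomials are compared by their values at complex points. Integral closedness of polynomial
  rings comes from division with remainder along a line, so that unique factorization never
  enters.\<close>

section \<open>Evaluation of polynomials in commutative algebras\<close>

hide_const (open) Polynomial.smult
alias keys = Poly_Mapping.keys
alias lookup = Poly_Mapping.lookup
alias single = Poly_Mapping.single

text \<open>As a type class, complex algebras need no carrier conditions, so power series,
  polynomials and matrices over them can be computed with by rewriting. \<open>scal\<close> is the
  structure map.\<close>

class complex_algebra = comm_ring_1 +
  fixes scal :: "complex \<Rightarrow> 'a"
  assumes scal_add: "scal (c + d) = scal c + scal d"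
    and scal_mult: "scal (c * d) = scal c * scal d"
    and scal_one: "scal 1 = 1"
begin

lemma scal_zero: "scal 0 = 0"
  using scal_add[of 0 0] by simp

end

instantiation complex :: complex_algebra
begin
definition scal_complex :: "complex \<Rightarrow> complex" where "scal_complex c = c"
instance by standard (auto simp: scal_complex_def)
end

instantiation fps :: (complex_algebra) complex_algebra
begin
definition scal_fps :: "complex \<Rightarrow> 'a fps" where "scal_fps c = fps_const (scal c)"
instance by standard (auto simp: scal_fps_def scal_add scal_mult scal_one fps_const_add[symmetric] fps_const_mult[symmetric] simp del: fps_const_add fps_const_mult)
end

instantiation poly :: (complex_algebra) complex_algebra
begin
definition scal_poly :: "complex \<Rightarrow> 'a poly" where "scal_poly c = [:scal c:]"
instance by standard (auto simp: scal_poly_def scal_add scal_mult scal_one)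
end

instantiation poly_mapping :: (comm_monoid_add, complex_algebra) complex_algebra
begin
definition scal_poly_mapping :: "complex \<Rightarrow> 'a \<Rightarrow>\<^sub>0 'b" where
  "scal_poly_mapping c = single 0 (scal c)"
instance by standard (auto simp: scal_poly_mapping_def scal_add scal_mult scal_one single_add mult_single)
end

lemma scal_mpoly: "(scal c :: 'x mpoly) = single 0 c"
  by (simp add: scal_poly_mapping_def scal_complex_def)

text \<open>The link back to the algebras given as records: what is known about
  \<open>poly_eval\<close> and \<open>alg_hom\<close> applies to type class algebras through this
  record.\<close>

definition class_alg :: "(complex, 'a::complex_algebra) module" where
  "class_alg =
     \<lparr>carrier = UNIV, mult = (*), one = 1, zero = 0, add = (+), smult = (\<lambda>c x. scal c * x)\<rparr>"

lemma class_alg_simps: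
  "carrier class_alg = UNIV" "x \<otimes>\<^bsub>class_alg\<^esub> y = x * y" "x \<oplus>\<^bsub>class_alg\<^esub> y = x + y"
  "\<one>\<^bsub>class_alg\<^esub> = 1" "\<zero>\<^bsub>class_alg\<^esub> = 0" "c \<odot>\<^bsub>class_alg\<^esub> x = scal c * x"
  by (simp_all add: class_alg_def)

lemma complex_alg_eq_class_alg: "complex_alg = class_alg"
  by (simp add: complex_alg_def class_alg_def scal_complex_def)

lemma cring_class_alg: "cring (class_alg :: (complex, 'a::complex_algebra) module)"
proof (rule cringI)
  show "abelian_group (class_alg :: (complex, 'a) module)"
    by (rule abelian_groupI) (auto simp: class_alg_simps add_ac intro: exI[of _ "- x" for x])
  show "comm_monoid (class_alg :: (complex, 'a) module)"
    by (rule comm_monoidI) (auto simp: class_alg_simps mult_ac)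
qed (auto simp: class_alg_simps algebra_simps)

lemma algebra_class_alg: "algebra complex_alg (class_alg :: (complex, 'a::complex_algebra) module)"
  by (rule algebraI[OF cring_complex_alg cring_class_alg])
     (auto simp: class_alg_simps complex_alg_def algebra_simps scal_add scal_mult scal_one)

lemma class_alg_nat_pow: "x [^]\<^bsub>class_alg\<^esub> (n::nat) = x ^ n"
  by (induction n) (auto simp: nat_pow_def class_alg_simps mult.commute)

lemma class_alg_finprod: "finprod class_alg f A = prod f A"
proof -
  interpret cring "class_alg :: (complex, 'a) module" by (rule cring_class_alg)
  show ?thesis by (induction A rule: infinite_finite_induct) (auto simp: class_alg_simps)
qed

lemma class_alg_finsum: "finsum class_alg f A = sum f A"
proof -
  interpret cring "class_alg :: (complex, 'a) module" by (rule cring_class_alg)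
  show ?thesis by (induction A rule: infinite_finite_induct) (auto simp: class_alg_simps)
qed

definition peval :: "('x \<Rightarrow> 'a::complex_algebra) \<Rightarrow> 'x mpoly \<Rightarrow> 'a" where
  "peval v p = poly_eval class_alg v p"

lemma peval_altdef:
  "peval v p = (\<Sum>\<mu>\<in>keys p. scal (lookup p \<mu>) *
     (\<Prod>x\<in>keys \<mu>. v x ^ lookup \<mu> x))"
  by (simp add: peval_def poly_eval_def class_alg_simps class_alg_nat_pow class_alg_finprod
      class_alg_finsum)

lemma in_poly_alg_UNIV: "p \<in> carrier (poly_alg UNIV)"
  by (simp add: poly_alg_def)

lemma peval_hom: "peval v \<in> alg_hom (poly_alg S) class_alg"
  using poly_eval_hom[OF algebra_class_alg, of UNIV v]
  by (auto simp: alg_hom_def peval_def[abs_def] Ring.ring_hom_def class_alg_simps in_poly_alg_UNIV poly_alg_simps)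

lemma peval_simps [simp]:
  "peval v 0 = 0" "peval v 1 = 1" "peval v (p + q) = peval v p + peval v q"
  "peval v (p * q) = peval v p * peval v q" "peval v (poly_var x) = v x"
  "peval v (scal c) = scal c"
proof -
  note h = alg_homD[OF peval_hom[of v "UNIV"], simplified class_alg_simps poly_alg_simps]
  show add: "peval v (p + q) = peval v p + peval v q" by (rule h) (auto simp: in_poly_alg_UNIV)
  show mult: "peval v (p * q) = peval v p * peval v q" by (rule h) (auto simp: in_poly_alg_UNIV)
  show "peval v 1 = 1" by (rule h)
  show "peval v 0 = 0" by (simp add: peval_altdef)
  show "peval v (poly_var x) = v x"
    by (simp add: peval_altdef poly_var_def scal_one)
  show "peval v (scal c) = scal c"
    by (simp add: peval_altdef scal_mpoly scal_zero)
qed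

interpretation peval: comm_ring_hom "peval v"
  by unfold_locales auto

lemma peval_single: "peval v (single \<mu> c) =
    scal c * (\<Prod>x\<in>keys \<mu>. v x ^ lookup \<mu> x)"
  by (simp add: peval_altdef scal_zero)

lemma peval_cong:
  assumes "p \<in> carrier (poly_alg S)" "\<And>x. x \<in> S \<Longrightarrow> v x = w x"
  shows "peval v p = peval w p"
  unfolding peval_altdef
  by (intro sum.cong prod.cong arg_cong2[of _ _ _ _ "(*)"] refl)
     (use assms in \<open>auto simp: poly_alg_def subset_iff\<close>)

lemma peval_var_id: "peval poly_var p = p"
proof -
  have "peval poly_var p = poly_eval class_alg (\<lambda>x. poly_var x) p" by (simp add: peval_def)
  also have "\<dots> = p"
    by (rule poly_hom_unique[OF algebra_class_alg, of "\<lambda>x. x" UNIV, symmetric])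
       (auto simp: alg_hom_def Ring.ring_hom_def class_alg_simps poly_alg_simps in_poly_alg_UNIV scal_mpoly)
  finally show ?thesis .
qed

lemma poly_alg_minus_closed:
  "p \<in> carrier (poly_alg S) \<Longrightarrow> q \<in> carrier (poly_alg S) \<Longrightarrow> p - q \<in> carrier (poly_alg S)"
  using poly_alg_add_closed[OF _ poly_alg_uminus_closed, of p S q] by simp

lemma poly_alg_zero_closed: "0 \<in> carrier (poly_alg S)"
  and poly_alg_one_closed: "1 \<in> carrier (poly_alg S)"
  by (auto simp: poly_alg_def)

lemma poly_alg_scal_closed: "scal c \<in> carrier (poly_alg S)"
  by (simp add: scal_mpoly poly_alg_const_closed)

lemma poly_alg_sum_closed:
  "(\<And>i. i \<in> A \<Longrightarrow> f i \<in> carrier (poly_alg S)) \<Longrightarrow> sum f A \<in> carrier (poly_alg S)"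
  by (induction A rule: infinite_finite_induct)
     (auto intro: poly_alg_add_closed poly_alg_zero_closed)

lemma poly_alg_prod_closed:
  "(\<And>i. i \<in> A \<Longrightarrow> f i \<in> carrier (poly_alg S)) \<Longrightarrow> prod f A \<in> carrier (poly_alg S)"
  by (induction A rule: infinite_finite_induct)
     (auto intro: poly_alg_mult_closed poly_alg_one_closed)

lemma poly_alg_power_closed: "p \<in> carrier (poly_alg S) \<Longrightarrow> p ^ k \<in> carrier (poly_alg S)"
  by (induction k) (auto intro: poly_alg_mult_closed poly_alg_one_closed)

lemmas poly_alg_closed =
  poly_alg_add_closed poly_alg_minus_closed poly_alg_mult_closed poly_alg_zero_closed
  poly_alg_one_closed poly_alg_scal_closed poly_alg_sum_closed poly_alg_prod_closed
  poly_alg_power_closed poly_alg_uminus_closed poly_var_closed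

lemma poly_alg_mono: "p \<in> carrier (poly_alg S) \<Longrightarrow> S \<subseteq> T \<Longrightarrow> p \<in> carrier (poly_alg T)"
  by (auto simp: poly_alg_def)

lemma single_eq_prod:
  "single \<mu> c = scal c * (\<Prod>x\<in>keys \<mu>. poly_var x ^ lookup \<mu> x)"
  using peval_single[of poly_var \<mu> c] by (simp add: peval_var_id)

lemma poly_alg_induct [consumes 1, case_names scal var add mult]:
  assumes p: "p \<in> carrier (poly_alg S)"
    and scal: "\<And>c. Q (scal c)" and var: "\<And>x. x \<in> S \<Longrightarrow> Q (poly_var x)"
    and add: "\<And>p q. Q p \<Longrightarrow> Q q \<Longrightarrow> Q (p + q)" and mult: "\<And>p q. Q p \<Longrightarrow> Q q \<Longrightarrow> Q (p * q)"
  shows "Q p"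
  using p
proof (induction p rule: poly_induct)
  case zero
  show ?case using scal[of 0] by (simp add: scal_zero)
next
  case (add p \<mu> c)
  have one: "Q 1" using scal[of 1] by (simp add: scal_one)
  have pow: "Q (poly_var x ^ k)" if "x \<in> S" for x and k :: nat
    by (induction k) (use one var[OF that] mult in auto)
  have "Q (\<Prod>x\<in>A. poly_var x ^ lookup \<mu> x)" if "A \<subseteq> S" for A
    using that by (induction A rule: infinite_finite_induct) (auto simp: one pow mult)
  thus ?case using add assms(4) by (auto simp: single_eq_prod[of \<mu> c] intro!: assms mult)
qed

lemma peval_closed:
  assumes "p \<in> carrier (poly_alg S)" "\<And>x. x \<in> S \<Longrightarrow> v x \<in> carrier (poly_alg T)"
  shows "peval v p \<in> carrier (poly_alg T)"
  using assms(1) by (induction rule: poly_alg_induct) (auto intro: poly_alg_closed assms(2))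

lemma hom_peval:
  assumes "comm_ring_hom h" "\<And>c. h (scal c) = scal c"
  shows "h (peval v p) = peval (\<lambda>x. h (v x)) p"
proof -
  interpret comm_ring_hom h by fact
  show ?thesis using in_poly_alg_UNIV[of p]
    by (induction p rule: poly_alg_induct) (auto simp: assms(2) hom_distribs)
qed

lemma peval_peval: "peval v (peval w p) = peval (\<lambda>x. peval v (w x)) p"
  by (rule hom_peval) (auto intro: peval.comm_ring_hom_axioms)

section \<open>Polynomials as functions\<close>

text \<open>Dedekind's argument: monomials are pairwise distinct multiplicative characters.\<close>

lemma characters_independent:
  assumes "finite F" "\<And>v :: 'x \<Rightarrow> complex. (\<Sum>\<mu>\<in>F. c \<mu> * peval v (single \<mu> 1)) = 0" "\<mu> \<in> F"
  shows "c \<mu> = 0"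
  using assms
proof (induction F arbitrary: c \<mu> rule: finite_induct)
  case (insert \<nu> F)
  let ?\<chi> = "\<lambda>v \<mu>. peval (v :: 'x \<Rightarrow> complex) (single \<mu> 1)"
  have mult: "?\<chi> (\<lambda>x. v x * w x) \<mu> = ?\<chi> v \<mu> * ?\<chi> w \<mu>" for v w \<mu>
    by (simp add: peval_single power_mult_distrib prod.distrib scal_one)
  \<comment> \<open>The relation at the pointwise product of \<open>v\<close> and \<open>w\<close>,
    minus \<open>?\<chi> w \<nu>\<close> times the relation at \<open>v\<close>, has no
    \<open>\<nu>\<close> term.\<close>
  have F: "c \<mu> * (?\<chi> w \<mu> - ?\<chi> w \<nu>) = 0" if "\<mu> \<in> F" for \<mu> w
  proof (rule insert.IH[OF _ that])
    fix v
    have "(\<Sum>\<mu>\<in>insert \<nu> F. c \<mu> * ?\<chi> (\<lambda>x. v x * w x) \<mu>) -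
       ?\<chi> w \<nu> * (\<Sum>\<mu>\<in>insert \<nu> F. c \<mu> * ?\<chi> v \<mu>) = 0"
      using insert.prems(1) by simp
    thus "(\<Sum>\<mu>\<in>F. c \<mu> * (?\<chi> w \<mu> - ?\<chi> w \<nu>) * ?\<chi> v \<mu>) = 0"
      using insert.hyps
      by (simp add: mult sum_distrib_left algebra_simps sum_subtractf sum.distrib)
  qed
  have c0: "c \<mu> = 0" if \<mu>: "\<mu> \<in> F" for \<mu>
  proof -
    have "\<mu> \<noteq> \<nu>" using \<mu> insert.hyps by auto
    then obtain x where x: "lookup \<mu> x \<noteq> lookup \<nu> x"
      by (meson poly_mapping_eqI)
    \<comment> \<open>2 is not a root of unity, so its powers tell the exponents of \<open>x\<close>
      apart.\<close>
    let ?w = "\<lambda>y. if y = x then 2 else 1 :: complex"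
    have e: "?\<chi> ?w \<kappa> = 2 ^ lookup \<kappa> x" for \<kappa>
    proof -
      have "?\<chi> ?w \<kappa> = (\<Prod>y\<in>keys \<kappa>. if y = x then 2 ^ lookup \<kappa> x else 1)"
        unfolding peval_single scal_one mult_1 by (intro prod.cong) auto
      thus ?thesis by (auto simp: prod.delta in_keys_iff)
    qed
    have "(2::complex) ^ lookup \<mu> x = 2 ^ lookup \<nu> x \<Longrightarrow> False"
    proof -
      assume "(2::complex) ^ lookup \<mu> x = 2 ^ lookup \<nu> x"
      hence "cmod (2 ^ lookup \<mu> x) = cmod (2 ^ lookup \<nu> x)" by simp
      thus False using x by (simp add: norm_power)
    qed
    thus ?thesis using F[OF \<mu>, of ?w] by (auto simp: e)
  qed
  have "c \<nu> = 0"
    using insert.prems(1)[of "\<lambda>_. 1"] insert.hyps c0 by (simp add: peval_single scal_one)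
  thus ?case using c0 insert.prems(2) by auto
qed simp

text \<open>Brings identities of polynomials back to identities of complex numbers, where group
  elements and slices can be applied.\<close>

lemma peval_eq_0_imp_eq_0:
  fixes p :: "'x mpoly"
  assumes "\<And>v :: 'x \<Rightarrow> complex. peval v p = 0"
  shows "p = 0"
proof -
  have "lookup p \<mu> = 0" if \<mu>: "\<mu> \<in> keys p" for \<mu>
  proof (rule characters_independent[OF _ _ \<mu>, where c = "lookup p"])
    fix v :: "'x \<Rightarrow> complex"
    show "(\<Sum>\<mu>\<in>keys p. lookup p \<mu> * peval v (single \<mu> 1)) = 0"
      using assms[of v] by (simp add: peval_altdef[of v p] peval_single scal_complex_def)
  qed simp
  thus ?thesis by (metis poly_mapping_eqI in_keys_iff lookup_zero)
qed

lemma peval_line: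
  fixes a b :: "'x \<Rightarrow> complex"
  shows "poly (peval (\<lambda>x. [:a x, b x:]) p) t = peval (\<lambda>x. a x + t * b x) p"
proof -
  have "comm_ring_hom (\<lambda>q. poly q t)" by unfold_locales auto
  from hom_peval[OF this, of "\<lambda>x. [:a x, b x:]" p] show ?thesis
    by (simp add: scal_poly_def)
qed

text \<open>Functions that are polynomial on lines obey the zero product rule; restrict to the line
  through points where the factors do not vanish.\<close>

lemma peval_mult_eq_0:
  fixes p q :: "'x mpoly"
  assumes pq: "\<And>v :: 'x \<Rightarrow> complex. peval v p * peval v q = 0" and p: "p \<noteq> 0"
  shows "q = 0"
proof (rule peval_eq_0_imp_eq_0)
  fix b :: "'x \<Rightarrow> complex"
  obtain a :: "'x \<Rightarrow> complex" where a: "peval a p \<noteq> 0" using p peval_eq_0_imp_eq_0 by blast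
  let ?l = "peval (\<lambda>x. [:b x, a x - b x:])"
  have "poly (?l p * ?l q) t = 0" for t
    unfolding poly_mult peval_line by (rule pq)
  hence "?l p * ?l q = 0" using poly_all_0_iff_0 by blast
  moreover have "poly (?l p) 1 \<noteq> 0" unfolding peval_line using a by simp
  ultimately have "?l q = 0" by auto
  hence "poly (?l q) 0 = 0" by simp
  thus "peval b q = 0" unfolding peval_line by simp
qed

lemma mpoly_eq_sum_singles:
  "p = (\<Sum>\<mu>\<in>keys p. single \<mu> (lookup p \<mu>))"
  by (rule poly_mapping_eqI) (auto simp: lookup_sum lookup_single when_def in_keys_iff)

section \<open>Normal forms modulo polynomials with coprime leading monomials\<close>

text \<open>Polynomials with pairwise coprime leading monomials are a Groebner basis by Buchberger's
  criterion. No S-polynomials are reduced here: coprimality allows all leading monomials to be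
  divided out of a monomial at once, which yields a triangular linear map. Leading refers to the
  weight alone; the other monomials of \<open>F s\<close> are strictly lighter, so no monomial order
  is chosen.\<close>

locale coprime_leading =
  fixes U :: "'x set" and J :: "'s set" and u v :: "'s \<Rightarrow> 'x" and F :: "'s \<Rightarrow> 'x mpoly"
    and \<omega> :: "'x \<Rightarrow> nat"
  assumes fin: "finite J"
    and uU: "s \<in> J \<Longrightarrow> u s \<in> U" and vU: "s \<in> J \<Longrightarrow> v s \<in> U"
    and inj_u: "inj_on u J" and inj_v: "inj_on v J" and u_v: "s \<in> J \<Longrightarrow> s' \<in> J \<Longrightarrow> u s \<noteq> v s'"
    and FU: "s \<in> J \<Longrightarrow> F s \<in> carrier (poly_alg U)"
    and F_tail: "s \<in> J \<Longrightarrow>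
       \<mu> \<in> keys (F s - poly_var (u s) * poly_var (v s)) \<Longrightarrow>
       (\<Sum>x\<in>keys \<mu>. lookup \<mu> x * \<omega> x) < \<omega> (u s) + \<omega> (v s)"
begin

abbreviation "P \<equiv> carrier (poly_alg U)"

section \<open>The weight filtration and leading monomials\<close>

definition wt :: "('x \<Rightarrow>\<^sub>0 nat) \<Rightarrow> nat" where
  "wt \<mu> = (\<Sum>x\<in>keys \<mu>. lookup \<mu> x * \<omega> x)"

lemma wt_superset: "finite A \<Longrightarrow> keys \<mu> \<subseteq> A \<Longrightarrow> wt \<mu> = (\<Sum>x\<in>A. lookup \<mu> x * \<omega> x)"
  unfolding wt_def by (rule sum.mono_neutral_left) (auto simp: in_keys_iff)

lemma wt_add: "wt (\<mu> + \<nu>) = wt \<mu> + wt \<nu>"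
proof -
  let ?A = "keys \<mu> \<union> keys \<nu>"
  show ?thesis
    using wt_superset[of ?A "\<mu> + \<nu>"] wt_superset[of ?A \<mu>] wt_superset[of ?A \<nu>]
      Poly_Mapping.keys_add[of \<mu> \<nu>]
    by (simp add: lookup_add algebra_simps sum.distrib)
qed

lemma wt_single: "wt (single x k) = k * \<omega> x"
  by (simp add: wt_def)

text \<open>The strict inequality makes \<open>W 0\<close> the zero space, where the inductions over
  the filtration start.\<close>

definition W :: "nat \<Rightarrow> 'x mpoly set" where
  "W k = {p \<in> P. \<forall>\<mu>\<in>keys p. wt \<mu> < k}"

lemma W_P: "p \<in> W k \<Longrightarrow> p \<in> P"
  by (simp add: W_def)

lemma W_mono: "p \<in> W k \<Longrightarrow> k \<le> l \<Longrightarrow> p \<in> W l"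
  by (fastforce simp: W_def)

lemma W_0: "p \<in> W 0 \<longleftrightarrow> p = 0"
  by (auto simp: W_def poly_alg_zero_closed)

lemma W_zero: "0 \<in> W k"
  by (auto simp: W_def poly_alg_zero_closed)

lemma W_add: "p \<in> W k \<Longrightarrow> q \<in> W k \<Longrightarrow> p + q \<in> W k"
  using Poly_Mapping.keys_add[of p q] by (auto simp: W_def poly_alg_add_closed)

lemma W_uminus: "p \<in> W k \<Longrightarrow> - p \<in> W k"
  by (auto simp: W_def poly_alg_uminus_closed in_keys_iff)

lemma W_minus: "p \<in> W k \<Longrightarrow> q \<in> W k \<Longrightarrow> p - q \<in> W k"
  using W_add[OF _ W_uminus, of p k q] by simp

lemma W_sum: "(\<And>i. i \<in> A \<Longrightarrow> f i \<in> W k) \<Longrightarrow> sum f A \<in> W k"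
  by (induction A rule: infinite_finite_induct) (auto simp: W_zero W_add)

lemma W_mult:
  assumes "p \<in> W k" "q \<in> W l"
  shows "p * q \<in> W (k + l)"
proof -
  have "wt \<mu> < k + l" if \<mu>: "\<mu> \<in> keys (p * q)" for \<mu>
  proof -
    obtain a b where "\<mu> = a + b" "a \<in> keys p" "b \<in> keys q"
      using \<mu> Poly_Mapping.keys_mult[of p q] by blast
    thus ?thesis using assms by (auto simp: W_def wt_add intro: add_strict_mono)
  qed
  thus ?thesis using assms by (auto simp: W_def poly_alg_mult_closed)
qed

lemma W_mult_single:
  assumes "p \<in> W k" "keys \<nu> \<subseteq> U"
  shows "p * single \<nu> c \<in> W (k + wt \<nu>)"
proof -
  have "wt \<mu> < k + wt \<nu>" if \<mu>: "\<mu> \<in> keys (p * single \<nu> c)" for \<mu>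
  proof -
    have "\<exists>a. \<mu> = a + \<nu> \<and> a \<in> keys p"
      using \<mu> Poly_Mapping.keys_mult[of p "single \<nu> c"] by (auto split: if_splits)
    thus ?thesis using assms by (auto simp: W_def wt_add)
  qed
  thus ?thesis using assms by (auto simp: W_def poly_alg_mult_closed single_closed)
qed

definition lead :: "'x mpoly \<Rightarrow> ('x \<Rightarrow>\<^sub>0 nat) \<Rightarrow> bool" where
  "lead p \<mu> \<longleftrightarrow> keys \<mu> \<subseteq> U \<and> p - single \<mu> 1 \<in> W (wt \<mu>)"

lemma lead_single: "keys \<mu> \<subseteq> U \<Longrightarrow> lead (single \<mu> 1) \<mu>"
  by (simp add: lead_def W_zero)

lemma lead_mult:
  assumes "lead p \<mu>" "lead q \<nu>"
  shows "lead (p * q) (\<mu> + \<nu>)"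
proof -
  let ?m = "single \<mu> 1 :: 'x mpoly" and ?n = "single \<nu> 1 :: 'x mpoly"
  have eq: "p * q - single (\<mu> + \<nu>) 1 = (p - ?m) * (q - ?n) + (p - ?m) * ?n + (q - ?n) * ?m"
    using mult_single[of \<mu> "1::complex" \<nu> 1] by (simp add: algebra_simps)
  have "\<dots> \<in> W (wt \<mu> + wt \<nu>)"
    using assms W_mult_single[of "p - ?m" "wt \<mu>" \<nu> 1] W_mult_single[of "q - ?n" "wt \<nu>" \<mu> 1]
      W_mult[of "p - ?m" "wt \<mu>" "q - ?n" "wt \<nu>"] W_add
    by (auto simp: lead_def add.commute[of "wt \<nu>"])
  thus ?thesis
    using assms Poly_Mapping.keys_add[of \<mu> \<nu>] unfolding lead_def eq wt_add by blast
qed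

lemma lead_1: "lead 1 0"
  using lead_single[of 0] by simp

lemma lead_power: "lead p \<mu> \<Longrightarrow> lead (p ^ k) (\<Sum>i<k. \<mu>)"
  by (induction k) (auto simp: lead_1 intro!: lead_mult simp: add.commute)

lemma lead_prod: "(\<And>s. s \<in> A \<Longrightarrow> lead (f s) (m s)) \<Longrightarrow> lead (prod f A) (sum m A)"
  by (induction A rule: infinite_finite_induct) (auto simp: lead_1 intro!: lead_mult)

section \<open>Dividing a monomial by all leading monomials at once\<close>

definition lm :: "'s \<Rightarrow> 'x \<Rightarrow>\<^sub>0 nat" where
  "lm s = single (u s) 1 + single (v s) 1"

lemma single_lm: "single (lm s) 1 = poly_var (u s) * poly_var (v s)"
  by (simp add: lm_def poly_var_def mult_single)

lemma keys_lm: "keys (lm s) = {u s, v s}"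
  by (auto simp: lm_def in_keys_iff lookup_add lookup_single when_def split: if_splits)

lemma lead_F: "s \<in> J \<Longrightarrow> lead (F s) (lm s)"
  using F_tail[of s] FU[of s] uU[of s] vU[of s] wt_add wt_single
  by (auto simp: lead_def single_lm keys_lm W_def wt_def[symmetric] intro!: poly_alg_closed)
     (simp add: lm_def wt_add wt_single)

text \<open>As \<open>u s\<close> and \<open>v s\<close> differ, this is the multiplicity with which
  \<open>lm s\<close> divides the monomial.\<close>

definition expo :: "'s \<Rightarrow> ('x \<Rightarrow>\<^sub>0 nat) \<Rightarrow> nat" where
  "expo s \<mu> = min (lookup \<mu> (u s)) (lookup \<mu> (v s))"

definition lpart :: "('x \<Rightarrow>\<^sub>0 nat) \<Rightarrow> 'x \<Rightarrow>\<^sub>0 nat" where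
  "lpart \<mu> = (\<Sum>s\<in>J. \<Sum>i<expo s \<mu>. lm s)"

text \<open>
  \<open>T0\<close> replaces the leading monomials dividing \<open>\<mu>\<close> by the polynomials \<open>F s\<close>. Its linear extension \<open>T\<close> is
  unitriangular with respect to the weight, hence bijective, and it maps the monomial ideal generated
  by the leading monomials onto \<open>idl\<close>.
\<close>

definition T0 :: "('x \<Rightarrow>\<^sub>0 nat) \<Rightarrow> 'x mpoly" where
  "T0 \<mu> = single (\<mu> - lpart \<mu>) 1 * (\<Prod>s\<in>J. F s ^ expo s \<mu>)"

lemma lookup_lpart:
  "lookup (lpart \<mu>) x =
     (\<Sum>s\<in>J. expo s \<mu> * ((if u s = x then 1 else 0) + (if v s = x then 1 else 0)))"
  by (simp add: lpart_def lookup_sum lm_def lookup_add lookup_single when_def eq_commute del: One_nat_def)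

lemma lookup_lpart_u: assumes "s \<in> J" shows "lookup (lpart \<mu>) (u s) = expo s \<mu>"
proof -
  have "lookup (lpart \<mu>) (u s) = (\<Sum>t\<in>J. if t = s then expo s \<mu> else 0)"
    unfolding lookup_lpart
    by (rule sum.cong[OF refl]) (use assms inj_u u_v in \<open>fastforce simp: inj_on_def\<close>)
  thus ?thesis using assms fin by simp
qed

lemma lookup_lpart_v: assumes "s \<in> J" shows "lookup (lpart \<mu>) (v s) = expo s \<mu>"
proof -
  have "lookup (lpart \<mu>) (v s) = (\<Sum>t\<in>J. if t = s then expo s \<mu> else 0)"
    unfolding lookup_lpart
    by (rule sum.cong[OF refl]) (use assms inj_v u_v in \<open>fastforce simp: inj_on_def\<close>)
  thus ?thesis using assms fin by simp
qed

lemma lookup_lpart_other: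
  assumes "x \<notin> u ` J" "x \<notin> v ` J" shows "lookup (lpart \<mu>) x = 0"
  unfolding lookup_lpart by (rule sum.neutral) (use assms in auto)

lemma lookup_lpart_le: "lookup (lpart \<mu>) x \<le> lookup \<mu> x"
  by (cases "x \<in> u ` J"; cases "x \<in> v ` J")
     (auto simp: lookup_lpart_u lookup_lpart_v lookup_lpart_other expo_def)

text \<open>Exponents are subtracted with truncation at 0, so this says that
  \<open>lpart \<mu>\<close> divides \<open>\<mu>\<close>. It holds because no variable belongs to
  two leading monomials.\<close>

lemma lpart_split: "\<mu> - lpart \<mu> + lpart \<mu> = \<mu>"
  by (rule poly_mapping_eqI) (simp add: lookup_add lookup_minus lookup_lpart_le)

lemma T0_lead:
  assumes "keys \<mu> \<subseteq> U"
  shows "lead (T0 \<mu>) \<mu>"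
proof -
  have "keys (\<mu> - lpart \<mu>) \<subseteq> U"
    using assms by (auto simp: in_keys_iff lookup_minus subset_iff)
  moreover have "lead (\<Prod>s\<in>J. F s ^ expo s \<mu>) (lpart \<mu>)"
    unfolding lpart_def by (intro lead_prod lead_power lead_F)
  ultimately show ?thesis
    using lead_mult[OF lead_single, of "\<mu> - lpart \<mu>" _ "lpart \<mu>"] by (simp add: lpart_split T0_def)
qed

lemma T0_P: "keys \<mu> \<subseteq> U \<Longrightarrow> T0 \<mu> \<in> P"
proof -
  assume k: "keys \<mu> \<subseteq> U"
  have "T0 \<mu> - single \<mu> 1 + single \<mu> 1 \<in> P"
    using T0_lead[OF k] k by (intro poly_alg_add_closed single_closed) (auto simp: lead_def W_P)
  thus ?thesis by simp
qed

lemma expo_add_lm: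
  assumes "s \<in> J" "t \<in> J"
  shows "expo t (\<mu> + lm s) = expo t \<mu> + (if t = s then 1 else 0)"
  using inj_onD[OF inj_u _ assms] inj_onD[OF inj_v _ assms] u_v[OF assms] u_v[OF assms(2,1)] u_v[OF assms(1,1)]
  by (auto simp: expo_def lookup_add lm_def lookup_single when_def eq_commute[of "v s"])

text \<open>A further factor \<open>lm s\<close> raises only its own multiplicity, whatever else
  divides \<open>\<mu>\<close>. Hence \<open>T\<close> turns multiplication by \<open>lm s\<close>
  into multiplication by \<open>F s\<close>.\<close>

lemma T0_add_lm:
  assumes s: "s \<in> J"
  shows "T0 (\<mu> + lm s) = F s * T0 \<mu>"
proof -
  have "lpart (\<mu> + lm s) = (\<Sum>t\<in>J. (\<Sum>i<expo t \<mu>. lm t) + (if t = s then lm s else 0))"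
    unfolding lpart_def using s by (intro sum.cong refl) (simp add: expo_add_lm)
  also have "\<dots> = lpart \<mu> + lm s"
    using s fin by (simp add: sum.distrib lpart_def)
  finally have 1: "lpart (\<mu> + lm s) = lpart \<mu> + lm s" .
  have "(\<Prod>t\<in>J. F t ^ expo t (\<mu> + lm s)) = (\<Prod>t\<in>J. F t ^ expo t \<mu> * (if t = s then F s else 1))"
    using s by (intro prod.cong refl) (simp add: expo_add_lm)
  also have "\<dots> = F s * (\<Prod>t\<in>J. F t ^ expo t \<mu>)"
    using s fin by (simp add: prod.distrib mult.commute)
  finally show ?thesis by (simp add: T0_def 1 mult_ac)
qed

definition T :: "'x mpoly \<Rightarrow> 'x mpoly" where
  "T p = (\<Sum>\<mu>\<in>keys p. scal (lookup p \<mu>) * T0 \<mu>)"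

lemma T_superset:
  "finite A \<Longrightarrow> keys p \<subseteq> A \<Longrightarrow> T p = (\<Sum>\<mu>\<in>A. scal (lookup p \<mu>) * T0 \<mu>)"
  unfolding T_def by (rule sum.mono_neutral_left) (auto simp: in_keys_iff scal_zero)

lemma T_add: "T (p + q) = T p + T q"
proof -
  let ?A = "keys p \<union> keys q"
  show ?thesis
    using T_superset[of ?A "p + q"] T_superset[of ?A p] T_superset[of ?A q]
      Poly_Mapping.keys_add[of p q]
    by (simp add: lookup_add scal_add algebra_simps sum.distrib)
qed

lemma T_zero: "T 0 = 0"
  by (simp add: T_def)

lemma T_sum: "T (sum f A) = (\<Sum>i\<in>A. T (f i))"
  by (induction A rule: infinite_finite_induct) (auto simp: T_zero T_add)

lemma T_minus: "T (p - q) = T p - T q"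
  using T_add[of "p - q" q] by simp

lemma T_single: "T (single \<mu> c) = scal c * T0 \<mu>"
  by (simp add: T_def scal_zero)

lemma T_diff_W:
  assumes p: "p \<in> W (Suc k)"
  shows "T p - p \<in> W k"
proof -
  have "T p - p = (\<Sum>\<mu>\<in>keys p. (T0 \<mu> - single \<mu> 1) *
          single 0 (lookup p \<mu>))"
  proof -
    have "T p - p = T p - (\<Sum>\<mu>\<in>keys p. single \<mu> (lookup p \<mu>))"
      unfolding mpoly_eq_sum_singles[symmetric] by (rule refl)
    thus ?thesis
      by (simp add: T_def sum_subtractf[symmetric] left_diff_distrib mult_single scal_mpoly mult.commute[of "single 0 _"])
  qed
  also have "\<dots> \<in> W k"
  proof (rule W_sum)
    fix \<mu> assume \<mu>: "\<mu> \<in> keys p"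
    hence k: "keys \<mu> \<subseteq> U" "wt \<mu> \<le> k" using p by (auto simp: W_def poly_alg_def)
    have "T0 \<mu> - single \<mu> 1 \<in> W k"
      using T0_lead[OF k(1)] k(2) by (auto simp: lead_def intro: W_mono)
    from W_mult_single[OF this, of 0]
    show "(T0 \<mu> - single \<mu> 1) * single 0 (lookup p \<mu>) \<in> W k"
      by (simp add: wt_def)
  qed
  finally show ?thesis .
qed

lemma T_surj_W: "p \<in> W k \<Longrightarrow> \<exists>w\<in>W k. T w = p"
proof (induction k arbitrary: p)
  case 0
  thus ?case by (auto simp: W_0 T_zero)
next
  case (Suc k)
  \<comment> \<open>By linearity \<open>T (p - w) = T p - (T p - p) = p\<close>.\<close>
  obtain w where w: "w \<in> W k" "T w = T p - p" using Suc.IH[OF T_diff_W[OF Suc.prems]] by blast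
  show ?case
    by (rule bexI[of _ "p - w"]) (use w Suc.prems W_mono[of w k "Suc k"] in \<open>auto simp: T_minus W_minus\<close>)
qed

lemma T_inj_W: "w \<in> W k \<Longrightarrow> T w = 0 \<Longrightarrow> w = 0"
proof (induction k arbitrary: w)
  case 0
  thus ?case by (simp add: W_0)
next
  case (Suc k)
  have "w = - (T w - w)" using Suc.prems by simp
  hence "w \<in> W k" using W_uminus[OF T_diff_W[OF Suc.prems(1)]] by simp
  thus ?case using Suc by blast
qed

lemma P_W: "p \<in> P \<Longrightarrow> \<exists>k. p \<in> W k"
proof -
  assume p: "p \<in> P"
  have "wt \<mu> < Suc (\<Sum>\<mu>\<in>keys p. wt \<mu>)" if "\<mu> \<in> keys p" for \<mu>
    using member_le_sum[OF that, of wt] by (simp add: less_Suc_eq_le)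
  thus ?thesis using p by (auto simp: W_def)
qed

lemma T_surj: "p \<in> P \<Longrightarrow> \<exists>w\<in>P. T w = p"
  using P_W T_surj_W W_P by blast

lemma T_inj: "w \<in> P \<Longrightarrow> T w = 0 \<Longrightarrow> w = 0"
  using P_W T_inj_W by blast

lemma T_lm_mult:
  assumes s: "s \<in> J"
  shows "T (single (lm s) 1 * w) = F s * T w"
proof -
  have "T (single (lm s) 1 * w) =
      T (\<Sum>\<mu>\<in>keys w. single (\<mu> + lm s) (lookup w \<mu>))"
    by (subst mpoly_eq_sum_singles[of w]) (simp add: sum_distrib_left mult_single add.commute)
  also have "\<dots> = (\<Sum>\<mu>\<in>keys w. F s * (scal (lookup w \<mu>) * T0 \<mu>))"
    unfolding T_sum T_single T0_add_lm[OF s] by (simp add: mult_ac)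
  also have "\<dots> = F s * T w"
    by (simp add: T_def sum_distrib_left)
  finally show ?thesis .
qed

section \<open>Standard polynomials as representatives modulo the ideal\<close>

definition std :: "'x mpoly \<Rightarrow> bool" where
  "std p \<longleftrightarrow> p \<in> P \<and> (\<forall>\<mu>\<in>keys p. \<forall>s\<in>J. expo s \<mu> = 0)"

definition idl :: "'x mpoly set" where
  "idl = {\<Sum>s\<in>J. c s * F s | c. \<forall>s\<in>J. c s \<in> P}"

lemma T0_std: "(\<And>s. s \<in> J \<Longrightarrow> expo s \<mu> = 0) \<Longrightarrow> T0 \<mu> = single \<mu> 1"
  by (simp add: T0_def lpart_def)

lemma T_std: "std p \<Longrightarrow> T p = p"
  by (subst (2) mpoly_eq_sum_singles) (auto simp: T_def std_def T0_std scal_mpoly mult_single intro!: sum.cong)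

lemma idl_zero: "0 \<in> idl"
  unfolding idl_def by (rule CollectI, rule exI[of _ "\<lambda>_. 0"]) (auto simp: poly_alg_closed)

lemma idl_add: "p \<in> idl \<Longrightarrow> q \<in> idl \<Longrightarrow> p + q \<in> idl"
proof -
  assume "p \<in> idl" "q \<in> idl"
  then obtain c d where "p = (\<Sum>s\<in>J. c s * F s)" "\<forall>s\<in>J. c s \<in> P" "q = (\<Sum>s\<in>J. d s * F s)" "\<forall>s\<in>J. d s \<in> P"
    by (auto simp: idl_def)
  thus ?thesis
    unfolding idl_def by (intro CollectI exI[of _ "\<lambda>s. c s + d s"]) (auto simp: poly_alg_closed algebra_simps sum.distrib)
qed

lemma idl_mult: "p \<in> P \<Longrightarrow> q \<in> idl \<Longrightarrow> p * q \<in> idl"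
proof -
  assume p: "p \<in> P" and "q \<in> idl"
  then obtain c where "q = (\<Sum>s\<in>J. c s * F s)" "\<forall>s\<in>J. c s \<in> P"
    by (auto simp: idl_def)
  thus ?thesis using p
    unfolding idl_def by (intro CollectI exI[of _ "\<lambda>s. p * c s"]) (auto simp: poly_alg_closed sum_distrib_left mult_ac)
qed

lemma idl_F: "s \<in> J \<Longrightarrow> F s \<in> idl"
  unfolding idl_def using fin
  by (intro CollectI exI[of _ "\<lambda>t. if t = s then 1 else 0"])
     (auto simp: poly_alg_closed if_distrib[of "\<lambda>x. x * _"] cong: if_cong)

lemma std_zero: "std 0"
  by (simp add: std_def poly_alg_closed)

lemma std_add: "std p \<Longrightarrow> std q \<Longrightarrow> std (p + q)"
  using Poly_Mapping.keys_add[of p q] by (auto simp: std_def poly_alg_closed)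

lemma std_uminus: "std p \<Longrightarrow> std (- p)"
  by (auto simp: std_def poly_alg_closed in_keys_iff)

lemma std_minus: "std p \<Longrightarrow> std q \<Longrightarrow> std (p - q)"
  using std_add[OF _ std_uminus, of p q] by simp

text \<open>Together with the uniqueness of normal forms this shows that a variable outside all
  leading monomials is no zero divisor modulo \<open>idl\<close>.\<close>

lemma std_var_mult:
  assumes "x \<in> U" "\<And>s. s \<in> J \<Longrightarrow> x \<noteq> u s" "\<And>s. s \<in> J \<Longrightarrow> x \<noteq> v s" "std p"
  shows "std (poly_var x * p)"
proof -
  have "expo s \<mu> = 0" if \<mu>: "\<mu> \<in> keys (poly_var x * p)" and s: "s \<in> J" for \<mu> s
  proof -
    have "\<exists>a. \<mu> = single x 1 + a \<and> a \<in> keys p"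
      using \<mu> Poly_Mapping.keys_mult[of "poly_var x" p] by (auto simp: poly_var_def)
    thus ?thesis using assms s
      by (auto simp: std_def expo_def lookup_add lookup_single when_def)
  qed
  thus ?thesis using assms by (auto simp: std_def poly_alg_closed)
qed

lemma std_var_power_mult:
  assumes "x \<in> U" "\<And>s. s \<in> J \<Longrightarrow> x \<noteq> u s" "\<And>s. s \<in> J \<Longrightarrow> x \<noteq> v s" "std p"
  shows "std (poly_var x ^ N * p)"
  by (induction N) (use assms in \<open>auto intro: std_var_mult simp: mult.assoc\<close>)

text \<open>The preimage of \<open>p\<close> under \<open>T\<close> is split by monomials: those
  divisible by some \<open>lm s\<close> go to multiples of \<open>F s\<close>, the others are fixed
  by \<open>T\<close>.\<close>

lemma normal_form: assumes "p \<in> P" shows "\<exists>q. std q \<and> p - q \<in> idl"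
proof -
  obtain w where w: "w \<in> P" "T w = p" using T_surj[OF assms] by blast
  have "\<exists>q. std q \<and> T w - q \<in> idl" using w(1)
  proof (induction w rule: poly_induct)
    case zero
    show ?case by (rule exI[of _ 0]) (simp add: T_zero std_zero idl_zero)
  next
    case (add p \<mu> c)
    then obtain q where q: "std q" "T p - q \<in> idl" by blast
    show ?case
    proof (cases "\<exists>s\<in>J. expo s \<mu> \<noteq> 0")
      case True
      then obtain s where s: "s \<in> J" "expo s \<mu> \<noteq> 0" by blast
      have "lookup (lm s) x \<le> lookup \<mu> x" for x
        using s(2) u_v[OF s(1) s(1)]
        by (auto simp: lm_def lookup_add lookup_single when_def expo_def)
      hence e: "(\<mu> - lm s) + lm s = \<mu>"
        by (intro poly_mapping_eqI) (simp add: lookup_add lookup_minus)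
      have "T0 \<mu> = F s * T0 (\<mu> - lm s)" using T0_add_lm[OF s(1), of "\<mu> - lm s"] by (simp add: e)
      moreover have "keys (\<mu> - lm s) \<subseteq> U" using add(2) by (auto simp: in_keys_iff lookup_minus subset_iff)
      ultimately have "scal c * T0 \<mu> \<in> idl"
        using idl_mult[OF poly_alg_mult_closed[OF poly_alg_scal_closed T0_P] idl_F[OF s(1)], of "\<mu> - lm s" c]
        by (simp add: mult_ac)
      moreover have "T (p + single \<mu> c) - q = (T p - q) + scal c * T0 \<mu>"
        by (simp add: T_add T_single)
      ultimately have "T (p + single \<mu> c) - q \<in> idl"
        using idl_add[OF q(2)] by metis
      thus ?thesis using q(1) by blast
    next
      case False
      hence "std (single \<mu> c)" using add(2) by (auto simp: std_def single_closed)
      hence "std (q + single \<mu> c)" "T (p + single \<mu> c) - (q + single \<mu> c) = T p - q"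
        using q by (auto simp: std_add T_add T_std)
      thus ?thesis using q(2) by metis
    qed
  qed
  thus ?thesis using w(2) by simp
qed

text \<open>Pulled back along \<open>T\<close>, an element of \<open>idl\<close> lies in the
  monomial ideal of the \<open>lm s\<close>. A standard \<open>q\<close> is its own preimage, and no
  monomial is both standard and divisible by some \<open>lm s\<close>.\<close>

lemma std_idl_eq_0: assumes q: "std q" and i: "q \<in> idl" shows "q = 0"
proof -
  obtain c where c: "q = (\<Sum>s\<in>J. c s * F s)" "\<forall>s\<in>J. c s \<in> P" using i by (auto simp: idl_def)
  have "\<forall>s\<in>J. \<exists>w. w \<in> P \<and> T w = c s" using T_surj c(2) by blast
  from bchoice[OF this] obtain w where w: "\<And>s. s \<in> J \<Longrightarrow> w s \<in> P" "\<And>s. s \<in> J \<Longrightarrow> T (w s) = c s"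
    by blast
  let ?q = "\<Sum>s\<in>J. single (lm s) 1 * w s"
  have qP: "?q \<in> P" using w(1) uU vU by (intro poly_alg_closed single_closed) (auto simp: keys_lm)
  have "T ?q = (\<Sum>s\<in>J. T (single (lm s) 1 * w s))" by (rule T_sum)
  also have "\<dots> = (\<Sum>s\<in>J. c s * F s)"
    by (intro sum.cong refl) (simp only: T_lm_mult w(2) mult.commute[of "c _"])
  finally have "T ?q = q" by (simp only: c(1))
  hence "T (?q - q) = 0" by (simp only: T_minus T_std[OF q] diff_self)
  moreover have "?q - q \<in> P" by (rule poly_alg_minus_closed[OF qP]) (use q in \<open>simp add: std_def\<close>)
  ultimately have eq: "?q = q" using T_inj[of "?q - q"] by (simp only: right_minus_eq)
  have "\<mu> \<notin> keys q" for \<mu>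
  proof
    assume \<mu>: "\<mu> \<in> keys q"
    have "\<exists>s\<in>J. \<mu> \<in> keys (single (lm s) 1 * w s)"
      using \<mu> Poly_Mapping.keys_sum[of "\<lambda>s. single (lm s) 1 * w s" J] unfolding eq by blast
    then obtain s where s: "s \<in> J" "\<mu> \<in> keys (single (lm s) 1 * w s)" by blast
    then obtain b a where "\<mu> = b + a" "b \<in> keys (single (lm s) (1::complex))"
      using Poly_Mapping.keys_mult[of "single (lm s) 1" "w s"] by blast
    hence s2: "\<mu> = a + lm s" by (simp add: add.commute)
    have "expo s \<mu> \<noteq> 0" unfolding s2 expo_add_lm[OF s(1) s(1)] by simp
    moreover have "expo s \<mu> = 0" using q s(1) \<mu> by (simp add: std_def)
    ultimately show False by simp
  qed
  hence "keys q = {}" by blast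
  thus ?thesis by (simp only: keys_eq_empty)
qed

end

no_notation vec_index (infixl "$" 100)
unbundle fps_syntax

section \<open>Jets of the relations between the invariants\<close>

datatype gvar = GM nat nat | GD nat

definition gvars :: "nat \<Rightarrow> gvar set" where
  "gvars n = {GM j i | j i. j < n - 1 \<and> i < n + 1} \<union> {GD i | i. i < n + 1}"

text \<open>The coefficient of t^k in the \<open>j\<close>-th entry of M(t) d(t).\<close>

definition rel :: "nat \<Rightarrow> nat \<times> nat \<Rightarrow> (gvar \<times> nat) mpoly" where
  "rel n = (\<lambda>(j, k). \<Sum>(i, a)\<in>{..<n + 1} \<times> {..k}. poly_var (GM j i, a) * poly_var (GD i, k - a))"

text \<open>A jet of any order is given by full power series; coefficients beyond the order in
  question are not read by the polynomials evaluated there.\<close>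

definition coeffs_at :: "('z \<Rightarrow> complex fps) \<Rightarrow> 'z \<times> nat \<Rightarrow> complex" where
  "coeffs_at y = (\<lambda>(z, k). y z $ k)"

definition sol :: "nat \<Rightarrow> (gvar \<Rightarrow> complex fps) \<Rightarrow> bool" where
  "sol n y \<longleftrightarrow> (\<forall>j<n - 1. (\<Sum>i<n + 1. y (GM j i) * y (GD i)) = 0)"

lemma peval_sum: "peval v (sum f A) = (\<Sum>i\<in>A. peval v (f i))"
  by (induction A rule: infinite_finite_induct) auto

lemma peval_power [simp]: "peval v (p ^ k) = peval v p ^ k"
  by (induction k) auto

lemma peval_minus [simp]: "peval v (p - q) = peval v p - peval v q"
  using peval_simps(3)[of v "p - q" q] by (simp del: peval_simps)

lemma peval_rel: "peval (coeffs_at y) (rel n (j, k)) = (\<Sum>i<n + 1. y (GM j i) * y (GD i)) $ k"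
proof -
  have "rel n (j, k) = (\<Sum>i<n + 1. \<Sum>a\<le>k. poly_var (GM j i, a) * poly_var (GD i, k - a))"
    unfolding rel_def prod.case by (rule sum.cartesian_product[symmetric])
  thus ?thesis by (simp only: peval_sum coeffs_at_def fps_sum_nth fps_mult_nth atLeast0AtMost peval_simps prod.case)
qed

text \<open>
  The generating series \<open>\<Sum>i. d\<^sub>i(s^(n+1)) s^i\<close> and \<open>\<Sum>i. M\<^sub>j\<^sub>i(s^(n+1)) s^(-i)\<close> turn the monomials
  of \<open>rel n (j, k)\<close> into products of a coefficient of index \<open>D\<close> and one of index \<open>E\<close> with
  \<open>D + E = (n + 1) k\<close>. The convex weight below has its minimum on this line at \<open>D = n k + j + 2\<close>.
\<close>

definition dexp :: "nat \<Rightarrow> nat \<times> nat \<Rightarrow> nat" where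
  "dexp n = (\<lambda>(j, k). n * k + j + 2)"

definition cw :: "nat \<Rightarrow> gvar \<times> nat \<Rightarrow> int" where
  "cw n = (\<lambda>(z, a). case z of
     GD i \<Rightarrow> (int ((n + 1) * a + i))\<^sup>2
   | GM j i \<Rightarrow> int n * (int ((n + 1) * a) - int i)\<^sup>2 + 2 * (int n + 1) * (int j + 2) * (int ((n + 1) * a) - int i))"

definition lead_u :: "nat \<Rightarrow> nat \<times> nat \<Rightarrow> gvar \<times> nat" where
  "lead_u n = (\<lambda>(j, k). (GM j (dexp n (j, k) mod (n + 1)), k - dexp n (j, k) div (n + 1)))"

definition lead_v :: "nat \<Rightarrow> nat \<times> nat \<Rightarrow> gvar \<times> nat" where
  "lead_v n = (\<lambda>(j, k). (GD (dexp n (j, k) mod (n + 1)), dexp n (j, k) div (n + 1)))"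

text \<open>The weight of a monomial of \<open>rel n (j, k)\<close> depends on \<open>i\<close> and
  \<open>a\<close> only through the index \<open>D\<close> of its second factor.\<close>

lemma cw_sum:
  assumes "a \<le> k"
  shows "cw n (GM j i, a) + cw n (GD i, k - a) =
    (let K = int ((n + 1) * k); D = int ((n + 1) * (k - a) + i) in
      D\<^sup>2 + int n * (K - D)\<^sup>2 + 2 * (int n + 1) * (int j + 2) * (K - D))"
proof -
  have E: "int ((n + 1) * a) - int i = int ((n + 1) * k) - int ((n + 1) * (k - a) + i)"
  proof -
    obtain b where "k = a + b" using assms le_Suc_ex by blast
    thus ?thesis by (simp add: algebra_simps)
  qed
  show ?thesis unfolding cw_def prod.case gvar.case E Let_def by simp
qed

text \<open>Completing the square. The ratio of the two quadratic terms places the minimum at nk,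
  and the linear term shifts it by j + 2.\<close>

lemma cw_quadratic:
  fixes n j k D :: int
  shows "(D\<^sup>2 + n * ((n+1)*k - D)\<^sup>2 + 2 * (n + 1) * (j + 2) * ((n+1)*k - D)) -
    ((n*k+j+2)\<^sup>2 + n * ((n+1)*k - (n*k+j+2))\<^sup>2 + 2 * (n + 1) * (j + 2) * ((n+1)*k - (n*k+j+2)))
    = (n + 1) * (D - (n*k+j+2))\<^sup>2"
  by (simp add: power2_eq_square algebra_simps)

section \<open>Leading monomials of the relations up to order m\<close>

locale jets =
  fixes n m :: nat
  assumes n2: "2 \<le> n"
begin

definition Vars :: "(gvar \<times> nat) set" where "Vars = gvars n \<times> {..m}"

definition Rels :: "(nat \<times> nat) set" where "Rels = {..<n - 1} \<times> {..m}"

lemma finite_gvars: "finite (gvars n)"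
proof -
  have "gvars n = (\<lambda>(j, i). GM j i) ` ({..<n - 1} \<times> {..<n + 1}) \<union> GD ` {..<n + 1}"
    by (auto simp: gvars_def)
  thus ?thesis by simp
qed

text \<open>\<open>coprime_leading\<close> asks for natural weights that are largest at the leading
  monomial, whereas \<open>cw\<close> takes integer values and is smallest there. Subtracting from a
  constant is harmless because all monomials of the relations have degree two.\<close>

definition cmax :: int where "cmax = (\<Sum>x\<in>Vars. \<bar>cw n x\<bar>)"

definition \<omega> :: "gvar \<times> nat \<Rightarrow> nat" where "\<omega> x = nat (cmax - cw n x)"

lemma \<omega>_int: "x \<in> Vars \<Longrightarrow> int (\<omega> x) = cmax - cw n x"
proof -
  assume x: "x \<in> Vars"
  have "finite Vars" using finite_gvars by (simp add: Vars_def)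
  hence "\<bar>cw n x\<bar> \<le> cmax" unfolding cmax_def by (intro member_le_sum[OF x]) auto
  thus ?thesis by (simp add: \<omega>_def)
qed

lemma GM_Vars: "j < n - 1 \<Longrightarrow> i < n + 1 \<Longrightarrow> a \<le> m \<Longrightarrow> (GM j i, a) \<in> Vars"
  and GD_Vars: "i < n + 1 \<Longrightarrow> a \<le> m \<Longrightarrow> (GD i, a) \<in> Vars"
  by (auto simp: Vars_def gvars_def)

text \<open>Holds because j + 2 is at most n. It keeps the subtraction in \<open>lead_u\<close> from
  truncating, so that the leading product really occurs in the relation.\<close>

lemma dexp_div_le: "s \<in> Rels \<Longrightarrow> dexp n s div (n + 1) \<le> snd s"
proof -
  assume s: "s \<in> Rels"
  obtain j k where jk: "s = (j, k)" "j < n - 1" using s by (auto simp: Rels_def)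
  have "n * k + j + 2 < (n + 1) * (k + 1)" using jk(2) n2 by (simp add: algebra_simps)
  hence "(n * k + j + 2) div (n + 1) < k + 1" by (simp add: less_mult_imp_div_less mult.commute)
  thus ?thesis by (simp add: jk dexp_def)
qed

lemma dexp_inj: "s \<in> Rels \<Longrightarrow> t \<in> Rels \<Longrightarrow> dexp n s = dexp n t \<Longrightarrow> s = t"
proof -
  assume *: "s \<in> Rels" "t \<in> Rels" "dexp n s = dexp n t"
  obtain j k j' k' where jk: "s = (j, k)" "j < n - 1" "t = (j', k')" "j' < n - 1"
    using * by (auto simp: Rels_def)
  \<comment> \<open>j + 2 may equal n, but j + 1 is below n and can be read off as a
    remainder.\<close>
  have e: "(j + 1) + k * n = (j' + 1) + k' * n" using *(3) jk by (simp add: dexp_def algebra_simps)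
  have "((j + 1) + k * n) mod n = j + 1" "((j' + 1) + k' * n) mod n = j' + 1"
    using jk by (simp_all only: mod_mult_self1) simp_all
  hence "j = j'" unfolding e by simp
  thus ?thesis using e jk n2 by auto
qed

text \<open>\<open>j\<close> is part of the variable, and the index of the M-factor is (n + 1)k -
  (nk + j + 2) = k - j - 2, which determines \<open>k\<close>.\<close>

lemma lead_u_inj: "inj_on (lead_u n) Rels"
proof (rule inj_onI)
  fix s t assume *: "s \<in> Rels" "t \<in> Rels" "lead_u n s = lead_u n t"
  obtain j k j' k' where jk: "s = (j, k)" "t = (j', k')" using * by (auto simp: Rels_def)
  have j: "j' = j" using *(3) by (simp add: jk lead_u_def)
  define D D' where "D = dexp n (j, k)" and "D' = dexp n (j, k')"
  define q q' where "q = D div (n + 1)" and "q' = D' div (n + 1)"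
  have e: "D mod (n + 1) = D' mod (n + 1)" "k - q = k' - q'"
    using *(3) by (auto simp: jk lead_u_def j D_def D'_def q_def q'_def)
  have "q \<le> k" "q' \<le> k'"
    using dexp_div_le[OF *(1)] dexp_div_le[OF *(2)] by (auto simp: jk D_def D'_def j q_def q'_def)
  then obtain a where a: "k = q + a" "k' = q' + a" using e(2) by (metis le_add_diff_inverse)
  have "D = (n + 1) * q + D mod (n + 1)"
    unfolding q_def by (rule mult_div_mod_eq[symmetric])
  moreover have "D' = (n + 1) * q' + D mod (n + 1)"
    unfolding q'_def e(1) by (rule mult_div_mod_eq[symmetric])
  moreover have "D = n * (q + a) + j + 2" "D' = n * (q' + a) + j + 2"
    by (simp_all add: D_def D'_def dexp_def a)
  ultimately have "q + D mod (n + 1) = q' + D mod (n + 1)" by (simp add: algebra_simps)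
  thus "s = t" by (simp add: jk j a)
qed

lemma lead_v_inj: "inj_on (lead_v n) Rels"
proof (rule inj_onI)
  fix s t assume *: "s \<in> Rels" "t \<in> Rels" "lead_v n s = lead_v n t"
  have "dexp n s mod (n + 1) = dexp n t mod (n + 1)" "dexp n s div (n + 1) = dexp n t div (n + 1)"
    using *(3) by (auto simp: lead_v_def case_prod_unfold)
  hence "dexp n s = dexp n t" by (metis mult_div_mod_eq)
  thus "s = t" by (rule dexp_inj[OF *(1,2)])
qed

lemma lead_u_Vars: "s \<in> Rels \<Longrightarrow> lead_u n s \<in> Vars"
  and lead_v_Vars: "s \<in> Rels \<Longrightarrow> lead_v n s \<in> Vars"
  using dexp_div_le[of s]
  by (auto simp: lead_u_def lead_v_def Rels_def case_prod_unfold intro!: GM_Vars GD_Vars)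

lemma rel_closed: "s \<in> Rels \<Longrightarrow> rel n s \<in> carrier (poly_alg Vars)"
  by (auto simp: rel_def Rels_def case_prod_unfold intro!: poly_alg_closed GM_Vars GD_Vars)

lemma weight_less:
  assumes s: "(j, k) \<in> Rels" and i: "i < n + 1" and a: "a \<le> k" and ne: "(GM j i, a) \<noteq> lead_u n (j, k)"
  shows "\<omega> (GM j i, a) + \<omega> (GD i, k - a) < \<omega> (lead_u n (j, k)) + \<omega> (lead_v n (j, k))"
proof -
  have jk: "j < n - 1" "k \<le> m" using s by (auto simp: Rels_def)
  define D where "D = (n + 1) * (k - a) + i"
  define D0 where "D0 = dexp n (j, k)"
  define i0 a0 where "i0 = D0 mod (n + 1)" and "a0 = k - D0 div (n + 1)"
  have le: "D0 div (n + 1) \<le> k" using dexp_div_le[OF s] by (simp add: D0_def)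
  have "k - a0 = D0 div (n + 1)" using le by (simp add: a0_def)
  hence D0: "(n + 1) * (k - a0) + i0 = D0" unfolding i0_def by (simp only: mult_div_mod_eq)
  have a0: "a0 \<le> k" by (simp add: a0_def)
  have lu: "lead_u n (j, k) = (GM j i0, a0)" and lv: "lead_v n (j, k) = (GD i0, k - a0)"
    using le by (simp_all add: lead_u_def lead_v_def i0_def a0_def D0_def)
  \<comment> \<open>\<open>i\<close> and \<open>k - a\<close> are remainder and quotient of
    \<open>D\<close> by n + 1, so equal indices would mean equal monomials.\<close>
  have DD0: "D \<noteq> D0"
  proof
    assume "D = D0"
    hence "D div (n + 1) = D0 div (n + 1)" "D mod (n + 1) = D0 mod (n + 1)" by auto
    moreover have "D div (n + 1) = (k - a) + i div (n + 1)" unfolding D_def by (rule div_mult_self4) simp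
    moreover have "D mod (n + 1) = i mod (n + 1)" unfolding D_def by (rule mod_mult_self4)
    ultimately have "k - a = D0 div (n + 1)" "i = D0 mod (n + 1)" using i by simp_all
    hence "i = i0" "a = a0" using a by (auto simp: i0_def a0_def)
    thus False using ne lu by simp
  qed
  have "cw n (GM j i, a) + cw n (GD i, k - a) - (cw n (GM j i0, a0) + cw n (GD i0, k - a0)) =
      (int n + 1) * (int D - int D0)\<^sup>2"
  proof -
    have K: "int ((n + 1) * k) = (int n + 1) * int k" and D0': "int D0 = int n * int k + int j + 2"
      by (simp_all add: D0_def dexp_def algebra_simps)
    show ?thesis
      unfolding cw_sum[OF a] cw_sum[OF a0] Let_def D0 D_def[symmetric] K D0' by (rule cw_quadratic)
  qed
  moreover have "(int n + 1) * (int D - int D0)\<^sup>2 > 0" using DD0 by simp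
  ultimately have "cw n (GM j i0, a0) + cw n (GD i0, k - a0) < cw n (GM j i, a) + cw n (GD i, k - a)" by linarith
  moreover have "(GM j i, a) \<in> Vars" "(GD i, k - a) \<in> Vars" "(GM j i0, a0) \<in> Vars" "(GD i0, k - a0) \<in> Vars"
    using jk i a a0 by (auto intro!: GM_Vars GD_Vars simp: i0_def)
  ultimately show ?thesis unfolding lu lv using \<omega>_int by (smt (verit) of_nat_add of_nat_less_iff)
qed

lemma rel_tail:
  assumes s: "s \<in> Rels"
    and \<mu>: "\<mu> \<in> keys (rel n s - poly_var (lead_u n s) * poly_var (lead_v n s))"
  shows "(\<Sum>x\<in>keys \<mu>. lookup \<mu> x * \<omega> x) < \<omega> (lead_u n s) + \<omega> (lead_v n s)"
proof -
  obtain j k where jk: "s = (j, k)" by (cases s)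
  let ?A = "{..<n + 1} \<times> {..k}"
  let ?f = "\<lambda>(i, a). poly_var (GM j i, a) * poly_var (GD i, k - a)"
  let ?D = "dexp n (j, k)"
  let ?t = "(?D mod (n + 1), k - ?D div (n + 1))"
  have le: "?D div (n + 1) \<le> k" using dexp_div_le[OF s] by (simp add: jk)
  have t: "?t \<in> ?A" by auto
  have ft: "?f ?t = poly_var (lead_u n s) * poly_var (lead_v n s)"
    using le by (simp add: lead_u_def lead_v_def jk)
  have "rel n s = sum ?f ?A" by (simp only: jk rel_def prod.case)
  also have "\<dots> = ?f ?t + sum ?f (?A - {?t})" by (rule sum.remove[OF _ t]) auto
  finally have "rel n s = ?f ?t + sum ?f (?A - {?t})" .
  hence "rel n s - poly_var (lead_u n s) * poly_var (lead_v n s) = sum ?f (?A - {?t})"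
    unfolding ft by simp
  with \<mu> have "\<mu> \<in> (\<Union>x\<in>?A - {?t}. keys (?f x))"
    using Poly_Mapping.keys_sum[of ?f "?A - {?t}"] by auto
  then obtain i a where ia: "(i, a) \<in> ?A" "(i, a) \<noteq> ?t" "\<mu> \<in> keys (?f (i, a))" by blast
  hence \<mu>: "\<mu> = single (GM j i, a) 1 + single (GD i, k - a) 1"
    by (simp add: poly_var_def mult_single)
  have "keys \<mu> = {(GM j i, a), (GD i, k - a)}"
    by (auto simp: \<mu> in_keys_iff lookup_add lookup_single when_def split: if_splits)
  hence "(\<Sum>x\<in>keys \<mu>. lookup \<mu> x * \<omega> x) = \<omega> (GM j i, a) + \<omega> (GD i, k - a)"
    by (simp add: \<mu> lookup_add lookup_single)
  also have "\<dots> < \<omega> (lead_u n s) + \<omega> (lead_v n s)"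
    unfolding jk by (rule weight_less) (use s ia in \<open>auto simp: jk lead_u_def\<close>)
  finally show ?thesis .
qed

sublocale coprime_leading Vars Rels "lead_u n" "lead_v n" "rel n" \<omega>
  by unfold_locales
     (use lead_u_Vars lead_v_Vars lead_u_inj lead_v_inj rel_closed rel_tail in
       \<open>auto simp: Rels_def lead_u_def lead_v_def case_prod_unfold\<close>)

lemma D01_Vars: "i < 2 \<Longrightarrow> (GD i, 0) \<in> Vars"
  using n2 by (auto intro!: GD_Vars)

text \<open>Every \<open>dexp\<close> is at least 2, while these variables have the indices 0 and 1;
  this is the purpose of the summand 2 in \<open>dexp\<close>.\<close>

lemma D01_not_lead: "i < 2 \<Longrightarrow> s \<in> Rels \<Longrightarrow> (GD i, 0) \<noteq> lead_u n s"
   "i < 2 \<Longrightarrow> s \<in> Rels \<Longrightarrow> (GD i, 0) \<noteq> lead_v n s"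
proof -
  show "(GD i, 0) \<noteq> lead_u n s" by (simp add: lead_u_def case_prod_unfold)
  assume i: "i < 2" and "s \<in> Rels"
  show "(GD i, 0) \<noteq> lead_v n s"
  proof
    assume "(GD i, 0) = lead_v n s"
    hence "dexp n s mod (n + 1) = i" "dexp n s div (n + 1) = 0"
      by (auto simp: lead_v_def case_prod_unfold)
    hence "dexp n s = i" by (metis add_0 mult_0_right mult_div_mod_eq)
    thus False using i by (simp add: dexp_def case_prod_unfold)
  qed
qed

lemma std_D01: "i < 2 \<Longrightarrow> std q \<Longrightarrow> std (poly_var (GD i, 0) ^ N * q)"
  by (rule std_var_power_mult) (use D01_Vars D01_not_lead in auto)

section \<open>Solutions of the relations where d_0(0) is invertible\<close>

lemma idl_sol: "p \<in> idl \<Longrightarrow> sol n y \<Longrightarrow> peval (coeffs_at y) p = 0"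
proof -
  assume p: "p \<in> idl" and y: "sol n y"
  have "peval (coeffs_at y) (rel n s) = 0" if "s \<in> Rels" for s
  proof -
    obtain j k where "s = (j, k)" "j < n - 1" using \<open>s \<in> Rels\<close> by (auto simp: Rels_def)
    thus ?thesis using y by (simp only: peval_rel sol_def) (simp only: fps_zero_nth)
  qed
  moreover obtain c where "p = (\<Sum>s\<in>Rels. c s * rel n s)" using p by (auto simp: idl_def)
  ultimately show ?thesis by (simp add: peval_sum del: split_paired_All)
qed

text \<open>The variables that survive elimination. By \<open>sol_exists\<close> they take arbitrary
  values on the solutions, as long as d_0(0) is nonzero.\<close>

definition reduced :: "(gvar \<times> nat) mpoly set" where
  "reduced = carrier (poly_alg {(z, k) \<in> Vars. \<forall>j. z \<noteq> GM j 0})"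

abbreviation "d0 \<equiv> poly_var (GD 0, 0 :: nat) :: (gvar \<times> nat) mpoly"

text \<open>Where \<open>GD 0\<close> is invertible, the relations determine the jets of \<open>GM j 0\<close>.\<close>

definition elim :: "(gvar \<times> nat) mpoly \<Rightarrow> bool" where
  "elim p \<longleftrightarrow> p \<in> P \<and> (\<exists>N. \<exists>q\<in>reduced. d0 ^ N * p - q \<in> idl)"

lemma reduced_P: "p \<in> reduced \<Longrightarrow> p \<in> P"
  unfolding reduced_def by (erule poly_alg_mono) auto

lemma d0_reduced: "d0 \<in> reduced" and d0_P: "d0 \<in> P"
  unfolding reduced_def using D01_Vars[of 0] by (auto intro!: poly_alg_closed)

lemma reduced_elim: "p \<in> reduced \<Longrightarrow> elim p"
  unfolding elim_def using idl_zero reduced_P by (auto intro!: exI[of _ 0] bexI[of _ p])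

lemma reduced_closed:
  "p \<in> reduced \<Longrightarrow> q \<in> reduced \<Longrightarrow> p + q \<in> reduced"
  "p \<in> reduced \<Longrightarrow> q \<in> reduced \<Longrightarrow> p * q \<in> reduced"
  "p \<in> reduced \<Longrightarrow> p ^ N \<in> reduced"
  "scal c \<in> reduced" "0 \<in> reduced" "- 1 \<in> reduced"
  unfolding reduced_def by (auto intro: poly_alg_closed)

lemma elim_add:
  assumes "elim p" "elim q" shows "elim (p + q)"
proof -
  obtain M p' N q' where *: "p' \<in> reduced" "d0 ^ M * p - p' \<in> idl" "q' \<in> reduced" "d0 ^ N * q - q' \<in> idl"
    using assms by (auto simp: elim_def)
  have "d0 ^ N * (d0 ^ M * p - p') + d0 ^ M * (d0 ^ N * q - q') \<in> idl"
    by (intro idl_add idl_mult poly_alg_power_closed d0_P *)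
  hence "d0 ^ (M + N) * (p + q) - (d0 ^ N * p' + d0 ^ M * q') \<in> idl"
    by (simp add: algebra_simps power_add)
  moreover have "d0 ^ N * p' + d0 ^ M * q' \<in> reduced"
    by (intro reduced_closed d0_reduced *)
  ultimately show ?thesis using assms poly_alg_add_closed unfolding elim_def by blast
qed

lemma elim_mult:
  assumes "elim p" "elim q" shows "elim (p * q)"
proof -
  obtain M p' N q' where *: "p' \<in> reduced" "d0 ^ M * p - p' \<in> idl" "q' \<in> reduced" "d0 ^ N * q - q' \<in> idl"
    using assms by (auto simp: elim_def)
  have "(d0 ^ N * q) * (d0 ^ M * p - p') + p' * (d0 ^ N * q - q') \<in> idl"
  proof -
    have "q \<in> P" "p' \<in> P" using assms * by (auto simp: elim_def reduced_P)
    thus ?thesis by (intro idl_add idl_mult poly_alg_mult_closed poly_alg_power_closed d0_P *)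
  qed
  hence "d0 ^ (M + N) * (p * q) - p' * q' \<in> idl"
    by (simp add: algebra_simps power_add)
  moreover have "p' * q' \<in> reduced"
    by (intro reduced_closed *)
  ultimately show ?thesis using assms poly_alg_mult_closed unfolding elim_def by blast
qed

lemma elim_sum: "(\<And>i. i \<in> A \<Longrightarrow> elim (f i)) \<Longrightarrow> elim (sum f A)"
  by (induction A rule: infinite_finite_induct)
     (auto intro: elim_add reduced_elim reduced_closed)

lemma elim_cancel:
  assumes "elim q" "p \<in> P" "d0 * p - q \<in> idl" shows "elim p"
proof -
  obtain N q' where *: "q' \<in> reduced" "d0 ^ N * q - q' \<in> idl" using assms by (auto simp: elim_def)
  have "d0 ^ N * (d0 * p - q) + (d0 ^ N * q - q') \<in> idl"
    by (intro idl_add idl_mult poly_alg_power_closed d0_P * assms)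
  hence "d0 ^ Suc N * p - q' \<in> idl" by (simp add: algebra_simps)
  thus ?thesis using assms(2) *(1) unfolding elim_def by blast
qed

lemma var_reduced: "(z, k) \<in> Vars \<Longrightarrow> (\<And>j. z \<noteq> GM j 0) \<Longrightarrow> elim (poly_var (z, k))"
  by (rule reduced_elim) (auto simp: reduced_def intro!: poly_var_closed)

text \<open>In the coefficient of t^k the variable \<open>(GM j 0, k)\<close> occurs only in the
  product with \<open>d0\<close>; every other factor survives elimination or has lower
  order.\<close>

lemma elim_var: "(z, k) \<in> Vars \<Longrightarrow> elim (poly_var (z, k))"
proof (induction k arbitrary: z rule: less_induct)
  case (less k)
  show ?case
  proof (cases "\<exists>j. z = GM j 0")
    case False
    thus ?thesis using less.prems by (intro var_reduced) auto
  next
    case True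
    then obtain j where z: "z = GM j 0" by blast
    have jk: "j < n - 1" "k \<le> m" using less.prems by (auto simp: z Vars_def gvars_def)
    hence s: "(j, k) \<in> Rels" by (auto simp: Rels_def)
    let ?A = "{..<n + 1} \<times> {..k}"
    let ?f = "\<lambda>(i, a). poly_var (GM j i, a) * poly_var (GD i, k - a)"
    define S where "S = sum ?f (?A - {(0, k)})"
    have "rel n (j, k) = sum ?f ?A" by (simp only: rel_def prod.case)
    also have "\<dots> = ?f (0, k) + S" unfolding S_def by (rule sum.remove) auto
    finally have r: "rel n (j, k) = poly_var (z, k) * d0 + S" by (simp add: z)
    have "elim (?f (i, a))" if ia: "(i, a) \<in> ?A - {(0, k)}" for i a
    proof -
      have "elim (poly_var (GM j i, a))"
      proof (cases "i = 0")
        case True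
        hence "a < k" using ia by auto
        thus ?thesis using ia jk by (intro less.IH GM_Vars) auto
      qed (use ia jk in \<open>auto intro!: var_reduced GM_Vars\<close>)
      moreover have "elim (poly_var (GD i, k - a))" using ia jk by (intro var_reduced GD_Vars) auto
      ultimately show ?thesis by (simp add: elim_mult)
    qed
    hence "elim (?f x)" if "x \<in> ?A - {(0, k)}" for x using that by (cases x) blast
    hence "elim S" unfolding S_def by (rule elim_sum)
    hence "elim (- 1 * S)" by (rule elim_mult[OF reduced_elim[OF reduced_closed(6)]])
    moreover have "poly_var (z, k) \<in> P" using less.prems by (rule poly_var_closed)
    moreover have "d0 * poly_var (z, k) - - 1 * S = rel n (j, k)" unfolding r by (simp add: mult.commute)
    hence "d0 * poly_var (z, k) - - 1 * S \<in> idl" using idl_F[OF s] by simp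
    ultimately show ?thesis by (rule elim_cancel)
  qed
qed

lemma P_elim: "p \<in> P \<Longrightarrow> elim p"
proof (induction p rule: poly_alg_induct)
  case (scal c)
  show ?case by (intro reduced_elim reduced_closed)
qed (auto intro: elim_var elim_add elim_mult)

lemma sol_exists:
  fixes a :: "gvar \<times> nat \<Rightarrow> complex"
  assumes "a (GD 0, 0) \<noteq> 0"
  shows "\<exists>y. sol n y \<and> y (GD 0) $ 0 \<noteq> 0 \<and> (\<forall>z k. (\<forall>j. z \<noteq> GM j 0) \<longrightarrow> y z $ k = a (z, k))"
proof -
  define b where "b z = Abs_fps (\<lambda>k. a (z, k))" for z
  define y where "y z = (case z of GM j i \<Rightarrow> if i = 0 then
     - (\<Sum>i\<in>{..<n + 1} - {0}. b (GM j i) * b (GD i)) * inverse (b (GD 0)) else b z | GD i \<Rightarrow> b z)" for z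
  have b0: "b (GD 0) $ 0 \<noteq> 0" using assms by (simp add: b_def)
  have "(\<Sum>i<n + 1. y (GM j i) * y (GD i)) = 0" for j
  proof -
    have "(\<Sum>i<n + 1. y (GM j i) * y (GD i)) =
       y (GM j 0) * y (GD 0) + (\<Sum>i\<in>{..<n + 1} - {0}. y (GM j i) * y (GD i))"
      by (rule sum.remove) auto
    also have "(\<Sum>i\<in>{..<n + 1} - {0}. y (GM j i) * y (GD i)) = (\<Sum>i\<in>{..<n + 1} - {0}. b (GM j i) * b (GD i))"
      by (rule sum.cong) (auto simp: y_def)
    also have "y (GM j 0) * y (GD 0) =
        - (\<Sum>i\<in>{..<n + 1} - {0}. b (GM j i) * b (GD i)) * (inverse (b (GD 0)) * b (GD 0))"
      by (simp add: y_def)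
    also have "inverse (b (GD 0)) * b (GD 0) = 1" by (rule inverse_mult_eq_1[OF b0])
    finally show ?thesis by simp
  qed
  moreover have "y z $ k = a (z, k)" if "\<forall>j. z \<noteq> GM j 0" for z k
    using that by (auto simp: y_def b_def split: gvar.split)
  moreover have "y (GD 0) $ 0 \<noteq> 0" using b0 by (simp add: y_def)
  ultimately show ?thesis unfolding sol_def by blast
qed

lemma mult_eq_0_mpoly: "p * q = 0 \<Longrightarrow> p \<noteq> 0 \<Longrightarrow> q = (0 :: 'x mpoly)"
  by (rule peval_mult_eq_0[of p]) (simp_all flip: peval_simps(4))

lemma poly_var_neq_0: "poly_var x ^ N \<noteq> (0 :: 'x mpoly)"
proof
  assume "poly_var x ^ N = (0 :: 'x mpoly)"
  hence "peval (\<lambda>_. 1 :: complex) (poly_var x ^ N) = 0" by (simp only: peval_simps(1))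
  thus False by simp
qed

text \<open>Elimination turns a vanishing polynomial into one in free variables, hence into 0. So a
  power of \<open>d0\<close> times the normal form lies in \<open>idl\<close>; this product is still
  standard, hence 0, and \<open>d0\<close> cancels.\<close>

lemma vanishing_in_idl:
  assumes p: "p \<in> P" and van: "\<And>y. sol n y \<Longrightarrow> y (GD 0) $ 0 \<noteq> 0 \<Longrightarrow> peval (coeffs_at y) p = 0"
  shows "p \<in> idl"
proof -
  from normal_form[OF p] obtain q where q: "std q" "p - q \<in> idl" by (elim exE conjE)
  have qP: "q \<in> P" using q(1) unfolding std_def by (rule conjunct1)
  obtain N q' where q': "q' \<in> reduced" "d0 ^ N * q - q' \<in> idl"
    using P_elim[OF qP] unfolding elim_def by (elim exE conjE bexE)
  \<comment> \<open>The factor \<open>d0\<close> takes care of the points \<open>a\<close> with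
    d_0(0) = 0, to which \<open>sol_exists\<close> does not apply.\<close>
  have "peval a d0 * peval a q' = 0" for a :: "gvar \<times> nat \<Rightarrow> complex"
  proof (cases "a (GD 0, 0) = 0")
    case False
    from sol_exists[of a, OF this] obtain y where
      y: "sol n y" "y (GD 0) $ 0 \<noteq> 0" "\<forall>z k. (\<forall>j. z \<noteq> GM j 0) \<longrightarrow> y z $ k = a (z, k)"
      by (elim exE conjE)
    have "peval a q' = peval (coeffs_at y) q'"
    proof (rule peval_cong[OF q'(1)[unfolded reduced_def]])
      fix x assume x: "x \<in> {(z, k). (z, k) \<in> Vars \<and> (\<forall>j. z \<noteq> GM j 0)}"
      obtain z k where zk: "x = (z, k)" by (cases x)
      have "\<forall>j. z \<noteq> GM j 0" using x by (simp add: zk)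
      thus "a x = coeffs_at y x" using y(3) by (simp add: zk coeffs_at_def)
    qed
    also have "\<dots> = 0"
    proof -
      have "peval (coeffs_at y) q = 0" using idl_sol[OF q(2) y(1)] van[OF y(1,2)] by simp
      thus ?thesis using idl_sol[OF q'(2) y(1)] by simp
    qed
    finally show ?thesis by simp
  qed simp
  moreover have "d0 \<noteq> 0" using poly_var_neq_0[of "(GD 0, 0 :: nat)" 1] by (simp only: power_one_right not_False_eq_True)
  ultimately have "q' = 0" by (rule peval_mult_eq_0)
  hence "d0 ^ N * q \<in> idl" using q'(2) by (simp only: diff_zero)
  moreover have "std (d0 ^ N * q)" by (rule std_D01[OF _ q(1)]) simp
  ultimately have "d0 ^ N * q = 0" by (intro std_idl_eq_0)
  hence "q = 0" using poly_var_neq_0 by (rule mult_eq_0_mpoly)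
  thus ?thesis using q(2) by simp
qed

text \<open>The monomials of \<open>p\<close> in which \<open>y\<close> has too small an exponent
  keep that exponent under multiplication by a power of \<open>x\<close>, so their part of
  \<open>p\<close> vanishes.\<close>

lemma var_power_dvd:
  fixes p q :: "'x mpoly"
  assumes eq: "poly_var x ^ M * p = poly_var y ^ N * q" and xy: "x \<noteq> y" and p: "p \<in> carrier (poly_alg S)"
  shows "\<exists>r\<in>carrier (poly_alg S). p = poly_var y ^ N * r"
proof -
  let ?l = "lookup"
  have vp: "poly_var z ^ K = single (single z K) (1::complex)" for z :: 'x and K
    by (induction K) (auto simp: poly_var_def mult_single single_add[symmetric])
  define A where "A = {\<mu> \<in> keys p. ?l \<mu> y \<ge> N}"
  define r where "r = (\<Sum>\<mu>\<in>A. single (\<mu> - single y N) (?l p \<mu>))"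
  define s where "s = (\<Sum>\<mu>\<in>keys p - A. single \<mu> (?l p \<mu>))"
  have "p = (\<Sum>\<mu>\<in>keys p. single \<mu> (?l p \<mu>))"
    by (rule mpoly_eq_sum_singles)
  also have "\<dots> = (\<Sum>\<mu>\<in>A. single \<mu> (?l p \<mu>)) + s"
    unfolding s_def by (subst sum.subset_diff[of A]) (auto simp: A_def add.commute)
  also have "(\<Sum>\<mu>\<in>A. single \<mu> (?l p \<mu>)) = poly_var y ^ N * r"
  proof -
    have "single y N + (\<mu> - single y N) = \<mu>" if "\<mu> \<in> A" for \<mu>
      using that by (intro poly_mapping_eqI) (auto simp: lookup_add lookup_minus lookup_single when_def A_def)
    thus ?thesis by (simp add: r_def vp sum_distrib_left mult_single)
  qed
  finally have ps: "p = poly_var y ^ N * r + s" .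
  have rS: "r \<in> carrier (poly_alg S)" unfolding r_def
    by (intro poly_alg_sum_closed single_closed)
       (use p in \<open>auto simp: A_def in_keys_iff lookup_minus poly_alg_def subset_iff\<close>)
  have e: "poly_var x ^ M * s = poly_var y ^ N * (q - poly_var x ^ M * r)"
    using eq unfolding ps by (simp add: algebra_simps)
  have "\<kappa> \<notin> keys (poly_var x ^ M * s)" for \<kappa>
  proof
    assume \<kappa>: "\<kappa> \<in> keys (poly_var x ^ M * s)"
    have "\<exists>\<mu>. \<kappa> = single x M + \<mu> \<and> \<mu> \<in> keys s"
      using \<kappa> Poly_Mapping.keys_mult[of "poly_var x ^ M" s] by (auto simp: vp)
    then obtain \<mu> where \<mu>: "\<kappa> = single x M + \<mu>" "\<mu> \<in> keys s" by blast
    have "\<mu> \<in> keys p - A"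
      using \<mu>(2) Poly_Mapping.keys_sum[of "\<lambda>\<mu>. single \<mu> (?l p \<mu>)" "keys p - A"]
      by (auto simp: s_def split: if_splits)
    hence "?l \<kappa> y < N" using xy by (auto simp: \<mu>(1) lookup_add lookup_single A_def)
    moreover have "\<exists>\<nu>. \<kappa> = single y N + \<nu>"
      using \<kappa> Poly_Mapping.keys_mult[of "poly_var y ^ N" "q - poly_var x ^ M * r"] unfolding e by (auto simp: vp)
    ultimately show False by (auto simp: lookup_add)
  qed
  hence "keys (poly_var x ^ M * s) = {}" by blast
  hence "poly_var x ^ M * s = 0" by (simp only: keys_eq_empty)
  hence "s = 0" using poly_var_neq_0 by (rule mult_eq_0_mpoly)
  thus ?thesis using ps rS by auto
qed

text \<open>Between normal forms the congruence becomes an equality of polynomials, because neither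
  of the two variables occurs in a leading monomial. The hypothesis speaks of solutions with d_0(0)
  nonzero, the conclusion of all of them.\<close>

lemma regular_sequence:
  assumes p: "p \<in> P" "q \<in> P"
    and eq: "\<And>y. sol n y \<Longrightarrow> y (GD 0) $ 0 \<noteq> 0 \<Longrightarrow>
      (y (GD 1) $ 0) ^ M * peval (coeffs_at y) p = (y (GD 0) $ 0) ^ N * peval (coeffs_at y) q"
  shows "\<exists>r\<in>P. \<forall>y. sol n y \<longrightarrow> peval (coeffs_at y) p = (y (GD 0) $ 0) ^ N * peval (coeffs_at y) r"
proof -
  let ?d1 = "poly_var (GD 1, 0 :: nat)"
  obtain p' q' where p': "std p'" "p - p' \<in> idl" and q': "std q'" "q - q' \<in> idl"
    using normal_form p by metis
  have p'P: "p' \<in> P" and "q' \<in> P" using p' q' by (auto simp: std_def)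
  have d1: "?d1 \<in> P" using D01_Vars[of 1] by (simp add: poly_var_closed)
  have p'e: "peval (coeffs_at y) p = peval (coeffs_at y) p'" if "sol n y" for y
    using idl_sol[OF p'(2) that] by simp
  have q'e: "peval (coeffs_at y) q = peval (coeffs_at y) q'" if "sol n y" for y
    using idl_sol[OF q'(2) that] by simp
  have "?d1 ^ M * p' - d0 ^ N * q' \<in> idl"
  proof (rule vanishing_in_idl)
    show "?d1 ^ M * p' - d0 ^ N * q' \<in> P" 
      by (intro poly_alg_minus_closed poly_alg_mult_closed poly_alg_power_closed d1 d0_P p'P \<open>q' \<in> P\<close>)
    fix y assume y: "sol n y" "y (GD 0) $ 0 \<noteq> 0"
    show "peval (coeffs_at y) (?d1 ^ M * p' - d0 ^ N * q') = 0"
      using eq[OF y] by (simp add: p'e[OF y(1)] q'e[OF y(1)]) (simp add: coeffs_at_def)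
  qed
  moreover have "std (?d1 ^ M * p' - d0 ^ N * q')"
    by (intro std_minus std_D01 p' q') auto
  ultimately have "?d1 ^ M * p' - d0 ^ N * q' = 0" by (intro std_idl_eq_0)
  hence "?d1 ^ M * p' = d0 ^ N * q'" by (simp only: right_minus_eq)
  from var_power_dvd[OF this _ p'P] obtain r where "r \<in> P" "p' = d0 ^ N * r" by auto
  thus ?thesis using p'e by (intro bexI[of _ r]) (auto simp: coeffs_at_def)
qed

end

section \<open>The generators of the invariants\<close>

text \<open>The increasing enumeration of the numbers other than \<open>c\<close>.\<close>

definition ins :: "nat \<Rightarrow> nat \<Rightarrow> nat" where
  "ins c s = (if s < c then s else Suc s)"

definition minor_mat :: "nat \<Rightarrow> (coord \<Rightarrow> 'a::comm_ring_1) \<Rightarrow> nat \<Rightarrow> 'a mat" where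
  "minor_mat n v c = mat n n (\<lambda>(r, s). v (Vec (ins c s) r))"

text \<open>
  With the sign, \<open>GD i\<close> is the \<open>i\<close>-th cofactor of the matrix with the columns \<open>x\<^sub>0, \<dots>, x\<^sub>n\<close> and one extra
  row, so that expansion along that row gives \<open>gen_relation\<close>.
\<close>

definition gen :: "nat \<Rightarrow> (coord \<Rightarrow> 'a::comm_ring_1) \<Rightarrow> gvar \<Rightarrow> 'a" where
  "gen n v z = (case z of
     GM j i \<Rightarrow> \<Sum>l<n. v (Covec j l) * v (Vec i l)
   | GD i \<Rightarrow> (- 1) ^ i * det (minor_mat n v i))"

text \<open>\<open>H\<close> stands for the inverse of \<open>G\<close>.\<close>

definition act :: "nat \<Rightarrow> 'a::comm_ring_1 mat \<Rightarrow> 'a mat \<Rightarrow> (coord \<Rightarrow> 'a) \<Rightarrow> coord \<Rightarrow> 'a" where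
  "act n G H v z = (case z of
     Vec i j \<Rightarrow> \<Sum>l<n. G $$ (j, l) * v (Vec i l)
   | Covec i j \<Rightarrow> \<Sum>l<n. v (Covec i l) * H $$ (l, j))"

lemma minor_mat_carrier: "minor_mat n v c \<in> carrier_mat n n"
  by (simp add: minor_mat_def)

text \<open>Naturality in the ring lets one formula serve numbers, power series and polynomials
  alike.\<close>

lemma gen_hom:
  assumes "comm_ring_hom h"
  shows "h (gen n v z) = gen n (\<lambda>x. h (v x)) z"
proof -
  interpret comm_ring_hom h by fact
  have "map_mat h (minor_mat n v i) = minor_mat n (\<lambda>x. h (v x)) i" for i
    by (rule eq_matI) (auto simp: minor_mat_def)
  thus ?thesis by (cases z) (auto simp: gen_def hom_distribs simp flip: hom_det)
qed

lemma sum_ins: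
  fixes f :: "nat \<Rightarrow> 'a::comm_monoid_add"
  assumes "c < n + 1"
  shows "(\<Sum>i<n + 1. f i) = f c + (\<Sum>s<n. f (ins c s))"
proof -
  have "ins c ` {..<n} = {..<n + 1} - {c}"
  proof (intro equalityI subsetI)
    fix i assume i: "i \<in> {..<n + 1} - {c}"
    show "i \<in> ins c ` {..<n}"
    proof (cases "i < c")
      case True
      thus ?thesis using assms by (intro image_eqI[of _ _ i]) (auto simp: ins_def)
    next
      case False
      thus ?thesis using i by (intro image_eqI[of _ _ "i - 1"]) (auto simp: ins_def)
    qed
  qed (use assms in \<open>auto simp: ins_def split: if_splits\<close>)
  moreover have "inj_on (ins c) {..<n}" by (auto simp: inj_on_def ins_def split: if_splits)
  ultimately have "(\<Sum>i\<in>{..<n + 1} - {c}. f i) = (\<Sum>s<n. f (ins c s))"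
    by (metis sum.reindex comp_apply sum.cong)
  thus ?thesis using sum.remove[of "{..<n + 1}" c f] assms by simp
qed

lemma gen_relation:
  assumes l: "l < n"
  shows "(\<Sum>i<n + 1. gen n v (GD i) * v (Vec i l)) = 0"
proof -
  \<comment> \<open>Row 0 repeats the row of the \<open>l\<close>-th coordinates, so the determinant
    vanishes.\<close>
  define B where "B = mat (Suc n) (Suc n) (\<lambda>(r, c). v (Vec c (if r = 0 then l else r - 1)))"
  have B: "B \<in> carrier_mat (Suc n) (Suc n)" by (simp add: B_def)
  have "det B = 0"
  proof (rule det_identical_rows[OF B, of 0 "Suc l"])
    show "row B 0 = row B (Suc l)" using l by (intro eq_vecI) (auto simp: B_def)
  qed (use l in auto)
  moreover have "det B = (\<Sum>c<Suc n. B $$ (0, c) * cofactor B 0 c)"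
    by (rule laplace_expansion_row[OF B]) simp
  moreover have "B $$ (0, c) * cofactor B 0 c = gen n v (GD c) * v (Vec c l)" if "c < Suc n" for c
  proof -
    have "mat_delete B 0 c = minor_mat n v c"
      by (rule eq_matI) (auto simp: mat_delete_def B_def minor_mat_def ins_def)
    thus ?thesis using that by (simp add: cofactor_def gen_def B_def mult.commute)
  qed
  ultimately show ?thesis by (simp del: sum.lessThan_Suc)
qed

lemma gen_relation_GM: "(\<Sum>i<n + 1. gen n v (GM j i) * gen n v (GD i)) = 0"
proof -
  have "(\<Sum>i<n + 1. gen n v (GM j i) * gen n v (GD i)) =
      (\<Sum>i<n + 1. \<Sum>l<n. v (Covec j l) * (gen n v (GD i) * v (Vec i l)))"
    by (intro sum.cong refl) (simp only: gen_def[of n v "GM _ _"] gvar.case sum_distrib_left sum_distrib_right mult_ac)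
  also have "\<dots> = (\<Sum>l<n. v (Covec j l) * (\<Sum>i<n + 1. gen n v (GD i) * v (Vec i l)))"
    by (subst sum.swap) (simp only: sum_distrib_left)
  also have "\<dots> = 0" 
  proof (intro sum.neutral ballI)
    fix l assume "l \<in> {..<n}"
    hence "(\<Sum>i<n + 1. gen n v (GD i) * v (Vec i l)) = 0" by (intro gen_relation) simp
    thus "v (Covec j l) * (\<Sum>i<n + 1. gen n v (GD i) * v (Vec i l)) = 0" by (simp only: mult_zero_right)
  qed
  finally show ?thesis .
qed

lemma sol_gen: "sol n (gen n v)"
  unfolding sol_def using gen_relation_GM by blast

lemma minor_mat_act:
  assumes "G \<in> carrier_mat n n"
  shows "minor_mat n (act n G H v) c = G * minor_mat n v c"
  by (rule eq_matI)
     (use assms in \<open>auto simp: minor_mat_def act_def scalar_prod_def atLeast0LessThan intro!: sum.cong\<close>)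

lemma gen_act:
  assumes G: "G \<in> carrier_mat n n" and H: "H \<in> carrier_mat n n" and HG: "H * G = 1\<^sub>m n" and det: "det G = 1"
  shows "gen n (act n G H v) z = gen n v z"
proof (cases z)
  case (GD i)
  have "det (G * minor_mat n v i) = det (minor_mat n v i)"
    using det_mult[OF G minor_mat_carrier] det by simp
  thus ?thesis by (simp add: GD gen_def minor_mat_act[OF G])
next
  case (GM j i)
  have hg: "(\<Sum>l<n. H $$ (a, l) * G $$ (l, b)) = (if a = b then 1 else 0)" if "a < n" "b < n" for a b
  proof -
    have "(\<Sum>l<n. H $$ (a, l) * G $$ (l, b)) = (H * G) $$ (a, b)"
      using that G H by (auto simp: scalar_prod_def atLeast0LessThan intro!: sum.cong)
    thus ?thesis using that by (simp add: HG)
  qed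
  have "gen n (act n G H v) z =
      (\<Sum>l<n. \<Sum>a<n. \<Sum>b<n. v (Covec j a) * v (Vec i b) * (H $$ (a, l) * G $$ (l, b)))"
    by (simp add: GM gen_def act_def sum_product mult_ac)
  also have "\<dots> = (\<Sum>a<n. \<Sum>b<n. \<Sum>l<n. v (Covec j a) * v (Vec i b) * (H $$ (a, l) * G $$ (l, b)))"
    by (subst sum.swap) (rule sum.cong[OF refl], rule sum.swap)
  also have "\<dots> = (\<Sum>a<n. \<Sum>b<n. v (Covec j a) * v (Vec i b) * (if a = b then 1 else 0))"
    by (intro sum.cong refl) (simp add: hg flip: sum_distrib_left)
  also have "\<dots> = (\<Sum>a<n. \<Sum>b<n. if b = a then v (Covec j a) * v (Vec i a) else 0)"
    by (intro sum.cong refl) auto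
  also have "\<dots> = gen n v z" by (simp add: GM gen_def)
  finally show ?thesis .
qed

section \<open>A slice for the action where a minor is invertible\<close>

text \<open>SL_n preserves the determinant of the chosen minor, so in general the minor cannot be
  moved to the identity. The determinant is stored in the first diagonal entry; the sign undoes the
  one in \<open>gen\<close>.\<close>

definition dfac :: "nat \<Rightarrow> (gvar \<Rightarrow> complex fps) \<Rightarrow> nat \<Rightarrow> complex fps" where
  "dfac c y l = (if l = 0 then (- 1) ^ c * y (GD c) else 1)"

definition ifac :: "nat \<Rightarrow> (gvar \<Rightarrow> complex fps) \<Rightarrow> nat \<Rightarrow> complex fps" where
  "ifac c y l = (if l = 0 then (- 1) ^ c * inverse (y (GD c)) else 1)"

text \<open>
  The representative of an orbit for which the vectors other than the \<open>c\<close>-th are the columns of the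
  diagonal matrix with entries \<open>dfac c y\<close>; the \<open>c\<close>-th vector and the linear forms are then forced.
\<close>

definition slice :: "nat \<Rightarrow> (gvar \<Rightarrow> complex fps) \<Rightarrow> coord \<Rightarrow> complex fps" where
  "slice c y z = (case z of
     Vec i l \<Rightarrow> if i = c then - (y (GD (ins c l)) * inverse (y (GD c)) * dfac c y l)
               else if i = ins c l then dfac c y l else 0
   | Covec j l \<Rightarrow> y (GM j (ins c l)) * ifac c y l)"

lemma ins_neq: "ins c s \<noteq> c" "c \<noteq> ins c s"
  by (auto simp: ins_def)

lemma ins_eq_iff: "ins c s = ins c t \<longleftrightarrow> s = t"
  by (auto simp: ins_def split: if_splits)

lemma neg_one_power_square: "(- 1) ^ c * ((- 1) ^ c * x) = (x :: 'a::comm_ring_1)"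
  by (metis (no_types, opaque_lifting) mult.assoc mult_1 power_mult_distrib square_eq_1_iff power_one mult_minus1 minus_minus)

lemma dfac_ifac: "y (GD c) $ 0 \<noteq> 0 \<Longrightarrow> dfac c y l * ifac c y l = 1"
  using inverse_mult_eq_1[of "y (GD c)"] neg_one_power_square[of c "y (GD c) * inverse (y (GD c))"]
  by (simp add: dfac_def ifac_def mult_ac)

definition diag :: "nat \<Rightarrow> (nat \<Rightarrow> 'a::comm_ring_1) \<Rightarrow> 'a mat" where
  "diag n d = mat n n (\<lambda>(r, s). if r = s then d r else 0)"

lemma diag_carrier: "diag n d \<in> carrier_mat n n"
  by (simp add: diag_def)

lemma diag_mult:
  assumes "\<And>l. d l * d' l = (1 :: 'a::comm_ring_1)"
  shows "diag n d * diag n d' = 1\<^sub>m n"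
proof (rule eq_matI)
  fix r s assume rs: "r < dim_row (1\<^sub>m n :: 'a mat)" "s < dim_col (1\<^sub>m n :: 'a mat)"
  have "(diag n d * diag n d') $$ (r, s) = (\<Sum>k<n. (if r = k then d r else 0) * (if k = s then d' k else 0))"
    using rs by (simp add: diag_def scalar_prod_def atLeast0LessThan)
  also have "\<dots> = (\<Sum>k<n. if k = r then d r * (if r = s then d' r else 0) else 0)"
    by (rule sum.cong) auto
  finally have "(diag n d * diag n d') $$ (r, s) = (\<Sum>k<n. if k = r then d r * (if r = s then d' r else 0) else 0)" .
  thus "(diag n d * diag n d') $$ (r, s) = 1\<^sub>m n $$ (r, s)" using rs assms by simp
qed (auto simp: diag_def)

lemma det_diag_dfac:
  assumes "n > 0"
  shows "det (diag n (dfac c y)) = (- 1) ^ c * y (GD c)"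
proof -
  have "det (diag n (dfac c y)) = prod_list (diag_mat (diag n (dfac c y)))"
    by (rule det_upper_triangular[OF _ diag_carrier]) (auto simp: upper_triangular_def diag_def)
  also have "diag_mat (diag n (dfac c y)) = map (dfac c y) [0..<n]"
    by (auto simp: diag_mat_def diag_def)
  also have "prod_list \<dots> = (\<Prod>l<n. dfac c y l)" 
    using prod.distinct_set_conv_list[of "[0..<n]" "dfac c y"] by (simp add: atLeast0LessThan)
  also have "\<dots> = dfac c y 0 * (\<Prod>l\<in>{..<n} - {0}. dfac c y l)"
    using assms by (intro prod.remove) auto
  also have "(\<Prod>l\<in>{..<n} - {0}. dfac c y l) = 1" by (rule prod.neutral) (auto simp: dfac_def)
  finally show ?thesis by (simp only: mult_1_right) (simp only: dfac_def if_True simp_thms)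
qed

lemma minor_mat_slice: "minor_mat n (slice c y) c = diag n (dfac c y)"
  by (rule eq_matI) (auto simp: minor_mat_def slice_def diag_def ins_neq ins_eq_iff)

text \<open>With \<open>A\<close> the minor and \<open>D\<close> the diagonal target,
  \<open>G = D A^(-1)\<close> works; its determinant is 1 because \<open>A\<close> and
  \<open>D\<close> have the same one.\<close>

lemma act_to_slice:
  fixes v :: "coord \<Rightarrow> complex fps"
  assumes n: "n > 0" and c: "c < n + 1" and unit: "gen n v (GD c) $ 0 \<noteq> 0"
  shows "\<exists>G H. G \<in> carrier_mat n n \<and> H \<in> carrier_mat n n \<and> det G = 1 \<and> G * H = 1\<^sub>m n \<and> H * G = 1\<^sub>m n \<and>
     (\<forall>z\<in>coords n. act n G H v z = slice c (gen n v) z)"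
proof -
  define y where "y = gen n v"
  define A where "A = minor_mat n v c"
  define e where "e = (- 1) ^ c * y (GD c)"
  define e' where "e' = (- 1) ^ c * inverse (y (GD c))"
  have y0: "y (GD c) $ 0 \<noteq> 0" using unit by (simp add: y_def)
  have A: "A \<in> carrier_mat n n" by (simp add: A_def minor_mat_carrier)
  have detA: "det A = e" by (simp add: e_def y_def gen_def A_def neg_one_power_square)
  have ee: "e * e' = 1" using dfac_ifac[of y c 0] y0 by (simp add: e_def e'_def dfac_def ifac_def)
  \<comment> \<open>Over power series the inverse is the adjugate divided by the determinant, a unit
    by assumption.\<close>
  define Xi where "Xi = e' \<cdot>\<^sub>m adj_mat A"
  have Xi: "Xi \<in> carrier_mat n n" using adj_mat(1)[OF A] by (simp add: Xi_def)
  have e1: "e' \<cdot>\<^sub>m (e \<cdot>\<^sub>m 1\<^sub>m n) = 1\<^sub>m n"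
    using ee by (intro eq_matI) (auto simp: mult.commute)
  have "A * Xi = e' \<cdot>\<^sub>m (A * adj_mat A)"
    unfolding Xi_def by (rule mult_smult_distrib[OF A adj_mat(1)[OF A]])
  hence AXi: "A * Xi = 1\<^sub>m n" by (simp only: adj_mat(2)[OF A] detA e1)
  have "Xi * A = e' \<cdot>\<^sub>m (adj_mat A * A)"
    unfolding Xi_def by (rule mult_smult_assoc_mat[OF adj_mat(1)[OF A] A])
  hence XiA: "Xi * A = 1\<^sub>m n" by (simp only: adj_mat(3)[OF A] detA e1)
  define D where "D = diag n (dfac c y)"
  define Di where "Di = diag n (ifac c y)"
  have D: "D \<in> carrier_mat n n" and Di: "Di \<in> carrier_mat n n" by (simp_all add: D_def Di_def diag_carrier)
  have DDi: "D * Di = 1\<^sub>m n" "Di * D = 1\<^sub>m n"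
    unfolding D_def Di_def using dfac_ifac[of y c] y0 by (intro diag_mult; simp add: mult.commute)+
  define G where "G = D * Xi"
  define H where "H = A * Di"
  have G: "G \<in> carrier_mat n n" and H: "H \<in> carrier_mat n n" using D Xi A Di by (auto simp: G_def H_def)
  have GH: "G * H = 1\<^sub>m n"
  proof -
    have "G * H = D * (Xi * A) * Di" unfolding G_def H_def using D Xi A Di
      by (simp add: assoc_mult_mat[of _ n n _ n _ n])
    thus ?thesis using D DDi XiA by simp
  qed
  have HG: "H * G = 1\<^sub>m n"
  proof -
    have "H * G = A * (Di * D) * Xi" unfolding G_def H_def using D Xi A Di
      by (simp add: assoc_mult_mat[of _ n n _ n _ n])
    thus ?thesis using A DDi AXi by simp
  qed
  have "det A * det Xi = 1" using det_mult[OF A Xi] AXi by simp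
  hence detG: "det G = 1"
    using det_mult[OF D Xi] det_diag_dfac[OF n, of c y] by (simp add: G_def D_def detA e_def)
  have "G * A = D" unfolding G_def using D Xi A XiA by (simp add: assoc_mult_mat[of _ n n _ n _ n])
  hence GA: "minor_mat n (act n G H v) c = D" by (simp add: minor_mat_act[OF G] A_def)
  have gvec: "act n G H v (Vec (ins c s) r) = (if r = s then dfac c y r else 0)" if "r < n" "s < n" for r s
  proof -
    have "minor_mat n (act n G H v) c $$ (r, s) = D $$ (r, s)" by (simp add: GA)
    thus ?thesis using that by (simp add: minor_mat_def D_def diag_def)
  qed
  have "act n G H v z = slice c y z" if z: "z \<in> coords n" for z
  proof (cases z)
    case (Vec i r)
    have r: "r < n" and i: "i < n + 1" using z by (auto simp: Vec coords_def)
    show ?thesis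
    proof (cases "i = c")
      case False
      define s where "s = (if i < c then i else i - 1)"
      have s: "i = ins c s" "s < n" using False i c by (auto simp: s_def ins_def)
      show ?thesis unfolding Vec s(1) gvec[OF r s(2)] by (auto simp: slice_def ins_neq ins_eq_iff)
    next
      case True
      \<comment> \<open>In the relation between the n + 1 vectors the other n are known and the
        coefficient of the \<open>c\<close>-th is a unit, so the \<open>c\<close>-th vector is
        forced.\<close>
      have "0 = (\<Sum>i<n + 1. gen n (act n G H v) (GD i) * act n G H v (Vec i r))"
        by (rule gen_relation[OF r, symmetric])
      also have "\<dots> = (\<Sum>i<n + 1. y (GD i) * act n G H v (Vec i r))"
        by (simp only: gen_act[OF G H HG detG] y_def)
      also have "\<dots> = y (GD c) * act n G H v (Vec c r) + (\<Sum>s<n. y (GD (ins c s)) * act n G H v (Vec (ins c s) r))"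
        by (rule sum_ins[OF c])
      also have "(\<Sum>s<n. y (GD (ins c s)) * act n G H v (Vec (ins c s) r)) =
          (\<Sum>s<n. if s = r then y (GD (ins c r)) * dfac c y r else 0)"
        by (intro sum.cong refl) (simp add: gvec[OF r])
      also have "\<dots> = y (GD (ins c r)) * dfac c y r" using r by simp
      finally have "y (GD c) * act n G H v (Vec c r) = - (y (GD (ins c r)) * dfac c y r)"
        by (simp add: eq_neg_iff_add_eq_0)
      hence "inverse (y (GD c)) * (y (GD c) * act n G H v (Vec c r)) =
        - (y (GD (ins c r)) * inverse (y (GD c)) * dfac c y r)" by (simp add: mult_ac)
      moreover have "inverse (y (GD c)) * (y (GD c) * act n G H v (Vec c r)) = act n G H v (Vec c r)"
        by (simp add: inverse_mult_eq_1[OF y0] flip: mult.assoc)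
      ultimately show ?thesis using True by (simp add: Vec slice_def)
    qed
  next
    case (Covec j r)
    have r: "r < n" using z by (auto simp: Covec coords_def)
    \<comment> \<open>A linear form \<open>\<xi>\<close> becomes \<open>\<xi> A D^(-1)\<close>, and
      the entries of \<open>\<xi> A\<close> are its pairings with the vectors other than the
      \<open>c\<close>-th.\<close>
    have "act n G H v z = (\<Sum>l<n. v (Covec j l) * (\<Sum>s<n. v (Vec (ins c s) l) * Di $$ (s, r)))"
      unfolding Covec act_def coord.case H_def
      by (intro sum.cong refl arg_cong2[of _ _ _ _ "(*)"])
         (use r Di in \<open>auto simp: A_def minor_mat_def scalar_prod_def atLeast0LessThan intro!: sum.cong\<close>)
    also have "\<dots> = (\<Sum>s<n. gen n v (GM j (ins c s)) * Di $$ (s, r))"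
      unfolding sum_distrib_left by (subst sum.swap) (simp add: gen_def sum_distrib_right sum_distrib_left mult_ac)
    also have "\<dots> = (\<Sum>s<n. if s = r then y (GM j (ins c r)) * ifac c y r else 0)"
      using r by (intro sum.cong refl) (auto simp: Di_def diag_def y_def)
    also have "\<dots> = slice c y z" using r by (simp add: Covec slice_def)
    finally show ?thesis .
  qed
  thus ?thesis using G H detG GH HG unfolding y_def by blast
qed

text \<open>The slice realizes every solution. \<open>GD 0\<close> is right by construction, the
  other minors follow by cancelling \<open>dfac\<close> in the relation between the vectors, the
  pairings \<open>GM j (Suc s)\<close> are read off, and \<open>GM j 0\<close> is determined by the
  relation that both sides satisfy.\<close>

lemma gen_slice:
  assumes n: "n > 0" and y: "sol n y" and y0: "y (GD 0) $ 0 \<noteq> 0" and z: "z \<in> gvars n"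
  shows "gen n (slice 0 y) z = y z"
proof -
  let ?g = "gen n (slice 0 y)"
  have dn0: "dfac 0 y l \<noteq> 0" for l using dfac_ifac[of y 0 l] y0 by auto
  have D0: "?g (GD 0) = y (GD 0)"
    using det_diag_dfac[OF n, of 0 y] by (simp add: gen_def minor_mat_slice)
  have DS: "?g (GD (Suc l)) = y (GD (Suc l))" if l: "l < n" for l
  proof -
    have "0 = (\<Sum>i<n + 1. ?g (GD i) * slice 0 y (Vec i l))" by (rule gen_relation[OF l, symmetric])
    also have "\<dots> = ?g (GD 0) * slice 0 y (Vec 0 l) + (\<Sum>s<n. ?g (GD (ins 0 s)) * slice 0 y (Vec (ins 0 s) l))"
      by (rule sum_ins) simp
    also have "(\<Sum>s<n. ?g (GD (ins 0 s)) * slice 0 y (Vec (ins 0 s) l)) =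
        (\<Sum>s<n. if s = l then ?g (GD (Suc l)) * dfac 0 y l else 0)"
      by (intro sum.cong refl) (auto simp: slice_def ins_def)
    also have "\<dots> = ?g (GD (Suc l)) * dfac 0 y l" using l by simp
    also have "?g (GD 0) * slice 0 y (Vec 0 l) = - (y (GD (Suc l)) * dfac 0 y l)"
      using inverse_mult_eq_1[OF y0] by (simp add: D0 slice_def ins_def)
        (metis (no_types, lifting) mult.left_commute mult.right_neutral mult.commute)
    finally have "0 = - (y (GD (Suc l)) * dfac 0 y l) + ?g (GD (Suc l)) * dfac 0 y l" .
    hence "?g (GD (Suc l)) * dfac 0 y l = y (GD (Suc l)) * dfac 0 y l"
      using minus_unique[of "- (y (GD (Suc l)) * dfac 0 y l)"] by simp
    hence "(?g (GD (Suc l)) - y (GD (Suc l))) * dfac 0 y l = 0" by (simp only: left_diff_distrib diff_self)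
    thus ?thesis using dn0[of l] by simp
  qed
  have D: "?g (GD i) = y (GD i)" if "i < n + 1" for i
    using that D0 DS by (cases i) auto
  have MS: "?g (GM j (Suc s)) = y (GM j (Suc s))" if s: "s < n" for j s
  proof -
    have "?g (GM j (Suc s)) = (\<Sum>l<n. if l = s then y (GM j (Suc s)) * (dfac 0 y s * ifac 0 y s) else 0)"
      unfolding gen_def gvar.case by (intro sum.cong refl) (auto simp: slice_def ins_def mult_ac)
    thus ?thesis using s dfac_ifac[of y 0 s, OF y0] by simp
  qed
  have M0: "?g (GM j 0) = y (GM j 0)" if j: "j < n - 1" for j
  proof -
    have "(\<Sum>i<n + 1. ?g (GM j i) * ?g (GD i)) - (\<Sum>i<n + 1. y (GM j i) * y (GD i)) = 0"
      using gen_relation_GM[of n "slice 0 y" j] y j by (simp add: sol_def)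
    moreover have "(\<Sum>s<n. ?g (GM j (ins 0 s)) * ?g (GD (ins 0 s))) = (\<Sum>s<n. y (GM j (ins 0 s)) * y (GD (ins 0 s)))"
      by (intro sum.cong refl) (simp add: ins_def MS DS)
    ultimately have "(?g (GM j 0) - y (GM j 0)) * y (GD 0) = 0"
      by (simp only: sum_ins[of 0 n] D0) (simp add: D0 algebra_simps)
    moreover have "y (GD 0) \<noteq> 0" using y0 by auto
    ultimately show ?thesis by simp
  qed
  show ?thesis
  proof (cases z)
    case (GM j i)
    thus ?thesis using z M0 MS by (cases i) (auto simp: gvars_def)
  qed (use z D in \<open>auto simp: gvars_def\<close>)
qed

section \<open>Invariants of the jets are polynomials in the jets of the generators\<close>

context jets
begin

text \<open>Regular functions on the chart where d_c(0) is nonzero, given by their values; off the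
  chart \<open>h\<close> is arbitrary.\<close>

definition ratl :: "nat \<Rightarrow> ((gvar \<Rightarrow> complex fps) \<Rightarrow> complex) \<Rightarrow> bool" where
  "ratl c h \<longleftrightarrow> (\<exists>N. \<exists>p\<in>P. \<forall>y. y (GD c) $ 0 \<noteq> 0 \<longrightarrow> (y (GD c) $ 0) ^ N * h y = peval (coeffs_at y) p)"

lemma ratl_poly: "p \<in> P \<Longrightarrow> ratl c (\<lambda>y. peval (coeffs_at y) p)"
  unfolding ratl_def by (intro exI[of _ 0] bexI[of _ p]) auto

lemma ratl_const: "ratl c (\<lambda>_. a)"
  using ratl_poly[of "scal a"] by (simp add: poly_alg_closed scal_complex_def)

lemma ratl_coeff: "z \<in> gvars n \<Longrightarrow> k \<le> m \<Longrightarrow> ratl c (\<lambda>y. y z $ k)"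
  using ratl_poly[of "poly_var (z, k)"] by (simp add: coeffs_at_def poly_var_closed Vars_def)

lemma ratl_cong: "ratl c h \<Longrightarrow> (\<And>y. y (GD c) $ 0 \<noteq> 0 \<Longrightarrow> h y = h' y) \<Longrightarrow> ratl c h'"
  by (simp add: ratl_def)

context
  fixes c :: nat
  assumes c: "c < n + 1"
begin

abbreviation "dc \<equiv> poly_var (GD c, 0 :: nat) :: (gvar \<times> nat) mpoly"

lemma dc_P: "dc \<in> P"
  using c by (intro poly_var_closed GD_Vars) auto

lemma peval_dc: "peval (coeffs_at y) dc = y (GD c) $ 0"
  by (simp add: coeffs_at_def)

lemma ratl_add:
  assumes "ratl c g" "ratl c h" shows "ratl c (\<lambda>y. g y + h y)"
proof -
  obtain M p N q where *: "p \<in> P" "\<And>y. y (GD c) $ 0 \<noteq> 0 \<Longrightarrow> (y (GD c) $ 0) ^ M * g y = peval (coeffs_at y) p"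
    "q \<in> P" "\<And>y. y (GD c) $ 0 \<noteq> 0 \<Longrightarrow> (y (GD c) $ 0) ^ N * h y = peval (coeffs_at y) q"
    using assms by (auto simp: ratl_def)
  have "(y (GD c) $ 0) ^ (M + N) * (g y + h y) = peval (coeffs_at y) (dc ^ N * p + dc ^ M * q)"
    if "y (GD c) $ 0 \<noteq> 0" for y
  proof -
    have e: "peval (coeffs_at y) p = (y (GD c) $ 0) ^ M * g y" "peval (coeffs_at y) q = (y (GD c) $ 0) ^ N * h y"
      using *(2,4) that by simp_all
    show ?thesis
      by (simp only: peval_simps(3,4) peval_power peval_dc e power_add) (simp add: algebra_simps)
  qed
  moreover have "dc ^ N * p + dc ^ M * q \<in> P"
    by (intro poly_alg_add_closed poly_alg_mult_closed poly_alg_power_closed dc_P *)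
  ultimately show ?thesis unfolding ratl_def by blast
qed

lemma ratl_mult:
  assumes "ratl c g" "ratl c h" shows "ratl c (\<lambda>y. g y * h y)"
proof -
  obtain M p N q where *: "p \<in> P" "\<And>y. y (GD c) $ 0 \<noteq> 0 \<Longrightarrow> (y (GD c) $ 0) ^ M * g y = peval (coeffs_at y) p"
    "q \<in> P" "\<And>y. y (GD c) $ 0 \<noteq> 0 \<Longrightarrow> (y (GD c) $ 0) ^ N * h y = peval (coeffs_at y) q"
    using assms by (auto simp: ratl_def)
  have "(y (GD c) $ 0) ^ (M + N) * (g y * h y) = peval (coeffs_at y) (p * q)"
    if "y (GD c) $ 0 \<noteq> 0" for y
    using that by (simp add: power_add mult_ac flip: *(2)[of y] *(4)[of y])
  moreover have "p * q \<in> P" by (intro poly_alg_mult_closed *)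
  ultimately show ?thesis unfolding ratl_def by blast
qed

lemma ratl_sum: "(\<And>i. i \<in> A \<Longrightarrow> ratl c (g i)) \<Longrightarrow> ratl c (\<lambda>y. \<Sum>i\<in>A. g i y)"
  by (induction A rule: infinite_finite_induct) (auto simp: ratl_const intro: ratl_add)

lemma ratl_cancel:
  assumes "ratl c (\<lambda>y. y (GD c) $ 0 * h y)" shows "ratl c h"
proof -
  obtain N p where *: "p \<in> P" "\<And>y. y (GD c) $ 0 \<noteq> 0 \<Longrightarrow> (y (GD c) $ 0) ^ N * (y (GD c) $ 0 * h y) = peval (coeffs_at y) p"
    using assms by (auto simp: ratl_def)
  have "(y (GD c) $ 0) ^ (Suc N) * h y = peval (coeffs_at y) p" if "y (GD c) $ 0 \<noteq> 0" for y
    using *(2)[of y] that by (simp add: mult_ac)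
  thus ?thesis using *(1) unfolding ratl_def by blast
qed

text \<open>Comparing coefficients in \<open>w * y (GD c) = 1\<close> expresses d_c(0) times the
  \<open>k\<close>-th coefficient of \<open>w\<close> by the lower ones.\<close>

lemma ratl_inverse: "k \<le> m \<Longrightarrow> ratl c (\<lambda>y. inverse (y (GD c)) $ k)"
proof (induction k rule: less_induct)
  case (less k)
  let ?w = "\<lambda>y :: gvar \<Rightarrow> complex fps. inverse (y (GD c))"
  have "(\<lambda>y. (if k = 0 then 1 else 0) + (- 1) * (\<Sum>i\<in>{1..k}. y (GD c) $ i * ?w y $ (k - i))) y =
      y (GD c) $ 0 * ?w y $ k" if y: "y (GD c) $ 0 \<noteq> 0" for y
  proof -
    have "(if k = 0 then 1 else 0) = (y (GD c) * ?w y) $ k"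
      using inverse_mult_eq_1[OF y] by (simp add: mult.commute)
    also have "\<dots> = (\<Sum>i=0..k. y (GD c) $ i * ?w y $ (k - i))" by (rule fps_mult_nth)
    also have "\<dots> = y (GD c) $ 0 * ?w y $ k + (\<Sum>i\<in>{1..k}. y (GD c) $ i * ?w y $ (k - i))"
      by (subst sum.atLeast_Suc_atMost) auto
    finally show ?thesis by simp
  qed
  moreover have "ratl c (\<lambda>y. (if k = 0 then 1 else 0) + (- 1) * (\<Sum>i\<in>{1..k}. y (GD c) $ i * ?w y $ (k - i)))"
    using less c by (intro ratl_add ratl_mult ratl_sum ratl_const ratl_coeff) (auto simp: gvars_def)
  ultimately have "ratl c (\<lambda>y. y (GD c) $ 0 * ?w y $ k)" by (rule ratl_cong[rotated])
  thus ?case by (rule ratl_cancel)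
qed

definition ratl_jet :: "((gvar \<Rightarrow> complex fps) \<Rightarrow> complex fps) \<Rightarrow> bool" where
  "ratl_jet h \<longleftrightarrow> (\<forall>k\<le>m. ratl c (\<lambda>y. h y $ k))"

lemma ratl_jet_mult: "ratl_jet g \<Longrightarrow> ratl_jet h \<Longrightarrow> ratl_jet (\<lambda>y. g y * h y)"
  unfolding ratl_jet_def fps_mult_nth by (auto intro!: ratl_sum ratl_mult)

lemma ratl_jet_uminus: "ratl_jet h \<Longrightarrow> ratl_jet (\<lambda>y. - h y)"
  using ratl_mult[OF ratl_const[of _ "- 1"]] unfolding ratl_jet_def by simp

lemma ratl_jet_const: "ratl_jet (\<lambda>_. f)"
  by (simp add: ratl_jet_def ratl_const)

lemma ratl_jet_var: "z \<in> gvars n \<Longrightarrow> ratl_jet (\<lambda>y. y z)"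
  by (simp add: ratl_jet_def ratl_coeff)

lemma ratl_jet_inverse: "ratl_jet (\<lambda>y. inverse (y (GD c)))"
  by (simp add: ratl_jet_def ratl_inverse)

lemma ratl_jet_slice:
  assumes z: "z \<in> coords n" shows "ratl_jet (\<lambda>y. slice c y z)"
proof -
  have c': "GD c \<in> gvars n" using c by (auto simp: gvars_def)
  have d: "ratl_jet (\<lambda>y. dfac c y l)" and i: "ratl_jet (\<lambda>y. ifac c y l)" for l
    unfolding dfac_def ifac_def
    by (cases "l = 0"; simp add: ratl_jet_const ratl_jet_mult ratl_jet_var[OF c'] ratl_jet_inverse)+
  show ?thesis
  proof (cases z)
    case (Vec i l)
    have "GD (ins c l) \<in> gvars n" using z by (auto simp: Vec coords_def gvars_def ins_def)
    hence "ratl_jet (\<lambda>y. - (y (GD (ins c l)) * inverse (y (GD c)) * dfac c y l))"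
      by (intro ratl_jet_uminus ratl_jet_mult ratl_jet_inverse ratl_jet_var d)
    thus ?thesis unfolding Vec slice_def coord.case
      by (cases "i = c"; cases "i = ins c l"; simp only: if_True if_False simp_thms d ratl_jet_const)
  next
    case (Covec j l)
    have "GM j (ins c l) \<in> gvars n" using z by (auto simp: Covec coords_def gvars_def ins_def)
    thus ?thesis unfolding Covec slice_def coord.case
      by (intro ratl_jet_mult ratl_jet_var i)
  qed
qed

lemma ratl_slice:
  assumes "s \<in> carrier (poly_alg (coords n \<times> {..m}))"
  shows "ratl c (\<lambda>y. peval (coeffs_at (slice c y)) s)"
  using assms
proof (induction s rule: poly_alg_induct)
  case (var x)
  thus ?case using ratl_jet_slice[of "fst x"] by (cases x) (auto simp: ratl_jet_def coeffs_at_def)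
qed (auto intro: ratl_const ratl_add ratl_mult)

end

text \<open>The generic arc. The coefficients of \<open>gen n univ_jet\<close> are the polynomials
  that give the jets of the generators in terms of the jets of the coordinates.\<close>

definition univ_jet :: "coord \<Rightarrow> (coord \<times> nat) mpoly fps" where
  "univ_jet x = Abs_fps (\<lambda>k. poly_var (x, k))"

lemma gen_univ_jet: "peval (coeffs_at v) (gen n univ_jet z $ k) = gen n v z $ k"
proof -
  let ?h = "\<lambda>f :: (coord \<times> nat) mpoly fps. Abs_fps (\<lambda>k. peval (coeffs_at v) (f $ k))"
  have "comm_ring_hom ?h"
    by unfold_locales (auto simp: fps_eq_iff fps_mult_nth peval_sum fps_one_nth)
  from gen_hom[OF this, of n univ_jet z]
  have "?h (gen n univ_jet z) = gen n (\<lambda>x. ?h (univ_jet x)) z" .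
  moreover have "?h (univ_jet x) = v x" for x by (simp add: univ_jet_def coeffs_at_def fps_eq_iff)
  ultimately have "?h (gen n univ_jet z) = gen n v z" by simp
  thus ?thesis by (metis fps_nth_Abs_fps)
qed

text \<open>One point is enough: the slice over the solution with \<open>GD 0\<close> equal to 1 and
  all else 0.\<close>

lemma gen_D0_nonzero: "gen n univ_jet (GD 0) $ 0 \<noteq> 0"
proof
  assume *: "gen n univ_jet (GD 0) $ 0 = 0"
  let ?y = "\<lambda>z. if z = GD 0 then 1 else 0 :: complex fps"
  have "sol n ?y" by (auto simp: sol_def intro!: sum.neutral)
  hence "gen n (slice 0 ?y) (GD 0) = ?y (GD 0)"
    using n2 by (intro gen_slice) (auto simp: gvars_def)
  moreover have "gen n (slice 0 ?y) (GD 0) $ 0 = 0"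
    using gen_univ_jet[of "slice 0 ?y" "GD 0" 0] * by simp
  ultimately show False by simp
qed

definition invariant :: "(coord \<times> nat) mpoly \<Rightarrow> bool" where
  "invariant s \<longleftrightarrow> (\<forall>G H v. G \<in> carrier_mat n n \<longrightarrow> H \<in> carrier_mat n n \<longrightarrow> det G = 1 \<longrightarrow>
     G * H = 1\<^sub>m n \<longrightarrow> H * G = 1\<^sub>m n \<longrightarrow> peval (coeffs_at (act n G H v)) s = peval (coeffs_at v) s)"

lemma invariant_generated:
  assumes s: "s \<in> carrier (poly_alg (coords n \<times> {..m}))" and inv: "invariant s"
  shows "\<exists>p\<in>P. \<forall>v. peval (coeffs_at v) s = peval (coeffs_at (gen n v)) p"
proof -
  have ex: "\<exists>N. \<exists>p\<in>P. \<forall>v. (gen n v (GD c) $ 0) ^ N * peval (coeffs_at v) s = peval (coeffs_at (gen n v)) p"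
    if c: "c < n + 1" for c
  proof -
    obtain N p where p: "p \<in> P" "\<And>y. y (GD c) $ 0 \<noteq> 0 \<Longrightarrow>
        (y (GD c) $ 0) ^ N * peval (coeffs_at (slice c y)) s = peval (coeffs_at y) p"
      using ratl_slice[OF c s] by (auto simp: ratl_def)
    let ?d = "poly_var (GD c, 0 :: nat)"
    \<comment> \<open>The extra factor \<open>?d\<close> makes both sides vanish where d_c(0) = 0,
      so the identity holds at every \<open>v\<close>.\<close>
    have "(gen n v (GD c) $ 0) ^ Suc N * peval (coeffs_at v) s = peval (coeffs_at (gen n v)) (?d * p)" for v
    proof (cases "gen n v (GD c) $ 0 = 0")
      case True
      thus ?thesis by (simp add: coeffs_at_def)
    next
      case False
      obtain G H where GH: "G \<in> carrier_mat n n" "H \<in> carrier_mat n n" "det G = 1" "G * H = 1\<^sub>m n" "H * G = 1\<^sub>m n"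
        "\<forall>z\<in>coords n. act n G H v z = slice c (gen n v) z"
        using act_to_slice[OF _ c False] n2 by auto
      have "peval (coeffs_at v) s = peval (coeffs_at (act n G H v)) s"
        using inv GH unfolding invariant_def by metis
      also have "\<dots> = peval (coeffs_at (slice c (gen n v))) s"
        by (rule peval_cong[OF s]) (use GH(6) in \<open>auto simp: coeffs_at_def\<close>)
      finally have "peval (coeffs_at v) s = peval (coeffs_at (slice c (gen n v))) s" .
      thus ?thesis using p(2)[of "gen n v", OF False] by (simp add: coeffs_at_def mult.assoc)
    qed
    moreover have "?d * p \<in> P" using dc_P[OF c] p(1) by (rule poly_alg_mult_closed)
    ultimately show ?thesis by blast
  qed
  obtain N p where p: "p \<in> P" "\<And>v. (gen n v (GD 0) $ 0) ^ N * peval (coeffs_at v) s = peval (coeffs_at (gen n v)) p"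
    using ex[of 0] by auto
  obtain M q where q: "q \<in> P" "\<And>v. (gen n v (GD 1) $ 0) ^ M * peval (coeffs_at v) s = peval (coeffs_at (gen n v)) q"
    using ex[of 1] n2 by auto
  \<comment> \<open>At a solution with \<open>GD 0\<close> a unit, realized by a slice, both
    fractions take the value of \<open>s\<close>; cross multiplication gives the hypothesis of
    \<open>regular_sequence\<close>.\<close>
  have "\<exists>r\<in>P. \<forall>y. sol n y \<longrightarrow> peval (coeffs_at y) p = (y (GD 0) $ 0) ^ N * peval (coeffs_at y) r"
  proof (rule regular_sequence[OF p(1) q(1)])
    fix y assume y: "sol n y" "y (GD 0) $ 0 \<noteq> 0"
    let ?v = "slice 0 y"
    have g: "gen n ?v z = y z" if "z \<in> gvars n" for z
      using gen_slice[OF _ y that] n2 by simp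
    have e: "peval (coeffs_at y) t = peval (coeffs_at (gen n ?v)) t" if "t \<in> P" for t
      by (rule peval_cong[OF that]) (auto simp: coeffs_at_def Vars_def g)
    have g01: "gen n ?v (GD 0) = y (GD 0)" "gen n ?v (GD 1) = y (GD 1)"
      using n2 by (auto intro!: g simp: gvars_def)
    have "(y (GD 1) $ 0) ^ M * peval (coeffs_at y) p = (y (GD 1) $ 0) ^ M * ((y (GD 0) $ 0) ^ N * peval (coeffs_at ?v) s)"
      using p(2)[of ?v] by (simp only: e[OF p(1)] g01)
    also have "\<dots> = (y (GD 0) $ 0) ^ N * ((y (GD 1) $ 0) ^ M * peval (coeffs_at ?v) s)"
      by (simp only: mult_ac)
    also have "\<dots> = (y (GD 0) $ 0) ^ N * peval (coeffs_at y) q"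
      using q(2)[of ?v] by (simp only: e[OF q(1)] g01)
    finally show "(y (GD 1) $ 0) ^ M * peval (coeffs_at y) p = (y (GD 0) $ 0) ^ N * peval (coeffs_at y) q" .
  qed
  then obtain r where r: "r \<in> P" "\<And>y. sol n y \<Longrightarrow> peval (coeffs_at y) p = (y (GD 0) $ 0) ^ N * peval (coeffs_at y) r"
    by blast
  define r' where "r' = peval (\<lambda>(z, k). gen n univ_jet z $ k) r"
  have r': "peval (coeffs_at v) r' = peval (coeffs_at (gen n v)) r" for v
  proof -
    have "(\<lambda>x. peval (coeffs_at v) ((\<lambda>(z, k). gen n univ_jet z $ k) x)) = coeffs_at (gen n v)"
      by (auto simp: coeffs_at_def gen_univ_jet[unfolded coeffs_at_def])
    thus ?thesis by (simp add: r'_def peval_peval)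
  qed
  let ?D = "gen n univ_jet (GD 0) $ 0"
  \<comment> \<open>\<open>s\<close> and \<open>r'\<close> agree after multiplication by d_0(0)^N,
    and d_0(0) is a nonzero polynomial on the jets of V.\<close>
  have "s - r' = 0"
  proof (rule peval_mult_eq_0[of ?D])
    fix a :: "coord \<times> nat \<Rightarrow> complex"
    define v where "v x = Abs_fps (\<lambda>k. a (x, k))" for x
    have a: "a = coeffs_at v" by (auto simp: coeffs_at_def v_def)
    have "(gen n v (GD 0) $ 0) ^ N * (peval (coeffs_at v) s - peval (coeffs_at v) r') = 0"
      using r(2)[OF sol_gen[of n v]] p(2)[of v] by (simp add: r' right_diff_distrib)
    thus "peval a ?D * peval a (s - r') = 0"
      by (auto simp: a gen_univ_jet)
  qed (rule gen_D0_nonzero)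
  hence "s = r'" by simp
  thus ?thesis using r(1) r' by blast
qed

end

section \<open>Points of the group and of the representation lifted to power series\<close>

lemma class_alg_UNIV: "x \<in> carrier class_alg"
  by (simp add: class_alg_simps)

text \<open>Treats C and the rings of jets and arcs uniformly as quotients of C[[t]]. The last
  assumption makes every series that is mapped to 1 a unit, which is needed to lift
  determinants.\<close>

locale fps_image =
  fixes B :: "(complex, 'b) module" and h :: "complex fps \<Rightarrow> 'b"
  assumes B: "algebra complex_alg B" and hom: "h \<in> alg_hom class_alg B"
    and surj: "h ` UNIV = carrier B" and unit: "h f = \<one>\<^bsub>B\<^esub> \<Longrightarrow> f $ 0 \<noteq> 0"
begin

interpretation BB: cring B by (rule algebra.M_cring[OF B])
interpretation CC: cring "class_alg :: (complex, complex fps) module" by (rule cring_class_alg)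
interpretation H: ring_hom_cring class_alg B h
  by unfold_locales (rule alg_homD(1)[OF hom])

lemma h_closed [simp]: "h f \<in> carrier B"
  using surj by blast

lemma h_simps:
  "h 1 = \<one>\<^bsub>B\<^esub>" "h 0 = \<zero>\<^bsub>B\<^esub>" "h (f + g) = h f \<oplus>\<^bsub>B\<^esub> h g" "h (f * g) = h f \<otimes>\<^bsub>B\<^esub> h g"
  "h (- f) = \<ominus>\<^bsub>B\<^esub> h f"
proof -
  show add: "h (f + g) = h f \<oplus>\<^bsub>B\<^esub> h g" and "h (f * g) = h f \<otimes>\<^bsub>B\<^esub> h g"
    using alg_homD(3,4)[OF hom, of f g] by (simp_all add: class_alg_simps)
  show "h 1 = \<one>\<^bsub>B\<^esub>" using alg_homD(5)[OF hom] by (simp add: class_alg_simps)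
  show z: "h 0 = \<zero>\<^bsub>B\<^esub>" using H.hom_zero by (simp add: class_alg_simps)
  have "h (- f) \<oplus>\<^bsub>B\<^esub> h f = \<zero>\<^bsub>B\<^esub>"
    using alg_homD(4)[OF hom, of "- f" f] z by (simp add: class_alg_simps)
  thus "h (- f) = \<ominus>\<^bsub>B\<^esub> h f" using BB.minus_equality[of "h (- f)" "h f"] by simp
qed

lemma h_sum: "h (sum f A) = (\<Oplus>\<^bsub>B\<^esub>i\<in>A. h (f i))"
  using H.hom_finsum[of f A] by (simp add: class_alg_finsum class_alg_simps comp_def)

lemma h_prod: "h (prod f A) = (\<Otimes>\<^bsub>B\<^esub>i\<in>A. h (f i))"
  using H.hom_finprod[of f A] by (simp add: class_alg_finprod class_alg_simps comp_def)

definition red :: "nat \<Rightarrow> complex fps mat \<Rightarrow> nat \<times> nat \<Rightarrow> 'b" where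
  "red n G = (\<lambda>(i, j) \<in> {..<n} \<times> {..<n}. h (G $$ (i, j)))"

lemma red_ring_det:
  assumes "G \<in> carrier_mat n n"
  shows "ring_det B n (red n G) = h (det G)"
proof -
  have "h (det G) = h (\<Sum>p | p permutes {..<n}. signof p * (\<Prod>i<n. G $$ (i, p i)))"
    unfolding det_def'[OF assms] by (simp add: atLeast0LessThan)
  also have "\<dots> = (\<Oplus>\<^bsub>B\<^esub>p\<in>{p. p permutes {..<n}}. h (signof p) \<otimes>\<^bsub>B\<^esub> (\<Otimes>\<^bsub>B\<^esub>i\<in>{..<n}. h (G $$ (i, p i))))"
    by (simp add: h_sum h_simps h_prod)
  also have "\<dots> = ring_det B n (red n G)"
    unfolding ring_det_def
  proof (intro BB.finsum_cong' refl)
    fix p assume "p \<in> {p. p permutes {..<n}}"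
    hence p: "i < n \<Longrightarrow> p i < n" for i using permutes_in_image[of p "{..<n}" i] by auto
    have "(\<Otimes>\<^bsub>B\<^esub>i\<in>{..<n}. h (G $$ (i, p i))) = (\<Otimes>\<^bsub>B\<^esub>i\<in>{..<n}. red n G (i, p i))"
      by (rule BB.finprod_cong') (auto simp: red_def p)
    thus "h (signof p) \<otimes>\<^bsub>B\<^esub> (\<Otimes>\<^bsub>B\<^esub>i\<in>{..<n}. h (G $$ (i, p i))) =
      (if evenperm p then \<one>\<^bsub>B\<^esub> else \<ominus>\<^bsub>B\<^esub> \<one>\<^bsub>B\<^esub>) \<otimes>\<^bsub>B\<^esub> (\<Otimes>\<^bsub>B\<^esub>i\<in>{..<n}. red n G (i, p i))"
      by (simp add: sign_def h_simps)
  next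
    show "(\<lambda>p. (if evenperm p then \<one>\<^bsub>B\<^esub> else \<ominus>\<^bsub>B\<^esub> \<one>\<^bsub>B\<^esub>) \<otimes>\<^bsub>B\<^esub> (\<Otimes>\<^bsub>B\<^esub>i\<in>{..<n}. red n G (i, p i)))
      \<in> {p. p permutes {..<n}} \<rightarrow> carrier B"
    proof (intro Pi_I BB.m_closed BB.finprod_closed)
      fix p i assume "p \<in> {p. p permutes {..<n}}" "i \<in> {..<n}"
      hence "i < n" "p i < n" using permutes_in_image[of p "{..<n}" i] by auto
      thus "red n G (i, p i) \<in> carrier B" by (simp add: red_def)
    qed auto
  qed
  finally show ?thesis by simp
qed

lemma red_closed: "red n G \<in> {..<n} \<times> {..<n} \<rightarrow>\<^sub>E carrier B"
  by (auto simp: red_def)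

lemma red_mult:
  assumes "G \<in> carrier_mat n n" "G' \<in> carrier_mat n n"
  shows "red n (G * G') = red n G \<otimes>\<^bsub>SL B n\<^esub> red n G'"
proof
  fix x :: "nat \<times> nat"
  obtain i j where x: "x = (i, j)" by (cases x)
  show "red n (G * G') x = (red n G \<otimes>\<^bsub>SL B n\<^esub> red n G') x"
  proof (cases "i < n \<and> j < n")
    case True
    have "(G * G') $$ (i, j) = (\<Sum>k<n. G $$ (i, k) * G' $$ (k, j))"
      using True assms by (auto simp: scalar_prod_def atLeast0LessThan intro!: sum.cong)
    hence "red n (G * G') x = (\<Oplus>\<^bsub>B\<^esub>k\<in>{..<n}. h (G $$ (i, k)) \<otimes>\<^bsub>B\<^esub> h (G' $$ (k, j)))"
      using True by (simp add: red_def x h_sum h_simps)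
    also have "\<dots> = (\<Oplus>\<^bsub>B\<^esub>k\<in>{..<n}. red n G (i, k) \<otimes>\<^bsub>B\<^esub> red n G' (k, j))"
      using True by (intro BB.finsum_cong') (auto simp: red_def)
    finally show ?thesis using True by (simp add: SL_def x)
  qed (auto simp: red_def SL_def x)
qed

lemma red_one: "red n (1\<^sub>m n) = \<one>\<^bsub>SL B n\<^esub>"
  by (auto simp: red_def SL_def h_simps fun_eq_iff)

lemma red_SL: "G \<in> carrier_mat n n \<Longrightarrow> det G = 1 \<Longrightarrow> red n G \<in> carrier (SL B n)"
  using red_closed[of n G] red_ring_det[of G n] by (simp add: SL_def h_simps)

lemma red_surj:
  assumes "g \<in> {..<n} \<times> {..<n} \<rightarrow>\<^sub>E carrier B"
  shows "\<exists>G\<in>carrier_mat n n. g = red n G"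
proof -
  define l where "l = inv_into UNIV h"
  have l: "h (l x) = x" if "x \<in> carrier B" for x
    unfolding l_def by (rule f_inv_into_f) (simp add: surj that)
  let ?G = "mat n n (\<lambda>x. l (g x))"
  have "g = red n ?G"
  proof
    fix x show "g x = red n ?G x"
    proof (cases "x \<in> {..<n} \<times> {..<n}")
      case True
      thus ?thesis using l[OF PiE_mem[OF assms True]] by (auto simp: red_def)
    next
      case False
      thus ?thesis using PiE_arb[OF assms False] by (auto simp: red_def)
    qed
  qed
  thus ?thesis by (intro bexI[of _ ?G]) auto
qed

text \<open>\<open>m_inv\<close> is a definite description, so uniqueness is part of the claim. A
  competitor is lifted to a matrix \<open>Y\<close>, for which only the reduction of
  \<open>Y * G\<close> is known to be 1.\<close>

lemma inv_red:
  assumes G: "G \<in> carrier_mat n n" "det G = 1" and H: "H \<in> carrier_mat n n" "G * H = 1\<^sub>m n" "H * G = 1\<^sub>m n"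
  shows "inv\<^bsub>SL B n\<^esub> (red n G) = red n H"
  unfolding m_inv_def
proof (rule the_equality)
  have "det G * det H = 1" using det_mult[OF G(1) H(1)] H(2) by simp
  hence "det H = 1" using G(2) by simp
  thus "red n H \<in> carrier (SL B n) \<and> red n G \<otimes>\<^bsub>SL B n\<^esub> red n H = \<one>\<^bsub>SL B n\<^esub> \<and> red n H \<otimes>\<^bsub>SL B n\<^esub> red n G = \<one>\<^bsub>SL B n\<^esub>"

    unfolding red_mult[OF G(1) H(1), symmetric] red_mult[OF H(1) G(1), symmetric] H(2,3) red_one
    using red_SL[OF H(1)] by simp
next
  fix y assume y: "y \<in> carrier (SL B n) \<and> red n G \<otimes>\<^bsub>SL B n\<^esub> y = \<one>\<^bsub>SL B n\<^esub> \<and> y \<otimes>\<^bsub>SL B n\<^esub> red n G = \<one>\<^bsub>SL B n\<^esub>"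
  then obtain Y where Y: "Y \<in> carrier_mat n n" "y = red n Y" using red_surj[of y n] by (auto simp: SL_def)
  have "y = red n (Y * (G * H))" unfolding H(2) right_mult_one_mat[OF Y(1)] by (rule Y(2))
  also have "\<dots> = red n ((Y * G) * H)" by (simp only: assoc_mult_mat[OF Y(1) G(1) H(1)])
  also have "\<dots> = red n (Y * G) \<otimes>\<^bsub>SL B n\<^esub> red n H" using Y G H by (intro red_mult) auto
  also have "red n (Y * G) = red n (1\<^sub>m n)" 
    unfolding red_mult[OF Y(1) G(1)] Y(2)[symmetric] red_one using y by simp
  also have "red n (1\<^sub>m n) \<otimes>\<^bsub>SL B n\<^esub> red n H = red n H" 
    unfolding red_mult[OF one_carrier_mat H(1), symmetric] left_mult_one_mat[OF H(1)] by (rule refl)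
  finally show "y = red n H" .
qed

text \<open>The entries are lifted arbitrarily. The determinant is then a unit that reduces to 1,
  and multiplying one row by its inverse corrects it without changing the reduction.\<close>

lemma SL_lift:
  assumes n: "n > 0" and g: "g \<in> carrier (SL B n)"
  shows "\<exists>G H. G \<in> carrier_mat n n \<and> H \<in> carrier_mat n n \<and> det G = 1 \<and> G * H = 1\<^sub>m n \<and> H * G = 1\<^sub>m n \<and>
    g = red n G"
proof -
  obtain G where G: "G \<in> carrier_mat n n" "g = red n G" using red_surj[of g n] g by (auto simp: SL_def)
  have h1: "h (det G) = \<one>\<^bsub>B\<^esub>" using g red_ring_det[OF G(1)] by (simp add: SL_def G(2))
  define w where "w = inverse (det G)"
  have w: "w * det G = 1" unfolding w_def by (rule inverse_mult_eq_1[OF unit[OF h1]])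
  have hw: "h w = \<one>\<^bsub>B\<^esub>"
    using h_simps(4)[of w "det G"] by (simp add: w h1 h_simps(1))
  define G' where "G' = multrow 0 w G"
  have G': "G' \<in> carrier_mat n n" using G by (simp add: G'_def)
  have det: "det G' = 1" using det_multrow[OF n G(1), of w] w by (simp add: G'_def)
  have red: "red n G' = red n G"
    using G by (auto simp: red_def fun_eq_iff G'_def h_simps hw)
  let ?H = "adj_mat G'"
  have "?H \<in> carrier_mat n n" "G' * ?H = 1\<^sub>m n" "?H * G' = 1\<^sub>m n"
    using adj_mat[OF G'] det by (auto intro!: eq_matI)
  thus ?thesis using G' det red G(2) by metis
qed

lemma V_points_lift:
  assumes "v \<in> V_points B n"
  shows "\<exists>w. v = restrict (\<lambda>x. h (w x)) (coords n)"
proof -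
  define l where "l = inv_into UNIV h"
  have l: "h (l x) = x" if "x \<in> carrier B" for x
    unfolding l_def by (rule f_inv_into_f) (simp add: surj that)
  have "v = restrict (\<lambda>x. h (l (v x))) (coords n)"
  proof
    fix x show "v x = restrict (\<lambda>x. h (l (v x))) (coords n) x"
    proof (cases "x \<in> coords n")
      case True
      thus ?thesis using l[OF PiE_mem[OF assms[unfolded V_points_def] True]] by simp
    next
      case False
      thus ?thesis using PiE_arb[OF assms[unfolded V_points_def] False] by simp
    qed
  qed
  thus ?thesis by (intro exI[of _ "\<lambda>x. l (v x)"])
qed

lemma V_points_restrict: "restrict (\<lambda>x. h (w x)) (coords n) \<in> V_points B n"
  by (auto simp: V_points_def)

lemma V_act_red:
  assumes G: "G \<in> carrier_mat n n" "det G = 1" and H: "H \<in> carrier_mat n n" "G * H = 1\<^sub>m n" "H * G = 1\<^sub>m n"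
  shows "V_act B n (red n G) (restrict (\<lambda>x. h (w x)) (coords n)) =
         restrict (\<lambda>x. h (act n G H w x)) (coords n)"
proof
  fix x
  show "V_act B n (red n G) (restrict (\<lambda>x. h (w x)) (coords n)) x = restrict (\<lambda>x. h (act n G H w x)) (coords n) x"
  proof (cases "x \<in> coords n")
    case True
    show ?thesis
    proof (cases x)
      case (Vec i j)
      have ij: "j < n" "\<And>l. l < n \<Longrightarrow> Vec i l \<in> coords n" using True by (auto simp: Vec coords_def)
      show ?thesis using True unfolding V_act_def Vec
        by (simp add: act_def h_sum h_simps) (intro BB.finsum_cong', use ij in \<open>auto simp: red_def\<close>)
    next
      case (Covec i j)
      have ij: "j < n" "\<And>l. l < n \<Longrightarrow> Covec i l \<in> coords n" using True by (auto simp: Covec coords_def)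
      show ?thesis using True unfolding V_act_def Covec inv_red[OF G H]
        by (simp add: act_def h_sum h_simps) (intro BB.finsum_cong', use ij in \<open>auto simp: red_def\<close>)
    qed
  qed (simp add: V_act_def)
qed

end

section \<open>Homomorphisms from polynomial algebras\<close>

lemma alg_hom_scal:
  assumes A: "algebra complex_alg A" and f: "f \<in> alg_hom (poly_alg S) A"
  shows "f (scal c) = c \<odot>\<^bsub>A\<^esub> \<one>\<^bsub>A\<^esub>"
  using alg_homD(5,6)[OF f, unfolded poly_alg_simps] poly_alg_one_closed[of S] alg_homD(6)[OF f, of 1 c]
  by (simp add: poly_alg_simps scal_mpoly)

lemma poly_hom_eqI:
  assumes A: "algebra complex_alg A" and f: "f \<in> alg_hom (poly_alg S) A" and g: "g \<in> alg_hom (poly_alg S) A"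
    and eq: "\<And>x. x \<in> S \<Longrightarrow> f (poly_var x) = g (poly_var x)" and p: "p \<in> carrier (poly_alg S)"
  shows "f p = g p"
proof -
  note fD = alg_homD[OF f, unfolded poly_alg_simps]
  note gD = alg_homD[OF g, unfolded poly_alg_simps]
  have "p \<in> carrier (poly_alg S) \<and> f p = g p"
    using p by (induction p rule: poly_alg_induct)
      (auto simp: poly_alg_closed alg_hom_scal[OF A f] alg_hom_scal[OF A g] eq fD gD)
  thus ?thesis ..
qed

lemma alg_hom_comp:
  "f \<in> alg_hom A B \<Longrightarrow> g \<in> alg_hom B C \<Longrightarrow> (\<lambda>x. g (f x)) \<in> alg_hom A C"
  by (auto simp: alg_hom_def Ring.ring_hom_def Pi_iff)

lemma poly_eval_hom_image:
  assumes B: "algebra complex_alg B" and h: "h \<in> alg_hom class_alg B" and p: "p \<in> carrier (poly_alg S)"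
    and v: "\<And>x. x \<in> S \<Longrightarrow> v x = h (w x)"
  shows "poly_eval B v p = h (peval w p)"
proof -
  have c: "h y \<in> carrier B" for y by (rule alg_homD(2)[OF h class_alg_UNIV])
  have "poly_eval B v \<in> alg_hom (poly_alg S) B" by (rule poly_eval_hom[OF B]) (simp add: v c)
  from poly_hom_eqI[OF B this alg_hom_comp[OF peval_hom h] _ p] show ?thesis
    using v c poly_eval_var[OF B, of S v] by simp
qed

section \<open>Truncation of power series\<close>

definition trunc :: "enat \<Rightarrow> complex fps \<Rightarrow> nat \<Rightarrow> complex" where
  "trunc m f k = (if enat k \<le> m then f $ k else 0)"

lemma complex_alg_simps:
  "carrier complex_alg = UNIV" "x \<otimes>\<^bsub>complex_alg\<^esub> y = x * y" "x \<oplus>\<^bsub>complex_alg\<^esub> y = x + y"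
  "\<one>\<^bsub>complex_alg\<^esub> = 1" "\<zero>\<^bsub>complex_alg\<^esub> = 0" "c \<odot>\<^bsub>complex_alg\<^esub> x = c * x" "finsum complex_alg g A = sum g A"
  by (simp_all add: complex_alg_eq_class_alg class_alg_simps class_alg_finsum scal_complex_def)

lemma enat_le_trans: "i \<le> k \<Longrightarrow> enat k \<le> m \<Longrightarrow> enat i \<le> m"
  by (meson enat_ord_simps(1) order_trans)

lemma trunc_mult: "trunc m (f * g) = trunc m f \<otimes>\<^bsub>jet_ring m complex_alg\<^esub> trunc m g"
proof
  fix k
  have "(\<Sum>i=0..k. f $ i * g $ (k - i)) = (\<Sum>i\<le>k. trunc m f i * trunc m g (k - i))" if "enat k \<le> m"
    unfolding atLeast0AtMost
    by (intro sum.cong refl) (use that in \<open>auto simp: trunc_def intro: enat_le_trans[of _ k]\<close>)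
  thus "trunc m (f * g) k = (trunc m f \<otimes>\<^bsub>jet_ring m complex_alg\<^esub> trunc m g) k"
    by (simp add: trunc_def[of m "f * g"] fps_mult_nth jet_ring_simps complex_alg_simps)
qed

lemma trunc_hom: "trunc m \<in> alg_hom class_alg (jet_ring m complex_alg)"
  unfolding alg_hom_def
proof (intro CollectI conjI ring_hom_memI allI ballI)
  show "trunc m \<one>\<^bsub>class_alg\<^esub> = \<one>\<^bsub>jet_ring m complex_alg\<^esub>"
    by (auto simp: class_alg_simps fun_eq_iff jet_ring_simps complex_alg_simps trunc_def zero_enat_def[symmetric])
  fix f g :: "complex fps" and c
  show "trunc m f \<in> carrier (jet_ring m complex_alg)"
    by (auto simp: jet_ring_simps complex_alg_simps trunc_def not_le[symmetric])
  show "trunc m (f \<otimes>\<^bsub>class_alg\<^esub> g) = trunc m f \<otimes>\<^bsub>jet_ring m complex_alg\<^esub> trunc m g"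
    by (simp add: class_alg_simps trunc_mult)
  show "trunc m (f \<oplus>\<^bsub>class_alg\<^esub> g) = trunc m f \<oplus>\<^bsub>jet_ring m complex_alg\<^esub> trunc m g"
    by (auto simp: class_alg_simps fun_eq_iff jet_ring_simps complex_alg_simps trunc_def)
  show "trunc m (c \<odot>\<^bsub>class_alg\<^esub> f) = c \<odot>\<^bsub>jet_ring m complex_alg\<^esub> trunc m f"
    by (auto simp: class_alg_simps fun_eq_iff jet_ring_simps complex_alg_simps trunc_def scal_fps_def scal_complex_def)
qed

lemma fps_image_trunc: "fps_image (jet_ring m complex_alg) (trunc m)"
proof (rule fps_image.intro)
  show "algebra complex_alg (jet_ring m complex_alg)" by (rule algebra_jet_ring[OF algebra_complex_alg])
  show "trunc m \<in> alg_hom class_alg (jet_ring m complex_alg)" by (rule trunc_hom)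
  have "f = trunc m (Abs_fps f)" if "f \<in> carrier (jet_ring m complex_alg)" for f
    using that by (auto simp: trunc_def jet_ring_def fun_eq_iff complex_alg_simps not_le)
  thus "trunc m ` UNIV = carrier (jet_ring m complex_alg)"
    using alg_homD(2)[OF trunc_hom class_alg_UNIV] by blast
next
  fix f assume "trunc m f = \<one>\<^bsub>jet_ring m complex_alg\<^esub>"
  hence "trunc m f 0 = 1" by (simp add: jet_ring_def complex_alg_simps)
  thus "f $ 0 \<noteq> 0" by (simp add: trunc_def zero_enat_def[symmetric])
qed

lemma fps_image_nth0: "fps_image complex_alg (\<lambda>f. f $ 0)"
proof (rule fps_image.intro)
  show "(\<lambda>f. f $ 0) \<in> alg_hom class_alg complex_alg"
    by (auto simp: alg_hom_def Ring.ring_hom_def class_alg_simps complex_alg_simps scal_fps_def scal_complex_def)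
  show "(\<lambda>f. f $ 0) ` UNIV = carrier complex_alg"
    by (auto simp: complex_alg_simps intro: range_eqI[of _ _ "fps_const _"])
qed (auto simp: algebra_complex_alg complex_alg_simps)

definition SL_pair :: "nat \<Rightarrow> complex fps mat \<Rightarrow> complex fps mat \<Rightarrow> bool" where
  "SL_pair n G H \<longleftrightarrow> G \<in> carrier_mat n n \<and> H \<in> carrier_mat n n \<and> det G = 1 \<and> G * H = 1\<^sub>m n \<and> H * G = 1\<^sub>m n"

text \<open>Invariance under SL_n(C) is tested by matrices over C[[t]] at t = 0. In this form the
  order 0 case of \<open>invariant_generated\<close> applies to O(Z).\<close>

lemma O_Z_iff:
  assumes n: "n > 0"
  shows "f \<in> carrier (O_Z n) \<longleftrightarrow> f \<in> carrier (O_V n) \<and>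
    (\<forall>G H w. SL_pair n G H \<longrightarrow> peval (act n G H w) f $ 0 = peval w f $ 0)"
proof -
  interpret fps_image complex_alg "\<lambda>f. f $ 0" by (rule fps_image_nth0)
  have ev: "poly_eval complex_alg (restrict (\<lambda>x. w x $ 0) (coords n)) f = peval w f $ 0"
    if "f \<in> carrier (O_V n)" for w f
    by (rule poly_eval_hom_image[OF algebra_complex_alg hom that]) simp
  have "(\<forall>g \<in> carrier (SL complex_alg n). \<forall>v \<in> V_points complex_alg n.
          poly_eval complex_alg (V_act complex_alg n g v) f = poly_eval complex_alg v f) \<longleftrightarrow>
        (\<forall>G H w. SL_pair n G H \<longrightarrow> peval (act n G H w) f $ 0 = peval w f $ 0)"
    if f: "f \<in> carrier (O_V n)"
  proof (intro iffI ballI allI impI)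
    fix G H w
    assume *: "\<forall>g \<in> carrier (SL complex_alg n). \<forall>v \<in> V_points complex_alg n.
          poly_eval complex_alg (V_act complex_alg n g v) f = poly_eval complex_alg v f" and GH: "SL_pair n G H"
    have "poly_eval complex_alg (V_act complex_alg n (red n G) (restrict (\<lambda>x. w x $ 0) (coords n))) f =
        poly_eval complex_alg (restrict (\<lambda>x. w x $ 0) (coords n)) f"
      using * GH red_SL V_points_restrict unfolding SL_pair_def by blast
    thus "peval (act n G H w) f $ 0 = peval w f $ 0"
      using GH V_act_red[of G n H w] by (simp add: ev[OF f] SL_pair_def)
  next
    fix g v
    assume *: "\<forall>G H w. SL_pair n G H \<longrightarrow> peval (act n G H w) f $ 0 = peval w f $ 0"
      and g: "g \<in> carrier (SL complex_alg n)" and v: "v \<in> V_points complex_alg n"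
    obtain w where w: "v = restrict (\<lambda>x. w x $ 0) (coords n)" using V_points_lift[OF v] by blast
    obtain G H where GH: "SL_pair n G H" "g = red n G" using SL_lift[OF n g] by (auto simp: SL_pair_def)
    show "poly_eval complex_alg (V_act complex_alg n g v) f = poly_eval complex_alg v f"
      using GH * V_act_red[of G n H w] by (simp add: w ev[OF f] SL_pair_def)
  qed
  thus ?thesis by (auto simp: O_Z_def)
qed

section \<open>Values of functions on jet schemes\<close>

lemma jet_lift_cong:
  assumes R: "algebra complex_alg R" and A: "algebra complex_alg A"
    and \<phi>: "\<phi> \<in> alg_hom R (jet_ring m A)" and \<phi>': "\<phi>' \<in> alg_hom R (jet_ring m A)"
    and eq: "\<And>r. r \<in> carrier R \<Longrightarrow> \<phi> r = \<phi>' r" and F: "F \<in> carrier (jet_alg m R)"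
  shows "jet_lift A \<phi> F = jet_lift A \<phi>' F"
  by (rule jet_alg_universal(3)[OF R A \<phi>' jet_alg_universal(1)[OF R A \<phi>] _ F])
     (simp add: jet_alg_universal(2)[OF R A \<phi>] eq)

definition jv :: "enat \<Rightarrow> (coord \<Rightarrow> complex fps) \<Rightarrow> (coord mpoly \<times> nat) mpoly set \<Rightarrow> complex" where
  "jv m w = jet_lift complex_alg (\<lambda>f. trunc m (peval w f))"

lemma trunc_peval_hom: "(\<lambda>f. trunc m (peval w f)) \<in> alg_hom (poly_alg S) (jet_ring m complex_alg)"
  by (rule alg_hom_comp[OF peval_hom trunc_hom])

lemma jv_hom: "jv m w \<in> alg_hom (jet_alg m (O_V n)) complex_alg"
  unfolding jv_def by (rule jet_alg_universal(1)[OF algebra_poly_alg algebra_complex_alg trunc_peval_hom])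

lemma jv_univ: "f \<in> carrier (O_V n) \<Longrightarrow> jv m w (jet_univ m (O_V n) f k) = trunc m (peval w f) k"
  unfolding jv_def by (rule jet_alg_universal(2)[OF algebra_poly_alg algebra_complex_alg trunc_peval_hom])

lemma jet_value_restrict:
  assumes "F \<in> carrier (jet_alg m (O_V n))"
  shows "jet_value m (restrict (\<lambda>x. trunc m (w x)) (coords n)) F = jv m w F"
proof -
  let ?v = "restrict (\<lambda>x. trunc m (w x)) (coords n)"
  note J = algebra_jet_ring[OF algebra_complex_alg, of m]
  have e: "poly_eval (jet_ring m complex_alg) ?v f = trunc m (peval w f)" if "f \<in> carrier (O_V n)" for f
    by (rule poly_eval_hom_image[OF J trunc_hom that]) simp
  have h: "poly_eval (jet_ring m complex_alg) ?v \<in> alg_hom (O_V n) (jet_ring m complex_alg)"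
    by (rule poly_eval_hom[OF J]) (use alg_homD(2)[OF trunc_hom class_alg_UNIV] in auto)
  show ?thesis unfolding jet_value_def jv_def
    by (rule jet_lift_cong[OF algebra_poly_alg algebra_complex_alg h trunc_peval_hom e assms])
qed

text \<open>The same translation for jets: after lifting the points of SL_n and V to C[[t]], the
  order enters only through \<open>jv\<close>.\<close>

lemma O_Vm_inv_iff:
  assumes n: "n > 0"
  shows "F \<in> carrier (O_Vm_inv m n) \<longleftrightarrow> F \<in> carrier (jet_alg m (O_V n)) \<and>
    (\<forall>G H w. SL_pair n G H \<longrightarrow> jv m (act n G H w) F = jv m w F)"
proof -
  interpret fps_image "jet_ring m complex_alg" "trunc m" by (rule fps_image_trunc)
  let ?B = "jet_ring m complex_alg"
  have "(\<forall>g \<in> carrier (SL ?B n). \<forall>v \<in> V_points ?B n. jet_value m (V_act ?B n g v) F = jet_value m v F) \<longleftrightarrow>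
        (\<forall>G H w. SL_pair n G H \<longrightarrow> jv m (act n G H w) F = jv m w F)"
    if F: "F \<in> carrier (jet_alg m (O_V n))"
  proof (intro iffI ballI allI impI)
    fix G H w
    assume *: "\<forall>g \<in> carrier (SL ?B n). \<forall>v \<in> V_points ?B n. jet_value m (V_act ?B n g v) F = jet_value m v F"
      and GH: "SL_pair n G H"
    have "jet_value m (V_act ?B n (red n G) (restrict (\<lambda>x. trunc m (w x)) (coords n))) F =
        jet_value m (restrict (\<lambda>x. trunc m (w x)) (coords n)) F"
      using * GH red_SL V_points_restrict unfolding SL_pair_def by blast
    thus "jv m (act n G H w) F = jv m w F"
      using GH V_act_red[of G n H w] by (simp add: jet_value_restrict[OF F] SL_pair_def)
  next
    fix g v
    assume *: "\<forall>G H w. SL_pair n G H \<longrightarrow> jv m (act n G H w) F = jv m w F"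
      and g: "g \<in> carrier (SL ?B n)" and v: "v \<in> V_points ?B n"
    obtain w where w: "v = restrict (\<lambda>x. trunc m (w x)) (coords n)" using V_points_lift[OF v] by blast
    obtain G H where GH: "SL_pair n G H" "g = red n G" using SL_lift[OF n g] by (auto simp: SL_pair_def)
    show "jet_value m (V_act ?B n g v) F = jet_value m v F"
      using GH * V_act_red[of G n H w] by (simp add: w jet_value_restrict[OF F] SL_pair_def)
  qed
  thus ?thesis by (auto simp: O_Vm_inv_def)
qed

section \<open>Generators of jet algebras\<close>

lemma jet_univ_closed:
  assumes "algebra complex_alg R" "r \<in> carrier R"
  shows "jet_univ m R r k \<in> carrier (jet_alg m R)"
  using alg_homD(2)[OF jet_univ_hom[OF assms(1), of m] assms(2)] by (simp add: jet_ring_simps)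

context
  fixes R :: "(complex, 'a) module" and m :: enat and X' :: "'x set" and q :: "'x mpoly \<Rightarrow> 'a"
  assumes R: "algebra complex_alg R" and q: "q \<in> alg_hom (poly_alg X') R"
begin

definition jet_gen :: "('x \<times> nat) mpoly \<Rightarrow> ('a \<times> nat) mpoly set" where
  "jet_gen = poly_eval (jet_alg m R) (\<lambda>(x, k). jet_univ m R (q (poly_var x)) k)"

interpretation J: cring "jet_alg m R" by (rule algebra.M_cring[OF algebra_jet_alg[OF R]])

lemma q_var_closed: "x \<in> X' \<Longrightarrow> q (poly_var x) \<in> carrier R"
  by (rule alg_homD(2)[OF q poly_var_closed])

lemma jet_gen_hom: "jet_gen \<in> alg_hom (poly_alg (X' \<times> {k. enat k \<le> m})) (jet_alg m R)"
  unfolding jet_gen_def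
  by (rule poly_eval_hom[OF algebra_jet_alg[OF R]]) (auto intro: jet_univ_closed[OF R] q_var_closed)

lemma jet_gen_var: "x \<in> X' \<Longrightarrow> enat k \<le> m \<Longrightarrow> jet_gen (poly_var (x, k)) = jet_univ m R (q (poly_var x)) k"
  unfolding jet_gen_def
  by (subst poly_eval_var[OF algebra_jet_alg[OF R], of "X' \<times> {k. enat k \<le> m}"])
     (auto intro: jet_univ_closed[OF R] q_var_closed)

text \<open>The universal jet is a homomorphism, so the jet coefficients of a polynomial in the
  generators are polynomials in the jet coefficients of the generators.\<close>

lemma jet_gen_surj:
  assumes surj: "q ` carrier (poly_alg X') = carrier R"
  shows "jet_gen ` carrier (poly_alg (X' \<times> {k. enat k \<le> m})) = carrier (jet_alg m R)"
proof -
  let ?S = "carrier (poly_alg (X' \<times> {k. enat k \<le> m}))"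
  let ?I = "jet_gen ` ?S"
  note hD = alg_homD[OF jet_gen_hom, unfolded poly_alg_simps]
  note AJ = algebra_jet_alg[OF R, of m]
  have sub: "?I \<subseteq> carrier (jet_alg m R)" using hD(2) by blast
  have Iadd: "a \<oplus>\<^bsub>jet_alg m R\<^esub> b \<in> ?I" and Imult: "a \<otimes>\<^bsub>jet_alg m R\<^esub> b \<in> ?I" if ab: "a \<in> ?I" "b \<in> ?I" for a b
  proof -
    obtain p p' where p: "p \<in> ?S" "p' \<in> ?S" "a = jet_gen p" "b = jet_gen p'" using ab by blast
    show "a \<oplus>\<^bsub>jet_alg m R\<^esub> b \<in> ?I"
      unfolding p(3,4) hD(4)[OF p(1,2), symmetric] by (intro imageI poly_alg_add_closed p)
    show "a \<otimes>\<^bsub>jet_alg m R\<^esub> b \<in> ?I"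
      unfolding p(3,4) hD(3)[OF p(1,2), symmetric] by (intro imageI poly_alg_mult_closed p)
  qed
  have const: "c \<odot>\<^bsub>jet_alg m R\<^esub> \<one>\<^bsub>jet_alg m R\<^esub> \<in> ?I" for c
    by (rule image_eqI[of _ _ "scal c"]) (simp_all add: alg_hom_scal[OF AJ jet_gen_hom] poly_alg_closed)
  have zero: "\<zero>\<^bsub>jet_alg m R\<^esub> \<in> ?I"
  proof (rule image_eqI[of _ _ 0])
    interpret H: ring_hom_cring "poly_alg (X' \<times> {k. enat k \<le> m})" "jet_alg m R" jet_gen
      by (intro ring_hom_cring.intro ring_hom_cring_axioms.intro cring_poly_alg J.cring_axioms alg_homD(1)[OF jet_gen_hom])
    show "\<zero>\<^bsub>jet_alg m R\<^esub> = jet_gen 0" using H.hom_zero by (simp add: poly_alg_simps)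
  qed (simp add: poly_alg_closed)
  have fsum: "(\<Oplus>\<^bsub>jet_alg m R\<^esub>i\<in>{..k}. f i) \<in> ?I" if "\<And>i. i \<le> (k::nat) \<Longrightarrow> f i \<in> ?I" for f k
    using that
  proof (induction k)
    case 0
    thus ?case using sub by (simp add: subset_iff)
  next
    case (Suc k)
    have "(\<Oplus>\<^bsub>jet_alg m R\<^esub>i\<in>{..Suc k}. f i) = f (Suc k) \<oplus>\<^bsub>jet_alg m R\<^esub> (\<Oplus>\<^bsub>jet_alg m R\<^esub>i\<in>{..k}. f i)"
      by (rule J.finsum_Suc) (use Suc.prems sub in blast)
    also have "\<dots> \<in> ?I" by (intro Iadd Suc) auto
    finally show ?case .
  qed
  note uD = alg_homD[OF jet_univ_hom[OF R, of m]]
  note qD = alg_homD[OF q, unfolded poly_alg_simps]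
  \<comment> \<open>The induction rule provides no membership for the parts of a sum or product,
    hence the conjunction.\<close>
  have u: "p \<in> carrier (poly_alg X') \<and> (\<forall>k. jet_univ m R (q p) k \<in> ?I)" if "p \<in> carrier (poly_alg X')" for p
    using that
  proof (induction p rule: poly_alg_induct)
    case (scal c)
    interpret RR: cring R by (rule algebra.M_cring[OF R])
    interpret AM: module complex_alg "jet_alg m R" using AJ by (simp add: algebra_def)
    have "jet_univ m R (q (scal c)) k = c \<odot>\<^bsub>jet_alg m R\<^esub> (if k = 0 then \<one>\<^bsub>jet_alg m R\<^esub> else \<zero>\<^bsub>jet_alg m R\<^esub>)" for k
      by (simp add: alg_hom_scal[OF R q] uD(5,6) jet_ring_simps)
    moreover have "c \<odot>\<^bsub>jet_alg m R\<^esub> \<zero>\<^bsub>jet_alg m R\<^esub> = \<zero>\<^bsub>jet_alg m R\<^esub>"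
      using AM.smult_r_null[of c] by (simp add: complex_alg_simps)
    ultimately show ?case using const zero by (auto simp: poly_alg_closed)
  next
    case (var x)
    have "jet_univ m R (q (poly_var x)) k \<in> ?I" for k
    proof (cases "enat k \<le> m")
      case True
      thus ?thesis using jet_gen_var[OF var True]
        by (intro image_eqI[of _ _ "poly_var (x, k)"]) (auto intro!: poly_var_closed simp: var)
    qed (simp add: jet_univ_gt[OF R] zero)
    thus ?case using var by (simp add: poly_var_closed)
  next
    case (add p p')
    have "jet_univ m R (q (p + p')) k = jet_univ m R (q p) k \<oplus>\<^bsub>jet_alg m R\<^esub> jet_univ m R (q p') k" for k
      using add by (simp only: qD(2,4) uD(4) jet_ring_simps)
    moreover have "jet_univ m R (q p) k \<oplus>\<^bsub>jet_alg m R\<^esub> jet_univ m R (q p') k \<in> ?I" for k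
      by (intro Iadd spec[OF conjunct2[OF add(1)]] spec[OF conjunct2[OF add(2)]])
    ultimately have "jet_univ m R (q (p + p')) k \<in> ?I" for k by (simp only:)
    thus ?case by (intro conjI allI poly_alg_add_closed conjunct1[OF add(1)] conjunct1[OF add(2)])
  next
    case (mult p p')
    have "jet_univ m R (q (p * p')) k \<in> ?I" for k
    proof -
      have "jet_univ m R (q (p * p')) k = (if enat k \<le> m then
        \<Oplus>\<^bsub>jet_alg m R\<^esub>i\<in>{..k}. jet_univ m R (q p) i \<otimes>\<^bsub>jet_alg m R\<^esub> jet_univ m R (q p') (k - i)
        else \<zero>\<^bsub>jet_alg m R\<^esub>)"
        using mult by (simp only: qD(2,3) uD(3) jet_ring_simps)
      also have "\<dots> \<in> ?I"
      proof (cases "enat k \<le> m")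
        case True
        have "(\<Oplus>\<^bsub>jet_alg m R\<^esub>i\<in>{..k}. jet_univ m R (q p) i \<otimes>\<^bsub>jet_alg m R\<^esub> jet_univ m R (q p') (k - i)) \<in> ?I"
          by (intro fsum Imult spec[OF conjunct2[OF mult(1)]] spec[OF conjunct2[OF mult(2)]])
        thus ?thesis by (simp only: True if_True)
      next
        case False
        thus ?thesis using zero by (simp only: if_False)
      qed
      finally show ?thesis .
    qed
    thus ?case by (intro conjI allI poly_alg_mult_closed conjunct1[OF mult(1)] conjunct1[OF mult(2)])
  qed
  have univ: "jet_univ m R r k \<in> ?I" if "r \<in> carrier R" for r k
  proof -
    have "r \<in> q ` carrier (poly_alg X')" unfolding surj by (rule that)
    then obtain p where p: "r = q p" "p \<in> carrier (poly_alg X')" by (rule imageE)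
    show ?thesis unfolding p(1) by (rule spec[OF conjunct2[OF u[OF p(2)]]])
  qed
  have "jet_ideal m R +>\<^bsub>poly_alg (jet_symbols m R)\<^esub> p \<in> ?I" (is "?q p \<in> _")
    if "p \<in> carrier (poly_alg (jet_symbols m R))" for p
  proof -
    note jD = alg_homD[OF jq(1)[OF R], unfolded poly_alg_simps]
    have "p \<in> carrier (poly_alg (jet_symbols m R)) \<and> ?q p \<in> ?I" using that
    proof (induction p rule: poly_alg_induct)
      case (scal c)
      show ?case using const alg_hom_scal[OF AJ jq(1)[OF R]] by (simp add: poly_alg_closed)
    next
      case (var x)
      then obtain r k where x: "x = (r, k)" "r \<in> carrier R" "enat k \<le> m" by (auto simp: jet_symbols_def)
      show ?case using univ[OF x(2), of k] jet_univ_le[OF R x(3), of r] var x(1) by (simp add: poly_var_closed)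
    next
      case (add p p')
      have "?q (p + p') = ?q p \<oplus>\<^bsub>jet_alg m R\<^esub> ?q p'"
        by (rule jD(4)[OF conjunct1[OF add(1)] conjunct1[OF add(2)]])
      also have "\<dots> \<in> ?I" by (rule Iadd[OF conjunct2[OF add(1)] conjunct2[OF add(2)]])
      finally show ?case by (intro conjI poly_alg_add_closed conjunct1[OF add(1)] conjunct1[OF add(2)])
    next
      case (mult p p')
      have "?q (p * p') = ?q p \<otimes>\<^bsub>jet_alg m R\<^esub> ?q p'"
        by (rule jD(3)[OF conjunct1[OF mult(1)] conjunct1[OF mult(2)]])
      also have "\<dots> \<in> ?I" by (rule Imult[OF conjunct2[OF mult(1)] conjunct2[OF mult(2)]])
      finally show ?case by (intro conjI poly_alg_mult_closed conjunct1[OF mult(1)] conjunct1[OF mult(2)])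
    qed
    thus ?thesis ..
  qed
  hence "carrier (jet_alg m R) \<subseteq> ?I" unfolding jq(2)[OF R] by (rule image_subsetI)
  with sub show ?thesis by (rule equalityI)
qed

end

section \<open>The coordinate ring of the quotient\<close>

definition gpoly :: "nat \<Rightarrow> gvar \<Rightarrow> coord mpoly" where
  "gpoly n = gen n poly_var"

lemma peval_gpoly: "peval w (gpoly n z) = gen n w z"
  unfolding gpoly_def using gen_hom[OF peval.comm_ring_hom_axioms, of w n poly_var z] by simp

lemma det_closed:
  assumes "M \<in> carrier_mat n n" "\<And>i j. i < n \<Longrightarrow> j < n \<Longrightarrow> M $$ (i, j) \<in> carrier (poly_alg S)"
  shows "det M \<in> carrier (poly_alg S)"
  unfolding det_def'[OF assms(1)]
proof (intro poly_alg_sum_closed poly_alg_mult_closed poly_alg_prod_closed)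
  fix p i assume "p \<in> {p. p permutes {0..<n}}" "i \<in> {0..<n}"
  thus "M $$ (i, p i) \<in> carrier (poly_alg S)" using permutes_in_image[of p "{0..<n}" i] assms(2) by auto
qed (auto simp: sign_def intro: poly_alg_closed)

lemma gpoly_closed:
  assumes "z \<in> gvars n"
  shows "gpoly n z \<in> carrier (O_V n)"
proof (cases z)
  case (GM j i)
  thus ?thesis using assms
    by (auto simp: gpoly_def gen_def gvars_def coords_def intro!: poly_alg_sum_closed poly_alg_mult_closed poly_var_closed)
next
  case (GD i)
  have "det (minor_mat n poly_var i) \<in> carrier (O_V n)"
    by (rule det_closed[OF minor_mat_carrier])
       (use assms in \<open>auto simp: GD minor_mat_def gvars_def coords_def ins_def intro!: poly_var_closed\<close>)
  moreover have "(- 1) ^ i \<in> carrier (O_V n)" by (intro poly_alg_closed)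
  ultimately show ?thesis by (simp add: GD gpoly_def gen_def poly_alg_mult_closed)
qed

lemma gen_act_pair: "SL_pair n G H \<Longrightarrow> gen n (act n G H w) z = gen n w z"
  unfolding SL_pair_def by (intro gen_act) auto

lemma peval_gpoly_hom:
  assumes n: "n > 0"
  shows "peval (gpoly n) \<in> alg_hom (poly_alg (gvars n)) (O_Z n)"
proof -
  have mem: "peval (gpoly n) p \<in> carrier (O_Z n)" if p: "p \<in> carrier (poly_alg (gvars n))" for p
    unfolding O_Z_iff[OF n]
    by (intro conjI allI impI peval_closed[OF p gpoly_closed])
       (simp_all add: peval_peval peval_gpoly gen_act_pair)
  note h = alg_homD[OF peval_hom[of "gpoly n" "gvars n"]]
  show ?thesis
    unfolding alg_hom_def
    by (intro CollectI conjI ring_hom_memI allI ballI mem)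
       (auto simp: O_Z_def poly_alg_simps scal_mpoly[symmetric])
qed

lemma comm_ring_hom_nth0: "comm_ring_hom (\<lambda>f :: complex fps. f $ 0)"
  by unfold_locales auto

lemma peval_nth0:
  fixes w :: "'x \<Rightarrow> complex fps"
  shows "peval w p $ 0 = peval (\<lambda>x. w x $ 0) p"
  using hom_peval[OF comm_ring_hom_nth0, of w p] by (simp add: scal_fps_def scal_complex_def)

text \<open>The first fundamental theorem for this representation, as the order 0 case:
  \<open>s\<close> is \<open>f\<close> with its variables placed in order 0.\<close>

lemma peval_gpoly_surj:
  assumes n: "2 \<le> n"
  shows "peval (gpoly n) ` carrier (poly_alg (gvars n)) = carrier (O_Z n)"
proof (intro equalityI subsetI)
  have n0: "n > 0" using n by simp
  interpret jets n 0 by unfold_locales (rule n)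
  fix f assume f: "f \<in> carrier (O_Z n)"
  define s where "s = peval (\<lambda>x. poly_var (x, 0 :: nat)) f"
  have fV: "f \<in> carrier (O_V n)" using f O_Z_iff[OF n0] by blast
  have s: "s \<in> carrier (poly_alg (coords n \<times> {..0}))"
    unfolding s_def by (rule peval_closed[OF fV]) (auto intro: poly_var_closed)
  have se: "peval (coeffs_at w) s = peval w f $ 0" for w :: "coord \<Rightarrow> complex fps"
    by (simp add: s_def peval_peval coeffs_at_def peval_nth0)
  have "invariant s" unfolding invariant_def se
    using f unfolding O_Z_iff[OF n0] SL_pair_def by blast
  from invariant_generated[OF s this] obtain p where
    p: "p \<in> carrier (poly_alg Vars)" "\<And>w. peval (coeffs_at w) s = peval (coeffs_at (gen n w)) p" by blast
  define p0 where "p0 = peval (\<lambda>(z, k :: nat). poly_var z) p"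
  have p0: "p0 \<in> carrier (poly_alg (gvars n))"
    unfolding p0_def by (rule peval_closed[OF p(1)]) (auto simp: Vars_def intro: poly_var_closed)
  have "f - peval (gpoly n) p0 = 0"
  proof (rule peval_eq_0_imp_eq_0)
    fix a :: "coord \<Rightarrow> complex"
    let ?w = "\<lambda>x. fps_const (a x)"
    have "gen n ?w z $ 0 = gen n a z" for z
      using gen_hom[OF comm_ring_hom_nth0, of n ?w z] by simp
    hence "peval (coeffs_at (gen n ?w)) p = peval (\<lambda>(z, k). gen n a z) p"
      by (intro peval_cong[OF p(1)]) (auto simp: Vars_def coeffs_at_def)
    also have "\<dots> = peval a (peval (gpoly n) p0)"
      by (simp add: p0_def peval_peval peval_gpoly case_prod_unfold)
    finally show "peval a (f - peval (gpoly n) p0) = 0"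
      using p(2)[of ?w] se[of ?w] by (simp add: peval_nth0)
  qed
  hence "f = peval (gpoly n) p0" by simp
  thus "f \<in> peval (gpoly n) ` carrier (poly_alg (gvars n))" using p0 by blast
next
  fix f assume "f \<in> peval (gpoly n) ` carrier (poly_alg (gvars n))"
  thus "f \<in> carrier (O_Z n)" using alg_homD(2)[OF peval_gpoly_hom[of n]] n by auto
qed

section \<open>The comorphism of the map of jet schemes\<close>

text \<open>Reduces arcs to jets of finite order.\<close>

lemma poly_alg_finite_level:
  assumes "p \<in> carrier (poly_alg (S \<times> {k. enat k \<le> m}))"
  shows "\<exists>M. enat M \<le> m \<and> p \<in> carrier (poly_alg (S \<times> {..M}))"
  using assms
proof (induction p rule: poly_alg_induct)
  case (scal c)
  show ?case by (intro exI[of _ 0]) (auto simp: poly_alg_closed zero_enat_def[symmetric])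
next
  case (var x)
  obtain z k where "x = (z, k)" by (cases x)
  thus ?case using var by (intro exI[of _ k]) (auto intro: poly_var_closed)
next
  case (add p q)
  then obtain M N where "enat M \<le> m" "p \<in> carrier (poly_alg (S \<times> {..M}))" "enat N \<le> m" "q \<in> carrier (poly_alg (S \<times> {..N}))"
    by blast
  thus ?case
    by (intro exI[of _ "max M N"] conjI poly_alg_add_closed)
       (auto simp: max_def elim: poly_alg_mono)
next
  case (mult p q)
  then obtain M N where "enat M \<le> m" "p \<in> carrier (poly_alg (S \<times> {..M}))" "enat N \<le> m" "q \<in> carrier (poly_alg (S \<times> {..N}))"
    by blast
  thus ?case
    by (intro exI[of _ "max M N"] conjI poly_alg_mult_closed)
       (auto simp: max_def elim: poly_alg_mono)
qed

locale quotient_jets =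
  fixes n :: nat and m :: enat
  assumes n2: "2 \<le> n"
begin

lemma n0: "n > 0"
  using n2 by simp

abbreviation "AZ \<equiv> jet_alg m (O_Z n)"
abbreviation "AV \<equiv> jet_alg m (O_V n)"
abbreviation "PZ \<equiv> poly_alg (gvars n \<times> {k. enat k \<le> m})"
abbreviation "PV \<equiv> poly_alg (coords n \<times> {k. enat k \<le> m})"

lemma algZ: "algebra complex_alg AZ"
  by (rule algebra_jet_alg[OF algebra_O_Z])

lemma algV: "algebra complex_alg AV"
  by (rule algebra_jet_alg[OF algebra_poly_alg])

text \<open>\<open>\<psi>\<close> presents \<open>AZ\<close> by the jets of the generators, and its
  kernel has to be found. \<open>\<Psi>\<close> presents \<open>AV\<close> by the jets of the
  coordinates, where \<open>jv_\<Psi>\<close> excludes relations.\<close>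

definition \<psi> where "\<psi> = jet_gen (O_Z n) m (peval (gpoly n))"
definition \<Psi> where "\<Psi> = jet_gen (O_V n) m (\<lambda>p. p)"

lemma \<psi>_hom: "\<psi> \<in> alg_hom PZ AZ"
  unfolding \<psi>_def by (rule jet_gen_hom[OF algebra_O_Z peval_gpoly_hom[OF n0]])

lemma \<psi>_var: "z \<in> gvars n \<Longrightarrow> enat k \<le> m \<Longrightarrow> \<psi> (poly_var (z, k)) = jet_univ m (O_Z n) (gpoly n z) k"
  unfolding \<psi>_def by (subst jet_gen_var[OF algebra_O_Z peval_gpoly_hom[OF n0]]) auto

lemma \<psi>_surj: "\<psi> ` carrier PZ = carrier AZ"
  unfolding \<psi>_def by (rule jet_gen_surj[OF algebra_O_Z peval_gpoly_hom[OF n0] peval_gpoly_surj[OF n2]])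

lemma id_hom: "(\<lambda>p. p) \<in> alg_hom (O_V n) (O_V n)"
  by (auto simp: alg_hom_def Ring.ring_hom_def)

lemma \<Psi>_hom: "\<Psi> \<in> alg_hom PV AV"
  unfolding \<Psi>_def by (rule jet_gen_hom[OF algebra_poly_alg id_hom])

lemma \<Psi>_var: "x \<in> coords n \<Longrightarrow> enat k \<le> m \<Longrightarrow> \<Psi> (poly_var (x, k)) = jet_univ m (O_V n) (poly_var x) k"
  unfolding \<Psi>_def by (rule jet_gen_var[OF algebra_poly_alg id_hom])

lemma \<Psi>_surj: "\<Psi> ` carrier PV = carrier AV"
  unfolding \<Psi>_def by (rule jet_gen_surj[OF algebra_poly_alg id_hom]) simp

lemma peval_complex_hom: "peval v \<in> alg_hom (poly_alg S) complex_alg"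
  unfolding complex_alg_eq_class_alg by (rule peval_hom)

lemma jv_\<Psi>: "s \<in> carrier PV \<Longrightarrow> jv m w (\<Psi> s) = peval (coeffs_at w) s"
  by (rule poly_hom_eqI[OF algebra_complex_alg alg_hom_comp[OF \<Psi>_hom jv_hom] peval_complex_hom])
     (auto simp: \<Psi>_var jv_univ poly_var_closed trunc_def coeffs_at_def)

lemma O_Z_sub: "f \<in> carrier (O_Z n) \<Longrightarrow> f \<in> carrier (O_V n)"
  by (simp add: O_Z_def)

lemma jet_univ_O_Z_hom: "(\<lambda>f. jet_univ m (O_V n) f) \<in> alg_hom (O_Z n) (jet_ring m AV)"
  using jet_univ_hom[OF algebra_poly_alg, of m "coords n"]
  by (auto simp: alg_hom_def Ring.ring_hom_def O_Z_def Pi_iff)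

lemma pm_star_hom: "pm_star m n \<in> alg_hom AZ AV"
  unfolding pm_star_def jet_map_def
  by (rule jet_alg_universal(1)[OF algebra_O_Z algV jet_univ_O_Z_hom])

lemma pm_star_univ: "f \<in> carrier (O_Z n) \<Longrightarrow> pm_star m n (jet_univ m (O_Z n) f k) = jet_univ m (O_V n) f k"
  unfolding pm_star_def jet_map_def
  by (rule jet_alg_universal(2)[OF algebra_O_Z algV jet_univ_O_Z_hom])

lemma gpoly_O_Z: "z \<in> gvars n \<Longrightarrow> gpoly n z \<in> carrier (O_Z n)"
  using alg_homD(2)[OF peval_gpoly_hom[OF n0] poly_var_closed, of z] by simp

text \<open>Through \<open>\<psi>\<close> the comorphism becomes substitution of the jets of the
  generators for the variables.\<close>

lemma jv_pm_star: "p \<in> carrier PZ \<Longrightarrow> jv m w (pm_star m n (\<psi> p)) = peval (coeffs_at (gen n w)) p"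
  by (rule poly_hom_eqI[OF algebra_complex_alg
        alg_hom_comp[OF \<psi>_hom alg_hom_comp[OF pm_star_hom jv_hom]] peval_complex_hom])
     (auto simp: \<psi>_var jv_univ pm_star_univ gpoly_O_Z O_Z_sub peval_gpoly trunc_def coeffs_at_def)

lemma poly_eqI_jets:
  assumes "\<And>w. peval (coeffs_at w) s = peval (coeffs_at w) (s' :: ('z \<times> nat) mpoly)"
  shows "s = s'"
proof -
  have "s - s' = 0"
  proof (rule peval_eq_0_imp_eq_0)
    fix a :: "'z \<times> nat \<Rightarrow> complex"
    have "coeffs_at (\<lambda>x. Abs_fps (\<lambda>k. a (x, k))) = a" by (auto simp: coeffs_at_def)
    thus "peval a (s - s') = 0" using assms by (metis peval_minus right_minus_eq)
  qed
  thus ?thesis by simp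
qed

text \<open>The jets of an affine space form an affine space, whose functions are separated by
  complex points.\<close>

lemma AV_eqI:
  assumes "F \<in> carrier AV" "F' \<in> carrier AV" "\<And>w. jv m w F = jv m w F'"
  shows "F = F'"
proof -
  obtain s s' where s: "s \<in> carrier PV" "F = \<Psi> s" "s' \<in> carrier PV" "F' = \<Psi> s'"
    using assms(1,2) unfolding \<Psi>_surj[symmetric] by blast
  have "s = s'" by (rule poly_eqI_jets) (use assms(3) s in \<open>simp add: jv_\<Psi>\<close>)
  thus ?thesis by (simp add: s)
qed

interpretation AZ: cring AZ by (rule algebra.M_cring[OF algZ])

section \<open>The relations in the jet algebra of Z\<close>

lemma \<psi>_simps:
  "p \<in> carrier PZ \<Longrightarrow> q \<in> carrier PZ \<Longrightarrow> \<psi> (p + q) = \<psi> p \<oplus>\<^bsub>AZ\<^esub> \<psi> q"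
  "p \<in> carrier PZ \<Longrightarrow> q \<in> carrier PZ \<Longrightarrow> \<psi> (p * q) = \<psi> p \<otimes>\<^bsub>AZ\<^esub> \<psi> q"
  "p \<in> carrier PZ \<Longrightarrow> \<psi> p \<in> carrier AZ" "\<psi> 0 = \<zero>\<^bsub>AZ\<^esub>" "\<psi> 1 = \<one>\<^bsub>AZ\<^esub>"
proof -
  note h = alg_homD[OF \<psi>_hom, unfolded poly_alg_simps]
  show "p \<in> carrier PZ \<Longrightarrow> q \<in> carrier PZ \<Longrightarrow> \<psi> (p + q) = \<psi> p \<oplus>\<^bsub>AZ\<^esub> \<psi> q" by (rule h)
  show "p \<in> carrier PZ \<Longrightarrow> q \<in> carrier PZ \<Longrightarrow> \<psi> (p * q) = \<psi> p \<otimes>\<^bsub>AZ\<^esub> \<psi> q" by (rule h)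
  show c: "p \<in> carrier PZ \<Longrightarrow> \<psi> p \<in> carrier AZ" by (rule h)
  interpret H: ring_hom_cring PZ AZ \<psi>
    by (intro ring_hom_cring.intro ring_hom_cring_axioms.intro cring_poly_alg AZ.cring_axioms alg_homD(1)[OF \<psi>_hom])
  show "\<psi> 0 = \<zero>\<^bsub>AZ\<^esub>" using H.hom_zero by (simp add: poly_alg_simps)
  show "\<psi> 1 = \<one>\<^bsub>AZ\<^esub>" by (rule h)
qed

lemma \<psi>_product_jet:
  assumes z: "z \<in> gvars n" "z' \<in> gvars n" and k: "enat k \<le> m"
  shows "\<psi> (\<Sum>a\<le>k. poly_var (z, a) * poly_var (z', k - a)) = jet_univ m (O_Z n) (gpoly n z * gpoly n z') k"
proof -
  have v: "poly_var (y, a) \<in> carrier PZ" if "y \<in> gvars n" "a \<le> k" for y a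
    using that k by (intro poly_var_closed) (auto intro: enat_le_trans)
  have v': "poly_var (y, k - a) \<in> carrier PZ" if "y \<in> gvars n" for y a
    by (rule v[OF that]) simp
  have "\<psi> (\<Sum>a\<le>k. poly_var (z, a) * poly_var (z', k - a)) =
      (\<Oplus>\<^bsub>AZ\<^esub>a\<in>{..k}. \<psi> (poly_var (z, a) * poly_var (z', k - a)))"
    by (rule poly_hom_sum[OF algebra_O_Z algZ \<psi>_hom]) (intro poly_alg_mult_closed v v' z)
  also have "\<dots> = (\<Oplus>\<^bsub>AZ\<^esub>a\<in>{..k}. jet_univ m (O_Z n) (gpoly n z) a \<otimes>\<^bsub>AZ\<^esub> jet_univ m (O_Z n) (gpoly n z') (k - a))"
  proof (rule AZ.finsum_cong')
    fix a assume "a \<in> {..k}"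
    hence "enat a \<le> m" "enat (k - a) \<le> m" "a \<le> k" using k enat_le_trans[of "k - a" k] by (auto intro: enat_le_trans)
    thus "\<psi> (poly_var (z, a) * poly_var (z', k - a)) =
        jet_univ m (O_Z n) (gpoly n z) a \<otimes>\<^bsub>AZ\<^esub> jet_univ m (O_Z n) (gpoly n z') (k - a)"
      using z by (simp add: \<psi>_simps v v' \<psi>_var)
  qed (auto intro!: AZ.m_closed jet_univ_closed[OF algebra_O_Z] gpoly_O_Z z)
  also have "\<dots> = (jet_univ m (O_Z n) (gpoly n z) \<otimes>\<^bsub>jet_ring m AZ\<^esub> jet_univ m (O_Z n) (gpoly n z')) k"
    using k by (simp add: jet_ring_simps)
  also have "\<dots> = jet_univ m (O_Z n) (gpoly n z \<otimes>\<^bsub>O_Z n\<^esub> gpoly n z') k"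
    by (simp only: alg_homD(3)[OF jet_univ_hom[OF algebra_O_Z] gpoly_O_Z[OF z(1)] gpoly_O_Z[OF z(2)]])
  also have "gpoly n z \<otimes>\<^bsub>O_Z n\<^esub> gpoly n z' = gpoly n z * gpoly n z'" by (simp add: O_Z_def poly_alg_simps)
  finally show ?thesis .
qed

text \<open>This has to be shown inside \<open>AZ\<close>, where values at points do not yet decide
  equality. The universal jet is a homomorphism, and it sends the relation M d = 0 of O(Z) to 0 in
  every order.\<close>

lemma \<psi>_rel:
  assumes j: "j < n - 1" and k: "enat k \<le> m"
  shows "\<psi> (rel n (j, k)) = \<zero>\<^bsub>AZ\<^esub>"
proof -
  interpret Z: cring "O_Z n" by (rule algebra.M_cring[OF algebra_O_Z])
  have ops: "f \<oplus>\<^bsub>O_Z n\<^esub> g = f + g" "f \<otimes>\<^bsub>O_Z n\<^esub> g = f * g" "\<zero>\<^bsub>O_Z n\<^esub> = 0" for f g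
    by (simp_all add: O_Z_def poly_alg_simps)
  note u = alg_homD[OF jet_univ_hom[OF algebra_O_Z, of m n], unfolded ops]
  let ?g = "\<lambda>i. gpoly n (GM j i) * gpoly n (GD i)"
  let ?r = "\<lambda>i. \<Sum>a\<le>k. poly_var (GM j i, a) * poly_var (GD i, k - a)"
  interpret U: ring_hom_cring "O_Z n" "jet_ring m AZ" "jet_univ m (O_Z n)"
    by (intro ring_hom_cring.intro ring_hom_cring_axioms.intro Z.cring_axioms
         algebra.M_cring[OF algebra_jet_ring[OF algZ]] alg_homD(1)[OF jet_univ_hom[OF algebra_O_Z]])
  have g: "?g i \<in> carrier (O_Z n)" if "i < n + 1" for i
    using Z.m_closed[OF gpoly_O_Z gpoly_O_Z, of "GM j i" "GD i"] that j by (auto simp: ops gvars_def)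
  have r: "?r i \<in> carrier PZ" if "i < n + 1" for i
    using that j k
    by (intro poly_alg_sum_closed poly_alg_mult_closed poly_var_closed)
       (auto simp: gvars_def intro: enat_le_trans enat_le_trans[of "k - _" k])
  have gs: "(\<Sum>i<N. ?g i) \<in> carrier (O_Z n)" if "N \<le> n + 1" for N
    using that
  proof (induction N)
    case (Suc N)
    thus ?case using Z.a_closed[OF Suc.IH g[of N]] by (simp add: ops)
  qed (use Z.zero_closed in \<open>simp add: ops\<close>)
  have "\<psi> (\<Sum>i<N. ?r i) = jet_univ m (O_Z n) (\<Sum>i<N. ?g i) k" if "N \<le> n + 1" for N
    using that
  proof (induction N)
    case 0
    thus ?case using U.hom_zero by (simp add: \<psi>_simps ops jet_ring_simps)
  next
    case (Suc N)
    have "\<psi> (\<Sum>i<Suc N. ?r i) = \<psi> (\<Sum>i<N. ?r i) \<oplus>\<^bsub>AZ\<^esub> \<psi> (?r N)"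
      unfolding sum.lessThan_Suc using Suc.prems
      by (intro \<psi>_simps(1) poly_alg_sum_closed[of "{..<N}"] r) auto
    also have "\<psi> (?r N) = jet_univ m (O_Z n) (?g N) k"
      using Suc.prems j k by (intro \<psi>_product_jet) (auto simp: gvars_def)
    also have "\<psi> (\<Sum>i<N. ?r i) = jet_univ m (O_Z n) (\<Sum>i<N. ?g i) k" using Suc by simp
    also have "jet_univ m (O_Z n) (\<Sum>i<N. ?g i) k \<oplus>\<^bsub>AZ\<^esub> jet_univ m (O_Z n) (?g N) k =
        jet_univ m (O_Z n) (\<Sum>i<Suc N. ?g i) k"
      unfolding sum.lessThan_Suc using Suc.prems by (subst u(4)) (auto simp: jet_ring_simps intro!: gs g)
    finally show ?case .
  qed
  hence "\<psi> (\<Sum>i<n + 1. ?r i) = jet_univ m (O_Z n) (\<Sum>i<n + 1. ?g i) k" by blast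
  also have "(\<Sum>i<n + 1. ?g i) = 0" unfolding gpoly_def by (rule gen_relation_GM)
  also have "jet_univ m (O_Z n) 0 k = \<zero>\<^bsub>AZ\<^esub>" using U.hom_zero by (simp add: ops jet_ring_simps)
  finally show ?thesis unfolding rel_def prod.case by (simp only: sum.cartesian_product)
qed

lemma PZ_mono: "p \<in> carrier (poly_alg (S \<times> {..M})) \<Longrightarrow> enat M \<le> m \<Longrightarrow> p \<in> carrier (poly_alg (S \<times> {k. enat k \<le> m}))"
  by (erule poly_alg_mono) (auto intro: enat_le_trans)

text \<open>Slices realize all solutions with \<open>GD 0\<close> a unit, so \<open>p\<close>
  vanishes on these and lies in \<open>idl\<close> for some finite order; \<open>\<psi>\<close>
  kills the generators of \<open>idl\<close>.\<close>

lemma \<psi>_vanishing: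
  assumes p: "p \<in> carrier PZ" and van: "\<And>w. peval (coeffs_at (gen n w)) p = 0"
  shows "\<psi> p = \<zero>\<^bsub>AZ\<^esub>"
proof -
  obtain M where M: "enat M \<le> m" "p \<in> carrier (poly_alg (gvars n \<times> {..M}))"
    using poly_alg_finite_level[OF p] by blast
  interpret J: jets n M by unfold_locales (rule n2)
  have pJ: "p \<in> carrier (poly_alg J.Vars)" using M(2) by (simp add: J.Vars_def)
  have "p \<in> J.idl"
  proof (rule J.vanishing_in_idl[OF pJ])
    fix y assume y: "sol n y" "y (GD 0) $ 0 \<noteq> 0"
    have "peval (coeffs_at y) p = peval (coeffs_at (gen n (slice 0 y))) p"
      by (rule peval_cong[OF pJ]) (auto simp: coeffs_at_def J.Vars_def gen_slice[OF n0 y])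
    thus "peval (coeffs_at y) p = 0" by (simp add: van)
  qed
  then obtain c where c: "p = (\<Sum>s\<in>J.Rels. c s * rel n s)" "\<forall>s\<in>J.Rels. c s \<in> carrier (poly_alg J.Vars)"
    by (auto simp: J.idl_def)
  have t: "c s * rel n s \<in> carrier PZ \<and> \<psi> (c s * rel n s) = \<zero>\<^bsub>AZ\<^esub>" if s: "s \<in> J.Rels" for s
  proof -
    have cs: "c s \<in> carrier PZ" "rel n s \<in> carrier PZ"
      using c(2) s J.rel_closed[OF s] PZ_mono[OF _ M(1)] by (auto simp: J.Vars_def)
    obtain j k where jk: "s = (j, k)" "j < n - 1" "enat k \<le> m"
      using s M(1) by (auto simp: J.Rels_def intro: enat_le_trans)
    show ?thesis
      using cs \<psi>_rel[OF jk(2,3)] by (simp add: poly_alg_mult_closed \<psi>_simps jk(1))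
  qed
  have "(\<Sum>s\<in>A. c s * rel n s) \<in> carrier PZ \<and> \<psi> (\<Sum>s\<in>A. c s * rel n s) = \<zero>\<^bsub>AZ\<^esub>" if "A \<subseteq> J.Rels" for A
    using that
    by (induction A rule: infinite_finite_induct) (auto simp: \<psi>_simps poly_alg_closed t)
  thus ?thesis unfolding c(1) by blast
qed

lemma pm_star_inj: "inj_on (pm_star m n) (carrier AZ)"
proof (rule inj_onI)
  fix a b assume ab: "a \<in> carrier AZ" "b \<in> carrier AZ" "pm_star m n a = pm_star m n b"
  obtain p q where pq: "p \<in> carrier PZ" "a = \<psi> p" "q \<in> carrier PZ" "b = \<psi> q"
    using ab(1,2) unfolding \<psi>_surj[symmetric] by blast
  have "peval (coeffs_at (gen n w)) p = peval (coeffs_at (gen n w)) q" for w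
    using ab(3) jv_pm_star[OF pq(1), of w] jv_pm_star[OF pq(3), of w] by (simp add: pq)
  hence "\<psi> (p - q) = \<zero>\<^bsub>AZ\<^esub>" using pq by (intro \<psi>_vanishing poly_alg_minus_closed) auto
  moreover have "\<psi> p = \<psi> (p - q) \<oplus>\<^bsub>AZ\<^esub> \<psi> q"
    using \<psi>_simps(1)[OF poly_alg_minus_closed[OF pq(1,3)] pq(3)] by simp
  ultimately show "a = b" using pq \<psi>_simps(3) by simp
qed

lemma pm_star_image: "pm_star m n ` carrier AZ = carrier (O_Vm_inv m n)"
proof (intro equalityI subsetI)
  fix F assume "F \<in> pm_star m n ` carrier AZ"
  then obtain p where p: "p \<in> carrier PZ" "F = pm_star m n (\<psi> p)" unfolding \<psi>_surj[symmetric] by blast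
  thus "F \<in> carrier (O_Vm_inv m n)"
    unfolding O_Vm_inv_iff[OF n0] p(2) jv_pm_star[OF p(1)]
    using alg_homD(2)[OF pm_star_hom \<psi>_simps(3)[OF p(1)]] gen_act_pair by (auto simp: coeffs_at_def)
next
  fix F assume F: "F \<in> carrier (O_Vm_inv m n)"
  have FV: "F \<in> carrier AV" using F unfolding O_Vm_inv_iff[OF n0] by blast
  obtain s where s: "s \<in> carrier PV" "F = \<Psi> s" using FV unfolding \<Psi>_surj[symmetric] by blast
  obtain M where M: "enat M \<le> m" "s \<in> carrier (poly_alg (coords n \<times> {..M}))"
    using poly_alg_finite_level[OF s(1)] by blast
  interpret J: jets n M by unfold_locales (rule n2)
  have "J.invariant s"
    unfolding J.invariant_def using F unfolding O_Vm_inv_iff[OF n0] SL_pair_def s(2) jv_\<Psi>[OF s(1)] by blast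
  from J.invariant_generated[OF M(2) this] obtain p where
    p: "p \<in> carrier (poly_alg J.Vars)" "\<And>w. peval (coeffs_at w) s = peval (coeffs_at (gen n w)) p" by blast
  have pZ: "p \<in> carrier PZ" using PZ_mono[OF _ M(1)] p(1) by (simp add: J.Vars_def)
  have "F = pm_star m n (\<psi> p)"
    by (rule AV_eqI[OF FV alg_homD(2)[OF pm_star_hom \<psi>_simps(3)[OF pZ]]])
       (simp add: jv_pm_star[OF pZ] s(2) jv_\<Psi>[OF s(1)] p(2))
  thus "F \<in> pm_star m n ` carrier AZ" using \<psi>_simps(3)[OF pZ] by blast
qed

lemma pm_star_iso: "pm_star m n \<in> ring_iso AZ (O_Vm_inv m n)"
proof -
  note h = alg_homD[OF pm_star_hom]
  have "pm_star m n \<in> Ring.ring_hom AZ (O_Vm_inv m n)"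
  proof (rule ring_hom_memI)
    show "pm_star m n x \<in> carrier (O_Vm_inv m n)" if "x \<in> carrier AZ" for x
      using that unfolding pm_star_image[symmetric] by (rule imageI)
  qed (auto simp: O_Vm_inv_def h)
  moreover have "bij_betw (pm_star m n) (carrier AZ) (carrier (O_Vm_inv m n))"
    unfolding bij_betw_def using pm_star_inj pm_star_image by blast
  ultimately show ?thesis by (simp add: ring_iso_def)
qed

end

section \<open>Polynomial rings are completely integrally closed\<close>

text \<open>The order on \<open>coord\<close> only serves to make the polynomial ring an instance of \<open>idom\<close>.\<close>

instance coord :: countable
  by countable_datatype

instantiation coord :: linorder
begin
definition less_eq_coord :: "coord \<Rightarrow> coord \<Rightarrow> bool" where "less_eq_coord x y \<longleftrightarrow> to_nat x \<le> to_nat y"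
definition less_coord :: "coord \<Rightarrow> coord \<Rightarrow> bool" where "less_coord x y \<longleftrightarrow> to_nat x < to_nat y"
instance by standard (auto simp: less_eq_coord_def less_coord_def)
end

text \<open>A coefficient in a nominal degree: \<open>c = 0\<close> is allowed, so sums and products
  need no case distinction.\<close>

definition top_coeff :: "'a::comm_ring_1 poly \<Rightarrow> nat \<Rightarrow> 'a \<Rightarrow> bool" where
  "top_coeff p n c \<longleftrightarrow> degree p \<le> n \<and> coeff p n = c"

lemma top_coeff_mult:
  assumes "top_coeff p m c" "top_coeff q n d"
  shows "top_coeff (p * q) (m + n) (c * d)"
proof -
  have p: "degree p \<le> m" "coeff p m = c" and q: "degree q \<le> n" "coeff q n = d"
    using assms by (auto simp: top_coeff_def)
  have "coeff (p * q) (m + n) = (\<Sum>i\<le>m + n. coeff p i * coeff q (m + n - i))" by (rule coeff_mult)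
  also have "\<dots> = (\<Sum>i\<le>m + n. if i = m then c * d else 0)"
  proof (rule sum.cong[OF refl])
    fix i assume i: "i \<in> {..m + n}"
    consider "i < m" | "i = m" | "i > m" by linarith
    thus "coeff p i * coeff q (m + n - i) = (if i = m then c * d else 0)"
    proof cases
      case 1
      hence "degree q < m + n - i" using q by linarith
      thus ?thesis using 1 by (simp add: coeff_eq_0)
    next
      case 3
      hence "degree p < i" using p by linarith
      thus ?thesis using 3 by (simp add: coeff_eq_0)
    qed (use p q in simp)
  qed
  also have "\<dots> = c * d" by simp
  finally show ?thesis using degree_mult_le[of p q] p q by (simp add: top_coeff_def)
qed

lemma top_coeff_power: "top_coeff p 1 c \<Longrightarrow> top_coeff (p ^ k) k (c ^ k)"
proof (induction k)
  case (Suc k)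
  thus ?case using top_coeff_mult[of p 1 c "p ^ k" k "c ^ k"] by simp
qed (simp add: top_coeff_def)

lemma top_coeff_prod:
  assumes "\<And>x. x \<in> A \<Longrightarrow> top_coeff (q x) (e x) (c x)"
  shows "top_coeff (prod q A) (sum e A) (prod c A)"
  using assms
  by (induction A rule: infinite_finite_induct) (auto simp: top_coeff_mult top_coeff_def[of 1])

lemma top_coeff_sum:
  assumes "\<And>x. x \<in> A \<Longrightarrow> top_coeff (q x) n (c x)"
  shows "top_coeff (sum q A) n (sum c A)"
  using assms
  by (induction A rule: infinite_finite_induct) (auto simp: top_coeff_def intro: degree_add_le)

text \<open>Restriction to the line through the generic point in the direction
  \<open>a\<close>.\<close>

definition line :: "('x \<Rightarrow> complex) \<Rightarrow> 'x mpoly \<Rightarrow> 'x mpoly poly" where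
  "line a = peval (\<lambda>x. [:poly_var x, scal (a x):])"

lemma poly_line_0: "poly (line a p) 0 = p"
proof -
  have "comm_ring_hom (\<lambda>q :: 'a mpoly poly. poly q 0)" by unfold_locales auto
  from hom_peval[OF this, of "\<lambda>x. [:poly_var x, scal (a x):]" p] show ?thesis
    by (simp add: line_def scal_poly_def peval_var_id)
qed

lemma line_simps: "line a (p * q) = line a p * line a q" "line a (p ^ k) = line a p ^ k"
  by (simp_all add: line_def)

definition tdeg :: "('x \<Rightarrow>\<^sub>0 nat) \<Rightarrow> nat" where
  "tdeg \<mu> = (\<Sum>x\<in>keys \<mu>. lookup \<mu> x)"

text \<open>The coefficient of g(x + ta) at t^n, with n the total degree of \<open>g\<close>, is the
  value at \<open>a\<close> of the top homogeneous part \<open>h\<close>, hence a constant;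
  \<open>a\<close> is chosen off the zeros of \<open>h\<close>.\<close>

lemma line_top_coeff:
  fixes g :: "'x mpoly"
  assumes g: "g \<noteq> 0"
  shows "\<exists>a u n. u \<noteq> 0 \<and> top_coeff (line a g) n (scal u)"
proof -
  let ?K = "keys g"
  define n where "n = Max (tdeg ` ?K)"
  have K: "?K \<noteq> {}" using g by simp
  have n: "tdeg \<mu> \<le> n" if "\<mu> \<in> ?K" for \<mu> unfolding n_def using that by simp
  obtain \<nu> where \<nu>: "\<nu> \<in> ?K" "tdeg \<nu> = n" using Max_in[of "tdeg ` ?K"] K unfolding n_def by fastforce
  let ?c = "lookup g"
  define h where "h = (\<Sum>\<mu>\<in>?K. single \<mu> (if tdeg \<mu> = n then ?c \<mu> else 0))"
  have "lookup h \<nu> = ?c \<nu>"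
    using \<nu> by (simp add: h_def lookup_sum lookup_single when_def)
  hence "h \<noteq> 0" using \<nu>(1) by (auto simp: in_keys_iff)
  then obtain a :: "'x \<Rightarrow> complex" where a: "peval a h \<noteq> 0" using peval_eq_0_imp_eq_0 by blast
  have mono: "top_coeff (line a (single \<mu> c)) (tdeg \<mu>) (scal (peval a (single \<mu> c)))" for \<mu> c
  proof -
    have "top_coeff ([:poly_var x, scal (a x):] ^ k) k (scal (a x) ^ k)" for x :: 'x and k
      by (rule top_coeff_power) (simp add: top_coeff_def)
    hence "top_coeff (\<Prod>x\<in>keys \<mu>. [:poly_var x, scal (a x):] ^ lookup \<mu> x) (tdeg \<mu>)
      (\<Prod>x\<in>keys \<mu>. scal (a x) ^ lookup \<mu> x)"
      unfolding tdeg_def by (rule top_coeff_prod)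
    moreover have "top_coeff (scal c :: 'x mpoly poly) 0 (scal c)" by (simp add: top_coeff_def scal_poly_def)
    ultimately have "top_coeff (line a (single \<mu> c)) (0 + tdeg \<mu>)
      (scal c * (\<Prod>x\<in>keys \<mu>. scal (a x) ^ lookup \<mu> x))"
      unfolding line_def peval_single by (intro top_coeff_mult)
    moreover have "scal (prod b A) = (\<Prod>x\<in>A. scal (b x) :: 'x mpoly)" for b :: "'x \<Rightarrow> complex" and A
      by (induction A rule: infinite_finite_induct) (auto simp: scal_one scal_mult)
    moreover have "scal (b ^ k) = (scal b ^ k :: 'x mpoly)" for b k
      by (induction k) (auto simp: scal_one scal_mult)
    ultimately show ?thesis by (simp add: peval_single scal_mult scal_complex_def)
  qed
  have "top_coeff (line a (single \<mu> (?c \<mu>))) n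
      (scal (peval a (single \<mu> (if tdeg \<mu> = n then ?c \<mu> else 0))))" if \<mu>: "\<mu> \<in> ?K" for \<mu>
  proof (cases "tdeg \<mu> = n")
    case True
    thus ?thesis using mono[of \<mu> "?c \<mu>"] by simp
  next
    case False
    hence "tdeg \<mu> < n" using n[OF \<mu>] by simp
    thus ?thesis using mono[of \<mu> "?c \<mu>"] False by (auto simp: top_coeff_def scal_zero coeff_eq_0)
  qed
  hence "top_coeff (\<Sum>\<mu>\<in>?K. line a (single \<mu> (?c \<mu>))) n
      (\<Sum>\<mu>\<in>?K. scal (peval a (single \<mu> (if tdeg \<mu> = n then ?c \<mu> else 0))))"
    by (rule top_coeff_sum)
  moreover have "(\<Sum>\<mu>\<in>?K. line a (single \<mu> (?c \<mu>))) = line a g"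
  proof -
    have "g = (\<Sum>\<mu>\<in>?K. single \<mu> (?c \<mu>))"
      by (rule mpoly_eq_sum_singles)
    thus ?thesis by (metis (no_types, lifting) line_def peval_sum sum.cong)
  qed
  moreover have "scal (sum b A) = (\<Sum>x\<in>A. scal (b x) :: 'x mpoly)" for b :: "('x \<Rightarrow>\<^sub>0 nat) \<Rightarrow> complex" and A
    by (induction A rule: infinite_finite_induct) (auto simp: scal_zero scal_add)
  ultimately have "top_coeff (line a g) n (scal (peval a h))" by (simp add: h_def peval_sum)
  thus ?thesis using a by blast
qed

text \<open>The divisibilities pass to every element congruent to \<open>a\<close> modulo
  \<open>g\<close>, in particular to a remainder.\<close>

lemma power_add_dvd:
  fixes a b g c :: "'a::comm_ring_1"
  assumes "\<And>j. g ^ j dvd c * a ^ j"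
  shows "g ^ k dvd c * (a + g * b) ^ k"
proof -
  have "g ^ k dvd c * (of_nat (k choose j) * a ^ j * (g * b) ^ (k - j))" if "j \<le> k" for j
  proof -
    have "g ^ j * g ^ (k - j) dvd (c * a ^ j) * (g ^ (k - j) * (b ^ (k - j) * of_nat (k choose j)))"
      by (intro mult_dvd_mono assms dvd_triv_left)
    moreover have "g ^ j * g ^ (k - j) = g ^ k" using that by (simp flip: power_add)
    ultimately show ?thesis by (simp add: power_mult_distrib mult_ac)
  qed
  hence "g ^ k dvd (\<Sum>j\<le>k. c * (of_nat (k choose j) * a ^ j * (g * b) ^ (k - j)))" by (intro dvd_sum) simp
  thus ?thesis unfolding binomial_ring sum_distrib_left .
qed

text \<open>
  On a generic line through the generic point, \<open>g\<close> becomes monic up to a scalar. The remainder \<open>r\<close> of \<open>f\<close>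
  modulo \<open>g\<close> satisfies the same divisibilities as \<open>f\<close>, which for large \<open>k\<close> contradicts
  \<open>degree r < degree g\<close> unless \<open>r = 0\<close>.
\<close>

lemma mpoly_completely_integrally_closed:
  fixes f g c :: "('x::linorder) mpoly"
  assumes g: "g \<noteq> 0" and c: "c \<noteq> 0" and dvd: "\<And>k. g ^ k dvd c * f ^ k"
  shows "g dvd f"
proof -
  obtain a u n where u: "u \<noteq> 0" "top_coeff (line a g) n (scal u)" using line_top_coeff[OF g] by blast
  define G C where "G = line a g" and "C = line a c"
  have su: "scal u * scal (inverse u) = (1 :: 'x mpoly)"
    using u(1) by (simp flip: scal_mult add: scal_one)
  hence "scal u \<noteq> (0 :: 'x mpoly)" by auto
  hence deg: "degree G = n" using u(2) unfolding top_coeff_def G_def by (simp add: le_antisym le_degree)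
  have G0: "G \<noteq> 0" using g poly_line_0[of a g] by (auto simp: G_def)
  have C0: "C \<noteq> 0" using c poly_line_0[of a c] by (auto simp: C_def)
  obtain q r where qr: "pseudo_divmod (line a f) G = (q, r)" by (cases "pseudo_divmod (line a f) G")
  define N where "N = Suc (degree (line a f)) - degree G"
  have lc: "coeff G (degree G) = scal u" using u(2) by (simp add: deg top_coeff_def G_def[symmetric])
  \<comment> \<open>The leading coefficient of \<open>G\<close> is a nonzero scalar, so
    pseudo-division multiplies only by a power of it, which is undone at the end.\<close>
  have div: "Polynomial.smult (scal u ^ N) (line a f) = G * q + r"
    using pseudo_divmod(1)[OF G0 qr] by (simp only: lc N_def)
  have rdeg: "r = 0 \<or> degree r < degree G" by (rule pseudo_divmod(2)[OF G0 qr])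
  have "G ^ k dvd C * r ^ k" for k
  proof -
    have "G ^ j dvd C * (Polynomial.smult (scal u ^ N) (line a f)) ^ j" for j
    proof -
      obtain k where "c * f ^ j = g ^ j * k" using dvd[of j] by (rule dvdE)
      hence "line a (c * f ^ j) = line a (g ^ j) * line a k" by (simp only: line_simps)
      hence "line a (g ^ j) dvd line a (c * f ^ j)" by simp
      hence "G ^ j dvd C * line a f ^ j" by (simp add: line_simps G_def C_def)
      hence "G ^ j dvd Polynomial.smult ((scal u ^ N) ^ j) (C * line a f ^ j)" by (rule dvd_smult)
      thus ?thesis by (simp add: smult_power)
    qed
    from power_add_dvd[OF this, of k "- q"]
    show ?thesis by (simp add: div)
  qed
  \<comment> \<open>For K = degree C + 1 the degrees would give K * degree G <= degree C + K *
    degree r, against degree r < degree G.\<close>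
  hence dvd': "G ^ Suc (degree C) dvd C * r ^ Suc (degree C)" by blast
  have "r = 0"
  proof (rule ccontr)
    assume r: "r \<noteq> 0"
    obtain t where t: "C * r ^ Suc (degree C) = G ^ Suc (degree C) * t" using dvd' by (auto simp: dvd_def)
    have "C * r ^ Suc (degree C) \<noteq> 0" using C0 r by simp
    hence t0: "t \<noteq> 0" using t by auto
    have "degree C + Suc (degree C) * degree r = Suc (degree C) * degree G + degree t"
      using arg_cong[OF t, of degree] C0 r G0 t0
      by (simp add: degree_mult_eq degree_power_eq del: power_Suc)
    moreover have "Suc (degree C) * Suc (degree r) \<le> Suc (degree C) * degree G"
      using rdeg r by (intro mult_le_mono) auto
    ultimately show False by simp
  qed
  \<comment> \<open>t = 0 is the generic point itself, where \<open>line a f\<close> and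
    \<open>G\<close> become \<open>f\<close> and \<open>g\<close>.\<close>
  hence "poly (Polynomial.smult (scal u ^ N) (line a f)) 0 = poly (G * q) 0" using div by simp
  hence "scal u ^ N * f = g * poly q 0" by (simp add: poly_line_0 G_def)
  hence "g dvd scal u ^ N * f" by simp
  hence "g dvd scal (inverse u) ^ N * (scal u ^ N * f)" by (rule dvd_mult)
  moreover have "scal (inverse u) ^ N * (scal u ^ N * f) = (scal u * scal (inverse u)) ^ N * f"
    by (simp only: power_mult_distrib mult_ac)
  ultimately show ?thesis by (simp only: su power_one mult_1_left)
qed

section \<open>Homogenized evaluation\<close>

text \<open>For \<open>ls = [l\<^sub>0, \<dots>, l\<^sub>N]\<close> this is \<open>\<Sum>i\<le>N. l\<^sub>i a^(N-i) b^i\<close>, the numerator of the value of \<open>ls\<close> at \<open>a/b\<close>.\<close>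

fun heval :: "('a, 'c) ring_scheme \<Rightarrow> 'a list \<Rightarrow> 'a \<Rightarrow> 'a \<Rightarrow> 'a" where
  "heval R [] a b = \<zero>\<^bsub>R\<^esub>"
| "heval R (l # ls) a b = l \<otimes>\<^bsub>R\<^esub> a [^]\<^bsub>R\<^esub> length ls \<oplus>\<^bsub>R\<^esub> b \<otimes>\<^bsub>R\<^esub> heval R ls a b"

text \<open>Integral closedness without fractions: if a/b is integral, then b divides a. No field of
  fractions is formed until the condition has been localized.\<close>

definition homog_closed :: "('a, 'c) ring_scheme \<Rightarrow> bool" where
  "homog_closed R \<longleftrightarrow> (\<forall>ls a b. set ls \<subseteq> carrier R \<longrightarrow> a \<in> carrier R \<longrightarrow> b \<in> carrier R \<longrightarrow> b \<noteq> \<zero>\<^bsub>R\<^esub> \<longrightarrow>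
     heval R (\<one>\<^bsub>R\<^esub> # ls) a b = \<zero>\<^bsub>R\<^esub> \<longrightarrow> (\<exists>c\<in>carrier R. a = b \<otimes>\<^bsub>R\<^esub> c))"

text \<open>Multiplies the \<open>i\<close>-th coefficient by \<open>w u^i\<close>.\<close>

fun scale_coeffs :: "('a, 'c) ring_scheme \<Rightarrow> 'a \<Rightarrow> 'a \<Rightarrow> 'a list \<Rightarrow> 'a list" where
  "scale_coeffs R u w [] = []"
| "scale_coeffs R u w (l # ls) = (w \<otimes>\<^bsub>R\<^esub> l) # scale_coeffs R u (w \<otimes>\<^bsub>R\<^esub> u) ls"

lemma length_scale_coeffs [simp]: "length (scale_coeffs R u w ls) = length ls"
  by (induction ls arbitrary: w) auto

context cring
begin

lemma heval_closed [simp]: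
  "set ls \<subseteq> carrier R \<Longrightarrow> a \<in> carrier R \<Longrightarrow> b \<in> carrier R \<Longrightarrow> heval R ls a b \<in> carrier R"
  by (induction ls) auto

text \<open>If x solves a monic equation, then ux solves the one with coefficients multiplied by u,
  u^2, and so on. The factor \<open>u\<close> on the left avoids the exponent
  \<open>length ls - 1\<close>.\<close>

lemma heval_scale:
  assumes "set ls \<subseteq> carrier R" "a \<in> carrier R" "b \<in> carrier R" "u \<in> carrier R" "w \<in> carrier R"
  shows "u \<otimes> heval R (scale_coeffs R u w ls) (u \<otimes> a) b = w \<otimes> u [^] length ls \<otimes> heval R ls a b"
    and "set (scale_coeffs R u w ls) \<subseteq> carrier R"
proof -
  have "u \<otimes> heval R (scale_coeffs R u w ls) (u \<otimes> a) b = w \<otimes> u [^] length ls \<otimes> heval R ls a b \<and>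
      set (scale_coeffs R u w ls) \<subseteq> carrier R"
    using assms(1,5)
  proof (induction ls arbitrary: w)
    case (Cons l ls)
    let ?n = "length ls"
    have IH: "u \<otimes> heval R (scale_coeffs R u (w \<otimes> u) ls) (u \<otimes> a) b = (w \<otimes> u) \<otimes> u [^] ?n \<otimes> heval R ls a b"
      and c: "set (scale_coeffs R u (w \<otimes> u) ls) \<subseteq> carrier R"
      using Cons.IH[of "w \<otimes> u"] Cons.prems assms(4) by auto
    have cl: "l \<in> carrier R" "heval R ls a b \<in> carrier R" "w \<in> carrier R" using Cons.prems assms by auto
    define h' where "h' = heval R (scale_coeffs R u (w \<otimes> u) ls) (u \<otimes> a) b"
    have h': "h' \<in> carrier R" unfolding h'_def using c assms by (intro heval_closed) auto
    have "u \<otimes> heval R (scale_coeffs R u w (l # ls)) (u \<otimes> a) b =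
        u \<otimes> ((w \<otimes> l) \<otimes> (u \<otimes> a) [^] ?n \<oplus> b \<otimes> h')"
      by (simp add: h'_def)
    also have "\<dots> = u \<otimes> ((w \<otimes> l) \<otimes> (u [^] ?n \<otimes> a [^] ?n)) \<oplus> b \<otimes> (u \<otimes> h')"
      using cl h' assms by (simp add: nat_pow_distrib r_distr m_ac)
    also have "\<dots> = w \<otimes> u [^] length (l # ls) \<otimes> heval R (l # ls) a b"
      unfolding h'_def IH using cl assms by (simp add: r_distr m_ac)
    finally show ?case using c cl by simp
  qed (use assms in auto)
  thus "u \<otimes> heval R (scale_coeffs R u w ls) (u \<otimes> a) b = w \<otimes> u [^] length ls \<otimes> heval R ls a b"
    and "set (scale_coeffs R u w ls) \<subseteq> carrier R" by auto
qed

lemma heval_homogeneous: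
  assumes "set ls \<subseteq> carrier R" "a \<in> carrier R" "b \<in> carrier R" "c \<in> carrier R"
  shows "c \<otimes> heval R ls (c \<otimes> a) (c \<otimes> b) = c [^] length ls \<otimes> heval R ls a b"
  using assms(1)
proof (induction ls)
  case (Cons l ls)
  let ?n = "length ls"
  have cl: "l \<in> carrier R" "heval R ls a b \<in> carrier R" "heval R ls (c \<otimes> a) (c \<otimes> b) \<in> carrier R"
    using Cons.prems assms by auto
  have IH: "c \<otimes> heval R ls (c \<otimes> a) (c \<otimes> b) = c [^] ?n \<otimes> heval R ls a b" using Cons by simp
  have "c \<otimes> heval R (l # ls) (c \<otimes> a) (c \<otimes> b) =
      c \<otimes> (l \<otimes> (c [^] ?n \<otimes> a [^] ?n)) \<oplus> c \<otimes> b \<otimes> (c \<otimes> heval R ls (c \<otimes> a) (c \<otimes> b))"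
    using cl assms by (simp add: nat_pow_distrib r_distr m_ac)
  also have "\<dots> = c [^] length (l # ls) \<otimes> heval R (l # ls) a b"
    unfolding IH using cl assms by (simp add: r_distr m_ac)
  finally show ?case .
qed (use assms in simp)

end

lemma heval_hom:
  assumes "ring_hom_cring R T h" "set ls \<subseteq> carrier R" "a \<in> carrier R" "b \<in> carrier R"
  shows "heval T (map h ls) (h a) (h b) = h (heval R ls a b)"
proof -
  interpret ring_hom_cring R T h by fact
  show ?thesis using assms(2) by (induction ls) (use assms in \<open>auto simp: R.heval_closed\<close>)
qed

section \<open>Localizations of integrally closed domains\<close>

locale domain_localization = domain R for R :: "('a, 'c) ring_scheme" (structure) +
  fixes S :: "'a set"
  assumes sub: "submonoid S R" and zero_notin: "\<zero> \<notin> S"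
begin

abbreviation "L \<equiv> localization R S"

abbreviation "fr \<equiv> fraction R S"

lemma S_carrier: "s \<in> S \<Longrightarrow> s \<in> carrier R"
  using submonoid.mem_carrier[OF sub] .

lemma S_one: "\<one> \<in> S" and S_mult: "s \<in> S \<Longrightarrow> t \<in> S \<Longrightarrow> s \<otimes> t \<in> S"
  using submonoid.one_closed[OF sub] submonoid.m_closed[OF sub] .

lemma fr_eq_iff:
  assumes "a \<in> carrier R" "b \<in> carrier R" "s \<in> S" "t \<in> S"
  shows "fr a s = fr b t \<longleftrightarrow> a \<otimes> t = b \<otimes> s"
proof -
  have "u \<otimes> (a \<otimes> t) = u \<otimes> (b \<otimes> s) \<longleftrightarrow> a \<otimes> t = b \<otimes> s" if "u \<in> S" for u
    using that assms S_carrier zero_notin by (intro m_lcancel) auto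
  thus ?thesis using fraction_eq_iff[OF is_cring sub assms] S_one by blast
qed

lemma fr_closed: "a \<in> carrier R \<Longrightarrow> s \<in> S \<Longrightarrow> fr a s \<in> carrier L"
  using localization_carrier[OF is_cring sub] by auto

lemma fr_cases: "x \<in> carrier L \<Longrightarrow> \<exists>a s. x = fr a s \<and> a \<in> carrier R \<and> s \<in> S"
  using localization_carrier[OF is_cring sub] by auto

lemmas fr_mult = localization_mult[OF is_cring sub]
lemmas fr_add = localization_add[OF is_cring sub]

lemma fr_one: "\<one>\<^bsub>L\<^esub> = fr \<one> \<one>" and fr_zero: "\<zero>\<^bsub>L\<^esub> = fr \<zero> \<one>"
  by (simp_all add: localization_def)

lemma fr_eq_zero_iff: "a \<in> carrier R \<Longrightarrow> s \<in> S \<Longrightarrow> fr a s = \<zero>\<^bsub>L\<^esub> \<longleftrightarrow> a = \<zero>"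
  unfolding fr_zero using S_one S_carrier by (subst fr_eq_iff) auto

lemma cring_L: "cring L"
  by (rule cring_localization[OF is_cring sub])

lemma domain_L: "domain L"
proof (intro domain.intro domain_axioms.intro cring_L)
  show "\<one>\<^bsub>L\<^esub> \<noteq> \<zero>\<^bsub>L\<^esub>" unfolding fr_one using fr_eq_zero_iff[of \<one> \<one>] S_one by simp
  fix x y assume xy: "x \<otimes>\<^bsub>L\<^esub> y = \<zero>\<^bsub>L\<^esub>" "x \<in> carrier L" "y \<in> carrier L"
  obtain a s b t where e: "x = fr a s" "a \<in> carrier R" "s \<in> S" "y = fr b t" "b \<in> carrier R" "t \<in> S"
    using fr_cases xy(2,3) by metis
  have "fr (a \<otimes> b) (s \<otimes> t) = \<zero>\<^bsub>L\<^esub>" using xy(1) by (simp add: e fr_mult)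
  hence "a \<otimes> b = \<zero>" using fr_eq_zero_iff[of "a \<otimes> b" "s \<otimes> t"] e S_mult by simp
  hence "a = \<zero> \<or> b = \<zero>" using e by (simp add: integral_iff)
  thus "x = \<zero>\<^bsub>L\<^esub> \<or> y = \<zero>\<^bsub>L\<^esub>" unfolding e(1,4) using e by (simp add: fr_eq_zero_iff)
qed

abbreviation "\<iota> \<equiv> \<lambda>a. fr a \<one>"

lemma iota_hom: "ring_hom_cring R L \<iota>"
  by (intro ring_hom_cring.intro ring_hom_cring_axioms.intro is_cring cring_L ring_hom_memI)
     (auto simp: fr_closed fr_mult fr_add S_one fr_one)

lemma common_denominator:
  assumes "set ls \<subseteq> carrier L"
  shows "\<exists>u\<in>S. \<forall>l\<in>set ls. \<exists>a\<in>carrier R. l \<otimes>\<^bsub>L\<^esub> \<iota> u = \<iota> a"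
  using assms
proof (induction ls)
  case Nil
  show ?case using S_one by auto
next
  case (Cons l ls)
  then obtain u where u: "u \<in> S" "\<forall>l\<in>set ls. \<exists>a\<in>carrier R. l \<otimes>\<^bsub>L\<^esub> \<iota> u = \<iota> a" by auto
  have "l \<in> carrier L" using Cons.prems by simp
  from fr_cases[OF this] obtain a s where l: "l = fr a s" "a \<in> carrier R" "s \<in> S" by blast
  interpret L: cring L by (rule cring_L)
  have ius: "\<iota> (u \<otimes> s) = \<iota> u \<otimes>\<^bsub>L\<^esub> \<iota> s" using u l S_carrier S_one by (simp add: fr_mult)
  have c: "\<iota> u \<in> carrier L" "\<iota> s \<in> carrier L" using u l S_carrier S_one by (auto intro: fr_closed)
  have "\<exists>b\<in>carrier R. l' \<otimes>\<^bsub>L\<^esub> \<iota> (u \<otimes> s) = \<iota> b" if l': "l' \<in> set (l # ls)" for l'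
  proof (cases "l' = l")
    case True
    have "l \<otimes>\<^bsub>L\<^esub> \<iota> (u \<otimes> s) = \<iota> (a \<otimes> u)"
      using u l S_carrier S_one S_mult by (simp add: fr_mult fr_eq_iff m_ac)
    thus ?thesis using True u l S_carrier by blast
  next
    case False
    then obtain b where b: "b \<in> carrier R" "l' \<otimes>\<^bsub>L\<^esub> \<iota> u = \<iota> b" using u l' by auto
    have "l' \<in> carrier L" using l' Cons.prems by auto
    hence "l' \<otimes>\<^bsub>L\<^esub> \<iota> (u \<otimes> s) = \<iota> b \<otimes>\<^bsub>L\<^esub> \<iota> s" using c by (simp add: ius b(2)[symmetric] L.m_assoc)
    also have "\<dots> = \<iota> (b \<otimes> s)" using b l S_carrier S_one by (simp add: fr_mult)
    finally show ?thesis using b l S_carrier by blast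
  qed
  thus ?case using S_mult[OF u(1) l(3)] by blast
qed

text \<open>Every coefficient after the leading 1 receives at least one factor \<open>u\<close>,
  which clears its denominator; hence the starting factor contains \<open>\<iota> u\<close>.\<close>

lemma scale_coeffs_image:
  assumes "u \<in> carrier R" "w \<in> carrier R" "set ls \<subseteq> carrier L" "\<forall>l\<in>set ls. \<exists>a\<in>carrier R. l \<otimes>\<^bsub>L\<^esub> \<iota> u = \<iota> a"
  shows "\<exists>ls'. set ls' \<subseteq> carrier R \<and> scale_coeffs L (\<iota> u) (\<iota> w \<otimes>\<^bsub>L\<^esub> \<iota> u) ls = map \<iota> ls'"
  using assms(2-)
proof (induction ls arbitrary: w)
  case Nil
  show ?case by (intro exI[of _ "[]"]) auto
next
  case (Cons l ls)
  interpret L: cring L by (rule cring_L)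
  have c: "\<iota> w \<in> carrier L" "\<iota> u \<in> carrier L" "l \<in> carrier L"
    using Cons.prems assms(1) S_one by (auto intro: fr_closed)
  obtain a where a: "a \<in> carrier R" "l \<otimes>\<^bsub>L\<^esub> \<iota> u = \<iota> a" using Cons.prems by auto
  have wu: "\<iota> w \<otimes>\<^bsub>L\<^esub> \<iota> u = \<iota> (w \<otimes> u)" using Cons.prems assms(1) S_one by (simp add: fr_mult)
  have "\<iota> w \<otimes>\<^bsub>L\<^esub> \<iota> u \<otimes>\<^bsub>L\<^esub> l = \<iota> w \<otimes>\<^bsub>L\<^esub> \<iota> a" using c by (simp add: a(2)[symmetric] L.m_ac)
  also have "\<dots> = \<iota> (w \<otimes> a)" using Cons.prems a S_one by (simp add: fr_mult)
  finally have hd: "\<iota> w \<otimes>\<^bsub>L\<^esub> \<iota> u \<otimes>\<^bsub>L\<^esub> l = \<iota> (w \<otimes> a)" .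
  obtain ls' where ls': "set ls' \<subseteq> carrier R" "scale_coeffs L (\<iota> u) (\<iota> (w \<otimes> u) \<otimes>\<^bsub>L\<^esub> \<iota> u) ls = map \<iota> ls'"
    using Cons.IH[of "w \<otimes> u"] Cons.prems assms(1) by auto
  show ?case
    by (intro exI[of _ "(w \<otimes> a) # ls'"]) (use ls' hd a Cons.prems in \<open>auto simp: wu\<close>)
qed

text \<open>Multiplying x = a/s and y = b/t by st moves both into R; multiplying x further by a
  common denominator u of the coefficients gives a monic equation over R. Division there yields u t
  a = s b d, hence x = y (d/u).\<close>

lemma homog_closed_L:
  assumes R: "homog_closed R"
  shows "homog_closed L"
  unfolding homog_closed_def
proof (intro allI impI)
  fix ls x y
  assume ls: "set ls \<subseteq> carrier L" and x: "x \<in> carrier L" and y: "y \<in> carrier L" "y \<noteq> \<zero>\<^bsub>L\<^esub>"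
    and eq: "heval L (\<one>\<^bsub>L\<^esub> # ls) x y = \<zero>\<^bsub>L\<^esub>"
  interpret L: domain L by (rule domain_L)
  interpret I: ring_hom_cring R L \<iota> by (rule iota_hom)
  from fr_cases[OF x] fr_cases[OF y(1)] obtain a s b t where
    e: "x = fr a s" "a \<in> carrier R" "s \<in> S" "y = fr b t" "b \<in> carrier R" "t \<in> S"
    by (elim exE conjE)
  from common_denominator[OF ls] obtain u where
    u: "u \<in> S" "\<forall>l\<in>set ls. \<exists>a\<in>carrier R. l \<otimes>\<^bsub>L\<^esub> \<iota> u = \<iota> a"
    by (rule bexE)
  note uC = S_carrier[OF u(1)] S_carrier[OF e(3)] S_carrier[OF e(6)]
  have nz: "\<iota> z \<noteq> \<zero>\<^bsub>L\<^esub>" if "z \<in> S" for z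
  proof
    assume "\<iota> z = \<zero>\<^bsub>L\<^esub>"
    hence "z = \<zero>" using fr_eq_zero_iff[OF S_carrier[OF that] S_one] by (rule iffD1[rotated])
    thus False using that zero_notin by simp
  qed
  have b0: "b \<noteq> \<zero>" using y(2) fr_eq_zero_iff[OF e(5,6)] unfolding e(4) by simp
  define c where "c = \<iota> (s \<otimes> t)"
  have cC: "c \<in> carrier L" "c \<noteq> \<zero>\<^bsub>L\<^esub>"
    unfolding c_def by (intro fr_closed S_one m_closed uC) (rule nz[OF S_mult[OF e(3,6)]])
  have st: "s \<otimes> t \<in> carrier R" "\<one> \<otimes> s \<in> S" "\<one> \<otimes> t \<in> S" using uC e(3,6) by simp_all
  have cx: "c \<otimes>\<^bsub>L\<^esub> x = \<iota> (t \<otimes> a)"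
    unfolding c_def e(1) fr_mult[OF st(1) e(2) S_one e(3)]
    by (subst fr_eq_iff[OF _ _ st(2) S_one]) (use e(2) uC in \<open>simp_all add: m_ac\<close>)
  have cy: "c \<otimes>\<^bsub>L\<^esub> y = \<iota> (s \<otimes> b)"
    unfolding c_def e(4) fr_mult[OF st(1) e(5) S_one e(6)]
    by (subst fr_eq_iff[OF _ _ st(3) S_one]) (use e(5) uC in \<open>simp_all add: m_ac\<close>)
  have c1: "set (\<one>\<^bsub>L\<^esub> # ls) \<subseteq> carrier L" using ls by simp
  have h0: "heval L (\<one>\<^bsub>L\<^esub> # ls) (c \<otimes>\<^bsub>L\<^esub> x) (c \<otimes>\<^bsub>L\<^esub> y) = \<zero>\<^bsub>L\<^esub>" (is "?h = _")
  proof -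
    have "c \<otimes>\<^bsub>L\<^esub> ?h = c [^]\<^bsub>L\<^esub> length (\<one>\<^bsub>L\<^esub> # ls) \<otimes>\<^bsub>L\<^esub> heval L (\<one>\<^bsub>L\<^esub> # ls) x y"
      by (rule L.heval_homogeneous[OF c1 x y(1) cC(1)])
    also have "\<dots> = \<zero>\<^bsub>L\<^esub>" unfolding eq by (rule L.r_null[OF L.nat_pow_closed[OF cC(1)]])
    finally have "c = \<zero>\<^bsub>L\<^esub> \<or> ?h = \<zero>\<^bsub>L\<^esub>"
      by (rule L.integral) (intro cC L.heval_closed[OF c1] L.m_closed x y)+
    thus ?thesis using cC(2) by simp
  qed
  define U where "U = \<iota> u"
  have UC: "U \<in> carrier L" "U \<noteq> \<zero>\<^bsub>L\<^esub>"
    unfolding U_def by (rule fr_closed[OF uC(1) S_one], rule nz[OF u(1)])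
  define ls1 where "ls1 = scale_coeffs L U (\<one>\<^bsub>L\<^esub> \<otimes>\<^bsub>L\<^esub> U) ls"
  have "\<one>\<^bsub>L\<^esub> \<otimes>\<^bsub>L\<^esub> \<one>\<^bsub>L\<^esub> = \<one>\<^bsub>L\<^esub>" by (rule L.l_one[OF L.one_closed])
  hence sc: "scale_coeffs L U \<one>\<^bsub>L\<^esub> (\<one>\<^bsub>L\<^esub> # ls) = \<one>\<^bsub>L\<^esub> # ls1" by (simp only: ls1_def scale_coeffs.simps)
  from scale_coeffs_image[OF uC(1) one_closed ls u(2)] obtain ls' where
    ls': "set ls' \<subseteq> carrier R" "ls1 = map \<iota> ls'"
    unfolding fr_one[symmetric] U_def[symmetric] ls1_def[symmetric] by (elim exE conjE)
  have ls1: "set (\<one>\<^bsub>L\<^esub> # ls1) \<subseteq> carrier L"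
    using L.heval_scale(2)[OF c1 L.m_closed[OF cC(1) x] L.m_closed[OF cC(1) y(1)] UC(1) L.one_closed] unfolding sc .
  have h1: "heval L (\<one>\<^bsub>L\<^esub> # ls1) (U \<otimes>\<^bsub>L\<^esub> (c \<otimes>\<^bsub>L\<^esub> x)) (c \<otimes>\<^bsub>L\<^esub> y) = \<zero>\<^bsub>L\<^esub>" (is "?h = _")
  proof -
    have "U \<otimes>\<^bsub>L\<^esub> ?h = \<one>\<^bsub>L\<^esub> \<otimes>\<^bsub>L\<^esub> U [^]\<^bsub>L\<^esub> length (\<one>\<^bsub>L\<^esub> # ls) \<otimes>\<^bsub>L\<^esub> heval L (\<one>\<^bsub>L\<^esub> # ls) (c \<otimes>\<^bsub>L\<^esub> x) (c \<otimes>\<^bsub>L\<^esub> y)"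
      unfolding sc[symmetric]
      by (rule L.heval_scale(1)[OF c1 L.m_closed[OF cC(1) x] L.m_closed[OF cC(1) y(1)] UC(1) L.one_closed])
    also have "\<dots> = \<zero>\<^bsub>L\<^esub>"
      unfolding h0 by (rule L.r_null[OF L.m_closed[OF L.one_closed L.nat_pow_closed[OF UC(1)]]])
    finally have "U = \<zero>\<^bsub>L\<^esub> \<or> ?h = \<zero>\<^bsub>L\<^esub>"
      by (rule L.integral) (intro UC cC L.heval_closed[OF ls1] L.m_closed x y)+
    thus ?thesis using UC(2) by simp
  qed
  have Ux: "U \<otimes>\<^bsub>L\<^esub> (c \<otimes>\<^bsub>L\<^esub> x) = \<iota> (u \<otimes> (t \<otimes> a))"
    unfolding cx U_def by (rule I.hom_mult[symmetric]) (intro uC m_closed e)+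
  have "heval L (map \<iota> (\<one> # ls')) (\<iota> (u \<otimes> (t \<otimes> a))) (\<iota> (s \<otimes> b)) = \<iota> (heval R (\<one> # ls') (u \<otimes> (t \<otimes> a)) (s \<otimes> b))"
    by (rule heval_hom[OF iota_hom]) (use ls' in simp, intro uC m_closed e, intro uC m_closed e)
  hence "\<iota> (heval R (\<one> # ls') (u \<otimes> (t \<otimes> a)) (s \<otimes> b)) = \<zero>\<^bsub>L\<^esub>"
    using h1 by (simp only: Ux cy ls'(2) list.map fr_one[symmetric])
  moreover have "heval R (\<one> # ls') (u \<otimes> (t \<otimes> a)) (s \<otimes> b) \<in> carrier R"
    using ls' uC e by (intro heval_closed) auto
  ultimately have "heval R (\<one> # ls') (u \<otimes> (t \<otimes> a)) (s \<otimes> b) = \<zero>" using S_one fr_eq_zero_iff by blast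
  moreover have "s \<otimes> b \<noteq> \<zero>"
  proof
    assume "s \<otimes> b = \<zero>"
    hence "s = \<zero> \<or> b = \<zero>" by (rule integral[OF _ uC(2) e(5)])
    thus False using b0 e(3) zero_notin by auto
  qed
  ultimately have "\<exists>d\<in>carrier R. u \<otimes> (t \<otimes> a) = (s \<otimes> b) \<otimes> d"
    using R[unfolded homog_closed_def, rule_format, OF ls'(1) m_closed[OF uC(1) m_closed[OF uC(3) e(2)]]
        m_closed[OF uC(2) e(5)]] by blast
  then obtain d where d: "d \<in> carrier R" "u \<otimes> (t \<otimes> a) = (s \<otimes> b) \<otimes> d" by (rule bexE)
  have "a \<otimes> (t \<otimes> u) = b \<otimes> d \<otimes> s" using d e uC by (simp add: m_ac)
  hence "x = y \<otimes>\<^bsub>L\<^esub> fr d u" using e uC d u S_mult by (simp add: fr_mult fr_eq_iff)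
  thus "\<exists>z\<in>carrier L. x = y \<otimes>\<^bsub>L\<^esub> z" using fr_closed[OF d(1) u(1)] by blast
qed

end

lemma (in domain) homog_closed_imp_int_closed:
  assumes "homog_closed R"
  shows "integrally_closed_domain R"
proof -
  define S where "S = carrier R - {\<zero>}"
  have "submonoid S R" by unfold_locales (auto simp: S_def integral_iff)
  then interpret F: domain_localization R S
    by (intro domain_localization.intro domain_localization_axioms.intro domain_axioms) (simp_all add: S_def)
  let ?K = "localization R S"
  let ?R' = "(\<lambda>a. fraction R S a \<one>) ` carrier R"
  interpret K: domain ?K by (rule F.domain_L)
  have "x \<in> ?R'" if x: "x \<in> carrier ?K" and i: "integral_over ?K ?R' x" for x
  proof -
    obtain \<alpha> \<beta> where e: "x = F.fr \<alpha> \<beta>" "\<alpha> \<in> carrier R" "\<beta> \<in> S" using F.fr_cases[OF x] by blast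
    have b: "\<beta> \<in> carrier R" "\<beta> \<noteq> \<zero>" using e by (auto simp: S_def)
    obtain p where p: "p \<noteq> []" "set p \<subseteq> ?R'" "hd p = \<one>\<^bsub>?K\<^esub>" "K.eval p x = \<zero>\<^bsub>?K\<^esub>"
      using i unfolding integral_over_def by (auto simp: univ_poly_def polynomial_def)
    have "\<exists>ls. set ls \<subseteq> carrier R \<and> p = map F.\<iota> ls"
      using p(2)
    proof (induction p)
      case (Cons y p)
      then obtain a ls where "a \<in> carrier R" "y = F.\<iota> a" "set ls \<subseteq> carrier R" "p = map F.\<iota> ls" by auto
      thus ?case by (intro exI[of _ "a # ls"]) auto
    qed auto
    then obtain ls where ls: "set ls \<subseteq> carrier R" "p = map F.\<iota> ls" by blast
    have pow: "\<beta> [^] k \<in> S" for k :: nat using b integral_iff by (induction k) (auto simp: S_def)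
    have xpow: "x [^]\<^bsub>?K\<^esub> k = F.fr (\<alpha> [^] k) (\<beta> [^] k)" for k :: nat
      by (induction k) (use e b pow in \<open>auto simp: F.fr_one F.fr_mult\<close>)
    \<comment> \<open>The homogenized value has degree \<open>length ls - 1\<close>, so over the
      denominator \<open>\<beta> [^] length ls\<close> one more factor \<open>\<beta>\<close> is
      needed.\<close>
    have ev: "K.eval (map F.\<iota> ls) x = F.fr (\<beta> \<otimes> heval R ls \<alpha> \<beta>) (\<beta> [^] length ls)" if "set ls \<subseteq> carrier R" for ls
      using that
    proof (induction ls)
      case Nil
      thus ?case using b by (simp add: F.fr_zero)
    next
      case (Cons l ls)
      let ?n = "length ls"
      let ?h = "heval R ls \<alpha> \<beta>"
      have cl: "l \<in> carrier R" "?h \<in> carrier R" "\<beta> [^] ?n \<in> carrier R" "\<alpha> [^] ?n \<in> carrier R"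
        using Cons.prems e b by auto
      have "K.eval (map F.\<iota> (l # ls)) x = F.\<iota> l \<otimes>\<^bsub>?K\<^esub> x [^]\<^bsub>?K\<^esub> ?n \<oplus>\<^bsub>?K\<^esub> K.eval (map F.\<iota> ls) x"
        by simp
      also have "\<dots> = F.fr (l \<otimes> \<alpha> [^] ?n) (\<beta> [^] ?n) \<oplus>\<^bsub>?K\<^esub> F.fr (\<beta> \<otimes> ?h) (\<beta> [^] ?n)"
        using Cons cl pow F.S_one by (simp add: xpow F.fr_mult)
      also have "\<dots> = F.fr ((l \<otimes> \<alpha> [^] ?n) \<otimes> \<beta> [^] ?n \<oplus> (\<beta> \<otimes> ?h) \<otimes> \<beta> [^] ?n) (\<beta> [^] ?n \<otimes> \<beta> [^] ?n)"
        using cl b pow by (simp add: F.fr_add)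
      also have "\<dots> = F.fr (\<beta> \<otimes> heval R (l # ls) \<alpha> \<beta>) (\<beta> [^] length (l # ls))"
        using cl b e pow[of "Suc ?n"] pow F.S_mult by (subst F.fr_eq_iff) (simp_all add: r_distr l_distr m_ac)
      finally show ?case .
    qed
    have "F.fr (\<beta> \<otimes> heval R ls \<alpha> \<beta>) (\<beta> [^] length ls) = \<zero>\<^bsub>?K\<^esub>" using p(4) ev[OF ls(1)] ls(2) by simp
    moreover have hc: "heval R ls \<alpha> \<beta> \<in> carrier R" using ls e b by simp
    ultimately have "\<beta> \<otimes> heval R ls \<alpha> \<beta> = \<zero>" using F.fr_eq_zero_iff pow b by simp
    hence h0: "heval R ls \<alpha> \<beta> = \<zero>" using b hc integral by blast
    obtain l ls' where l: "ls = l # ls'" using p(1) ls(2) by (cases ls) auto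
    have "F.fr l \<one> = F.fr \<one> \<one>" using p(3) by (simp add: ls(2) l F.fr_one)
    hence l1: "l = \<one>" using ls(1) l F.S_one by (subst (asm) F.fr_eq_iff) auto
    have "\<exists>c\<in>carrier R. \<alpha> = \<beta> \<otimes> c"
      by (rule assms[unfolded homog_closed_def, rule_format, of ls'])
         (use h0 ls(1) e(2) b in \<open>simp_all add: l l1\<close>)
    then obtain c where c: "c \<in> carrier R" "\<alpha> = \<beta> \<otimes> c" by blast
    have "x = F.\<iota> c" unfolding e(1) using e b c F.S_one by (subst F.fr_eq_iff) (auto simp: m_ac)
    thus ?thesis using c by blast
  qed
  thus ?thesis unfolding integrally_closed_domain_def Let_def S_def[symmetric]
    using domain_axioms by blast
qed

lemma (in domain) homog_closed_imp_normal:
  assumes "homog_closed R"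
  shows "normal_ring R"
  unfolding normal_ring_def
proof (intro allI impI)
  fix P assume P: "primeideal P R"
  interpret P: primeideal P R by (rule P)
  have "submonoid (carrier R - P) R"
  proof
    show "\<one> \<in> carrier R - P" using P.I_notcarr P.one_imp_carrier by auto
  qed (use P.I_prime in auto)
  then interpret F: domain_localization R "carrier R - P"
    by (intro domain_localization.intro domain_localization_axioms.intro domain_axioms) simp_all
  interpret L: domain "localization R (carrier R - P)" by (rule F.domain_L)
  show "integrally_closed_domain (localization R (carrier R - P))"
    by (rule L.homog_closed_imp_int_closed[OF F.homog_closed_L[OF assms]])
qed

section \<open>Normality of the invariant ring\<close>

text \<open>The powers of an integral fraction f/g have the common denominator g^N, by repeated use
  of the equation. This is the hypothesis of \<open>mpoly_completely_integrally_closed\<close> with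
  \<open>c = g ^ ?N\<close>.\<close>

lemma heval_integral_dvd:
  fixes f g :: "('x::linorder) mpoly"
  assumes g: "g \<noteq> 0" and eq: "heval class_alg (1 # ls) f g = 0"
  shows "g dvd f"
proof -
  let ?N = "length ls"
  let ?H = "heval class_alg ls f g"
  have fN: "f ^ ?N = - (g * ?H)"
    using eq by (simp add: class_alg_simps class_alg_nat_pow eq_neg_iff_add_eq_0)
  \<comment> \<open>The terms of \<open>heval\<close> are l f^(r-1-i) g^i with r =
    \<open>length ls\<close>: each power of \<open>f\<close> that is missing is made up by one of
    \<open>g\<close>.\<close>
  have tail: "g ^ (e + length ls - 1) dvd C * (f ^ e * heval class_alg ls f g)"
    if "\<And>j. j < e + length ls \<Longrightarrow> g ^ j dvd C * f ^ j" for e C and ls :: "'x mpoly list"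
    using that
  proof (induction ls)
    case (Cons l ls)
    let ?n = "length ls"
    have 1: "g ^ (e + ?n) dvd C * f ^ (e + ?n)" using Cons.prems by simp
    have 2: "g ^ (e + ?n) dvd g * (C * (f ^ e * heval class_alg ls f g))"
    proof (cases ls)
      case Nil
      thus ?thesis by (simp add: class_alg_simps)
    next
      case (Cons l' ls')
      have "g ^ (e + ?n - 1) dvd C * (f ^ e * heval class_alg ls f g)"
        using Cons.IH[OF Cons.prems] by simp
      hence "g * g ^ (e + ?n - 1) dvd g * (C * (f ^ e * heval class_alg ls f g))" by (intro mult_dvd_mono) auto
      moreover have "g * g ^ (e + ?n - 1) = g ^ (e + ?n)" using Cons by simp
      ultimately show ?thesis by (simp only:)
    qed
    have "C * (f ^ e * heval class_alg (l # ls) f g) =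
        l * (C * f ^ (e + ?n)) + g * (C * (f ^ e * heval class_alg ls f g))"
      by (simp add: class_alg_simps class_alg_nat_pow power_add algebra_simps)
    thus ?case using 1 2 by (auto intro: dvd_add)
  qed (simp add: class_alg_simps)
  have "g ^ k dvd g ^ ?N * f ^ k" for k
  proof (induction k rule: less_induct)
    case (less k)
    show ?case
    proof (cases "k \<le> ?N")
      case True
      thus ?thesis by (intro dvd_mult2 le_imp_power_dvd)
    next
      case False
      define e where "e = k - ?N"
      have k: "k = e + ?N" "e > 0" using False by (auto simp: e_def)
      have "g ^ (k - 1) dvd g ^ ?N * (f ^ e * ?H)"
        using tail[of e ls "g ^ ?N"] less k by simp
      hence "g * g ^ (k - 1) dvd g * (g ^ ?N * (f ^ e * ?H))" by (intro mult_dvd_mono) auto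
      moreover have "g * g ^ (k - 1) = g ^ k" using k by (simp flip: power_Suc)
      moreover have "g * (g ^ ?N * (f ^ e * ?H)) = - (g ^ ?N * f ^ k)"
        by (simp add: k power_add fN mult_ac)
      ultimately show ?thesis by (simp only: dvd_minus_iff)
    qed
  qed
  moreover have "g ^ ?N \<noteq> 0" using g by simp
  ultimately show ?thesis using mpoly_completely_integrally_closed[OF g] by blast
qed

lemma act_line:
  "act n G H (\<lambda>x. w x + c * d x) z = act n G H w z + c * act n G H d z"
  by (cases z) (simp_all add: act_def algebra_simps sum.distrib sum_distrib_left)

text \<open>The factor \<open>g\<close> cancels because the action is linear, so that all functions are polynomial on lines.\<close>

lemma invariant_quotient:
  fixes g h :: "(coord \<times> nat) mpoly"
  assumes g0: "g \<noteq> 0" and g: "\<And>w. peval (coeffs_at (act n G H w)) g = peval (coeffs_at w) g"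
    and gh: "\<And>w. peval (coeffs_at (act n G H w)) (g * h) = peval (coeffs_at w) (g * h)"
  shows "peval (coeffs_at (act n G H w)) h = peval (coeffs_at w) h"
proof -
  have zero: "peval (coeffs_at w) g * (peval (coeffs_at (act n G H w)) h - peval (coeffs_at w) h) = 0" for w
    using gh[of w] by (simp add: g right_diff_distrib)
  obtain a where a: "peval a g \<noteq> (0 :: complex)" using g0 peval_eq_0_imp_eq_0 by blast
  \<comment> \<open>The line runs from \<open>w\<close> at t = 0 to a point with coordinates
    \<open>a\<close> at t = 1, where \<open>g\<close> does not vanish.\<close>
  define d where "d x = Abs_fps (\<lambda>k. a (x, k)) - w x" for x
  have d: "coeffs_at (\<lambda>x. w x + d x) = a" by (auto simp: coeffs_at_def d_def)
  let ?l = "\<lambda>w d. peval (\<lambda>x. [:coeffs_at w x, coeffs_at d x:]) :: (coord \<times> nat) mpoly \<Rightarrow> complex poly"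
  have l: "poly (?l w d p) t = peval (coeffs_at (\<lambda>x. w x + fps_const t * d x)) p" for w d p t
    unfolding peval_line by (simp add: coeffs_at_def case_prod_unfold)
  have "poly (?l w d g * (?l (act n G H w) (act n G H d) h - ?l w d h)) t = 0" for t
    unfolding poly_mult poly_diff l act_line[symmetric] by (rule zero)
  hence "?l w d g * (?l (act n G H w) (act n G H d) h - ?l w d h) = 0" using poly_all_0_iff_0 by blast
  moreover have "poly (?l w d g) 1 \<noteq> 0" unfolding l using a d by simp
  ultimately have "?l (act n G H w) (act n G H d) h - ?l w d h = 0" by auto
  hence "poly (?l (act n G H w) (act n G H d) h) 0 = poly (?l w d h) 0" by simp
  thus ?thesis unfolding l by simp
qed

section \<open>The jet algebra of Z as a ring of invariant polynomials\<close>

context quotient_jets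
begin

interpretation AZ: cring AZ by (rule algebra.M_cring[OF algZ])

text \<open>Identifies \<open>AZ\<close> with the invariants among the polynomials in the jet
  coordinates. By \<open>jv_\<Psi>\<close> the preimage under \<open>\<Psi>\<close> is
  unique.\<close>

definition ev :: "(coord mpoly \<times> nat) mpoly set \<Rightarrow> (coord \<times> nat) mpoly" where
  "ev a = inv_into (carrier PV) \<Psi> (pm_star m n a)"

lemma ev:
  assumes "a \<in> carrier AZ"
  shows "ev a \<in> carrier PV" "\<Psi> (ev a) = pm_star m n a"
proof -
  have "pm_star m n a \<in> \<Psi> ` carrier PV" unfolding \<Psi>_surj by (rule alg_homD(2)[OF pm_star_hom assms])
  thus "ev a \<in> carrier PV" "\<Psi> (ev a) = pm_star m n a"
    unfolding ev_def by (rule inv_into_into, rule f_inv_into_f)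
qed

lemma peval_ev: "a \<in> carrier AZ \<Longrightarrow> peval (coeffs_at w) (ev a) = jv m w (pm_star m n a)"
  using jv_\<Psi>[OF ev(1), of a w] ev(2)[of a] by simp

lemma jv_pm_star_hom: "(\<lambda>a. jv m w (pm_star m n a)) \<in> alg_hom AZ complex_alg"
  by (rule alg_hom_comp[OF pm_star_hom jv_hom])

lemma ev_hom: "ring_hom_cring AZ class_alg ev"
proof (intro ring_hom_cring.intro ring_hom_cring_axioms.intro AZ.cring_axioms cring_class_alg ring_hom_memI)
  note h = alg_homD[OF jv_pm_star_hom, unfolded complex_alg_simps]
  show "ev a \<in> carrier class_alg" for a by (rule class_alg_UNIV)
  show "ev (a \<otimes>\<^bsub>AZ\<^esub> b) = ev a \<otimes>\<^bsub>class_alg\<^esub> ev b" if "a \<in> carrier AZ" "b \<in> carrier AZ" for a b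
    unfolding class_alg_simps by (rule poly_eqI_jets) (simp add: peval_ev that h)
  show "ev (a \<oplus>\<^bsub>AZ\<^esub> b) = ev a \<oplus>\<^bsub>class_alg\<^esub> ev b" if "a \<in> carrier AZ" "b \<in> carrier AZ" for a b
    unfolding class_alg_simps by (rule poly_eqI_jets) (simp add: peval_ev that h)
  show "ev \<one>\<^bsub>AZ\<^esub> = \<one>\<^bsub>class_alg\<^esub>"
    unfolding class_alg_simps by (rule poly_eqI_jets) (simp add: peval_ev h)
qed

lemma ev_inj: "a \<in> carrier AZ \<Longrightarrow> b \<in> carrier AZ \<Longrightarrow> ev a = ev b \<Longrightarrow> a = b"
  using pm_star_inj ev(2) by (metis inj_onD)

lemma ev_invariant: "a \<in> carrier AZ \<Longrightarrow> SL_pair n G H \<Longrightarrow> peval (coeffs_at (act n G H w)) (ev a) = peval (coeffs_at w) (ev a)"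
proof -
  assume a: "a \<in> carrier AZ" and GH: "SL_pair n G H"
  have "pm_star m n a \<in> carrier (O_Vm_inv m n)" unfolding pm_star_image[symmetric] using a by (rule imageI)
  thus ?thesis unfolding peval_ev[OF a] O_Vm_inv_iff[OF n0] using GH by blast
qed

interpretation E: ring_hom_cring AZ class_alg ev by (rule ev_hom)

lemma ev_zero: "ev \<zero>\<^bsub>AZ\<^esub> = 0" and ev_one: "ev \<one>\<^bsub>AZ\<^esub> = 1"
  using E.hom_zero E.hom_one by (simp_all add: class_alg_simps)

lemma ev_mult: "a \<in> carrier AZ \<Longrightarrow> b \<in> carrier AZ \<Longrightarrow> ev (a \<otimes>\<^bsub>AZ\<^esub> b) = ev a * ev b"
  using E.hom_mult by (simp add: class_alg_simps)

lemma domain_AZ: "domain AZ"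
proof (intro domain.intro domain_axioms.intro AZ.cring_axioms)
  show "\<one>\<^bsub>AZ\<^esub> \<noteq> \<zero>\<^bsub>AZ\<^esub>" using ev_zero ev_one by (metis zero_neq_one)
  fix a b assume ab: "a \<otimes>\<^bsub>AZ\<^esub> b = \<zero>\<^bsub>AZ\<^esub>" "a \<in> carrier AZ" "b \<in> carrier AZ"
  hence "ev a * ev b = 0" using ev_mult ev_zero by metis
  hence "ev a = 0 \<or> ev b = 0" by simp
  thus "a = \<zero>\<^bsub>AZ\<^esub> \<or> b = \<zero>\<^bsub>AZ\<^esub>"
    using ev_inj[OF ab(2) AZ.zero_closed] ev_inj[OF ab(3) AZ.zero_closed] ev_zero by auto
qed

text \<open>A polynomial quotient of two invariants is invariant, hence in the image of p_m^*, so
  divisibility of polynomials descends to \<open>AZ\<close>. This is how normality uses the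
  surjectivity of p_m^*.\<close>

lemma ev_dvd:
  assumes a: "a \<in> carrier AZ" and b: "b \<in> carrier AZ" "b \<noteq> \<zero>\<^bsub>AZ\<^esub>" and dvd: "ev b dvd ev a"
  shows "\<exists>c\<in>carrier AZ. a = b \<otimes>\<^bsub>AZ\<^esub> c"
proof -
  let ?S = "coords n \<times> {k. enat k \<le> m}"
  \<comment> \<open>The quotient \<open>h\<close> might involve variables that are not jet
    coordinates of V up to order m; these are set to 0.\<close>
  let ?p = "peval (\<lambda>x. if x \<in> ?S then poly_var x else 0)"
  obtain h where h: "ev a = ev b * h" using dvd by (auto simp: dvd_def)
  have proj: "?p q = q" if "q \<in> carrier PV" for q
    using peval_cong[OF that, of "\<lambda>x. if x \<in> ?S then poly_var x else 0" poly_var] by (simp add: peval_var_id)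
  define h0 where "h0 = ?p h"
  have h0: "h0 \<in> carrier PV"
    unfolding h0_def by (rule peval_closed[OF in_poly_alg_UNIV]) (auto intro: poly_var_closed poly_alg_zero_closed)
  have eq: "ev a = ev b * h0"
    using arg_cong[OF h, of ?p] proj[OF ev(1)[OF a]] proj[OF ev(1)[OF b(1)]] by (simp add: h0_def)
  have b0: "ev b \<noteq> 0" using ev_inj[OF b(1) AZ.zero_closed] b(2) ev_zero by auto
  have inv: "jv m (act n G H w) (\<Psi> h0) = jv m w (\<Psi> h0)" if GH: "SL_pair n G H" for G H w
    unfolding jv_\<Psi>[OF h0]
    by (rule invariant_quotient[OF b0 ev_invariant[OF b(1) GH]])
       (simp only: eq[symmetric] ev_invariant[OF a GH])
  have "\<Psi> h0 \<in> carrier (O_Vm_inv m n)"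
    unfolding O_Vm_inv_iff[OF n0] using alg_homD(2)[OF \<Psi>_hom h0] inv by blast
  then obtain c where c: "c \<in> carrier AZ" "pm_star m n c = \<Psi> h0" unfolding pm_star_image[symmetric] by (metis imageE)
  have "ev c = h0" by (rule poly_eqI_jets) (simp add: peval_ev[OF c(1)] c(2) jv_\<Psi>[OF h0])
  hence "ev a = ev (b \<otimes>\<^bsub>AZ\<^esub> c)" using ev_mult[OF b(1) c(1)] eq by simp
  hence "a = b \<otimes>\<^bsub>AZ\<^esub> c" using a b(1) c(1) by (intro ev_inj AZ.m_closed)
  thus ?thesis using c(1) by blast
qed

lemma homog_closed_AZ: "homog_closed AZ"
  unfolding homog_closed_def
proof (intro allI impI)
  fix ls a b
  assume ls: "set ls \<subseteq> carrier AZ" and a: "a \<in> carrier AZ" and b: "b \<in> carrier AZ" "b \<noteq> \<zero>\<^bsub>AZ\<^esub>"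
    and eq: "heval AZ (\<one>\<^bsub>AZ\<^esub> # ls) a b = \<zero>\<^bsub>AZ\<^esub>"
  have "heval class_alg (map ev (\<one>\<^bsub>AZ\<^esub> # ls)) (ev a) (ev b) = ev (heval AZ (\<one>\<^bsub>AZ\<^esub> # ls) a b)"
    by (rule heval_hom[OF ev_hom]) (use ls a b in auto)
  hence "heval class_alg (1 # map ev ls) (ev a) (ev b) = 0" unfolding eq ev_zero list.map ev_one .
  moreover have "ev b \<noteq> 0" using ev_inj[OF b(1) AZ.zero_closed] b(2) ev_zero by auto
  ultimately have "ev b dvd ev a" by (intro heval_integral_dvd)
  thus "\<exists>c\<in>carrier AZ. a = b \<otimes>\<^bsub>AZ\<^esub> c" by (rule ev_dvd[OF a b])
qed

lemma normal_AZ: "normal_ring AZ"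
  by (rule domain.homog_closed_imp_normal[OF domain_AZ homog_closed_AZ])

end

theorem theorem4p4:
  fixes n :: nat
  assumes "n \<ge> 2"
  shows "(\<forall>m::nat. normal_ring (jet_alg (enat m) (O_Z n))) \<and>
         (\<forall>m::enat. pm_star m n \<in> ring_iso (jet_alg m (O_Z n)) (O_Vm_inv m n))"
proof (intro conjI allI)
  fix m :: nat
  interpret quotient_jets n "enat m" by unfold_locales (rule assms)
  show "normal_ring (jet_alg (enat m) (O_Z n))" by (rule normal_AZ)
next
  fix m :: enat
  interpret quotient_jets n m by unfold_locales (rule assms)
  show "pm_star m n \<in> ring_iso (jet_alg m (O_Z n)) (O_Vm_inv m n)" by (rule pm_star_iso)
qed

end
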